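(* Let $X$ be a Banach space. Suppose $\mathcal A(X)$ contains a bounded net of projections $(P_\alpha)_{\alpha\in A}$ such that $P_\alpha\to I_X$ strongly and $P_\alpha^*\to I_{X^*}$ strongly. Set $X_\alpha=\mathrm{rg}\,P_\alpha$ $(\alpha\in A)$. Then $\mathcal A(X)$ is amenable if and only if there is a constant $K>0$ such that for every $\alpha\in A$ there exists $\beta=\beta(\alpha)\in A$ such that $\mathcal F(X_\beta,X_\alpha)\widehat{\otimes}\mathcal F(X_\alpha,X_\beta)$ contains a generalized diagonal for $\mathcal F(X_\alpha)$ of norm no greater than $K$.
   Context: $\mathcal F(X,Y)$ denotes the continuous finite-rank operators $X\to Y$ with the operator norm, $\mathcal F(X)=\mathcal F(X,X)$; $\mathcal A(X)$ is the operator norm closure of $\mathcal F(X)$ in the algebra $\mathcal B(X)$ of bounded operators on $X$ (approximable operators). $\mathrm{rg}$ denotes range, and $I_X$ the identity operator on $X$. $\widehat\otimes$ is the projective tensor product, with norm $\|\cdot\|_\wedge$. Amenability: a Banach algebra $\mathcal A$ is amenable if every continuous derivation from $\mathcal A$ into the dual of any Banach $\mathcal A$-bimodule is inner; equivalently, $\mathcal A$ has an approximate diagonal, i.e. a bounded net $(d_\alpha)$ in $\mathcal A\widehat\otimes\mathcal A$ with $\pi(d_\alpha)a\to a$ and $a\cdot d_\alpha-d_\alpha\cdot a\to 0$ for all $a\in\mathcal A$, where $\pi(a\otimes b)=ab$, $a\cdot(b\otimes c)=ab\otimes c$, $(b\otimes c)\cdot a=b\otimes ca$. Generalized diagonal: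 let $X,Y$ be finite-dimensional Banach spaces and $\mathcal A$ a subalgebra of $\mathcal F(X)$. An element $\Delta\in\mathcal F(Y,X)\widehat\otimes\mathcal F(X,Y)$ is a generalized diagonal for $\mathcal A$ if (i) $W\Delta=\Delta W$ for all $W\in\mathcal A$, and (ii) $\pi(\Delta)W=W$ for all $W\in\mathcal A$, where $W(R\otimes S)=WR\otimes S$, $(R\otimes S)W=R\otimes SW$, $\pi(R\otimes S)=RS$. *)

theory Defs
  imports "HOL-Analysis.Analysis"
begin

text \<open>
  The scalar field is a type of sort \<open>{real_normed_field, euclidean_space}\<close>. By the
  Gelfand-Mazur theorem such a type is (isometrically) the field of real or of complex numbers,
  so real and complex Banach spaces are treated simultaneously. The type class \<open>banach\<close> supplies
  the underlying real Banach space; \<open>s\<close> is the multiplication by scalars.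
\<close>

definition banach_space_over ::
  "('k::{real_normed_field, euclidean_space} \<Rightarrow> 'x::banach \<Rightarrow> 'x) \<Rightarrow> bool" where
  "banach_space_over s \<longleftrightarrow>
     vector_space s \<and>
     (\<forall>r x. s (of_real r) x = r *\<^sub>R x) \<and>
     (\<forall>c x. norm (s c x) = norm c * norm x)"


subsection \<open>Operators between subspaces\<close>

text \<open>
  An operator from a subspace \<open>Y\<close> to a subspace \<open>Z\<close> is represented by the function that extends
  it by \<open>0\<close> outside \<open>Y\<close>. With this convention \<^const>\<open>onorm\<close> is the operator norm of operators
  on \<open>Y\<close> (the lemma \<open>onorm_bounded_ops\<close> below).
\<close>

definition bounded_ops ::
  "('k::{real_normed_field, euclidean_space} \<Rightarrow> 'x::banach \<Rightarrow> 'x) \<Rightarrow>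
    'x set \<Rightarrow> 'x set \<Rightarrow> ('x \<Rightarrow> 'x) set" where
  "bounded_ops s Y Z = {T.
     (\<forall>x\<in>Y. T x \<in> Z) \<and> (\<forall>x. x \<notin> Y \<longrightarrow> T x = 0) \<and>
     (\<forall>x\<in>Y. \<forall>y\<in>Y. T (x + y) = T x + T y) \<and>
     (\<forall>c. \<forall>x\<in>Y. T (s c x) = s c (T x)) \<and>
     (\<exists>B. \<forall>x\<in>Y. norm (T x) \<le> B * norm x)}"

lemma onorm_bounded_ops:
  assumes "T \<in> bounded_ops s Y Z" and "0 \<in> Y"
  shows "onorm T = (SUP x\<in>Y. norm (T x) / norm x)"
proof -
  have "range (\<lambda>x. norm (T x) / norm x) = (\<lambda>x. norm (T x) / norm x) ` Y"
  proof (intro equalityI subsetI)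
    fix r assume "r \<in> range (\<lambda>x. norm (T x) / norm x)"
    then obtain x where r: "r = norm (T x) / norm x" by auto
    show "r \<in> (\<lambda>x. norm (T x) / norm x) ` Y"
    proof (cases "x \<in> Y")
      case False
      with assms have "T x = 0" by (auto simp: bounded_ops_def)
      with r have "r = norm (T 0) / norm (0::'a)" by simp
      with assms(2) show ?thesis by blast
    qed (use r in auto)
  qed auto
  then show ?thesis by (simp add: onorm_def)
qed

definition finite_rank_ops ::
  "('k::{real_normed_field, euclidean_space} \<Rightarrow> 'x::banach \<Rightarrow> 'x) \<Rightarrow>
    'x set \<Rightarrow> 'x set \<Rightarrow> ('x \<Rightarrow> 'x) set" where
  "finite_rank_ops s Y Z =
     {T \<in> bounded_ops s Y Z. \<exists>B. finite B \<and> T ` Y \<subseteq> module.span s B}"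

definition approximable_ops ::
  "('k::{real_normed_field, euclidean_space} \<Rightarrow> 'x::banach \<Rightarrow> 'x) \<Rightarrow> ('x \<Rightarrow> 'x) set" where
  "approximable_ops s =
     {T \<in> bounded_ops s UNIV UNIV.
        \<forall>e>0. \<exists>S \<in> finite_rank_ops s UNIV UNIV. onorm (\<lambda>x. T x - S x) < e}"

definition dual_space ::
  "('k::{real_normed_field, euclidean_space} \<Rightarrow> 'x::banach \<Rightarrow> 'x) \<Rightarrow> ('x \<Rightarrow> 'k) set" where
  "dual_space s = {f.
     (\<forall>x y. f (x + y) = f x + f y) \<and> (\<forall>c x. f (s c x) = c * f x) \<and>
     (\<exists>B. \<forall>x. norm (f x) \<le> B * norm x)}"


subsection \<open>Projective tensor products of operator spaces\<close>

text \<open>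
  \<open>U\<close> and \<open>V\<close> are linear spaces of operators, normed by \<^const>\<open>onorm\<close>. A tensor is the functional
  it induces on the bounded bilinear forms on \<open>U \<times> V\<close>, with \<open>R \<otimes> S\<close> corresponding to
  \<open>\<phi> \<mapsto> \<phi> R S\<close>; bounded bilinear forms separate the points of the projective tensor product.
  Every element of the completion is the sum of a series \<open>\<Sum>n. R n \<otimes> S n\<close> with
  \<open>(\<Sum>n. \<parallel>R n\<parallel> \<parallel>S n\<parallel>) < \<infinity>\<close>, and its projective norm is the infimum of the latter
  sums over all such representations. A tensor is \<open>0\<close> by convention on functions that are not
  bounded bilinear forms.
\<close>

definition bounded_bilinear_forms ::
  "('k::{real_normed_field, euclidean_space} \<Rightarrow> 'x::banach \<Rightarrow> 'x) \<Rightarrow>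
    ('x \<Rightarrow> 'x) set \<Rightarrow> ('x \<Rightarrow> 'x) set \<Rightarrow> (('x \<Rightarrow> 'x) \<Rightarrow> ('x \<Rightarrow> 'x) \<Rightarrow> 'k) set" where
  "bounded_bilinear_forms s U V = {\<phi>.
     (\<forall>R\<in>U. \<forall>R'\<in>U. \<forall>S\<in>V. \<phi> (\<lambda>x. R x + R' x) S = \<phi> R S + \<phi> R' S) \<and>
     (\<forall>R\<in>U. \<forall>S\<in>V. \<forall>S'\<in>V. \<phi> R (\<lambda>x. S x + S' x) = \<phi> R S + \<phi> R S') \<and>
     (\<forall>c. \<forall>R\<in>U. \<forall>S\<in>V. \<phi> (\<lambda>x. s c (R x)) S = c * \<phi> R S) \<and>
     (\<forall>c. \<forall>R\<in>U. \<forall>S\<in>V. \<phi> R (\<lambda>x. s c (S x)) = c * \<phi> R S) \<and>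
     (\<exists>B. \<forall>R\<in>U. \<forall>S\<in>V. norm (\<phi> R S) \<le> B * onorm R * onorm S)}"

type_synonym ('x, 'k) tensor = "(('x \<Rightarrow> 'x) \<Rightarrow> ('x \<Rightarrow> 'x) \<Rightarrow> 'k) \<Rightarrow> 'k"

definition abs_convergent ::
  "('x::banach \<Rightarrow> 'x) set \<Rightarrow> ('x \<Rightarrow> 'x) set \<Rightarrow> (nat \<Rightarrow> 'x \<Rightarrow> 'x) \<Rightarrow> (nat \<Rightarrow> 'x \<Rightarrow> 'x) \<Rightarrow> bool" where
  "abs_convergent U V R S \<longleftrightarrow>
     (\<forall>n. R n \<in> U) \<and> (\<forall>n. S n \<in> V) \<and> summable (\<lambda>n. onorm (R n) * onorm (S n))"

definition tensor_series ::
  "('k::{real_normed_field, euclidean_space} \<Rightarrow> 'x::banach \<Rightarrow> 'x) \<Rightarrow>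
    ('x \<Rightarrow> 'x) set \<Rightarrow> ('x \<Rightarrow> 'x) set \<Rightarrow>
    (nat \<Rightarrow> 'x \<Rightarrow> 'x) \<Rightarrow> (nat \<Rightarrow> 'x \<Rightarrow> 'x) \<Rightarrow> ('x, 'k) tensor" where
  "tensor_series s U V R S =
     (\<lambda>\<phi>. if \<phi> \<in> bounded_bilinear_forms s U V then \<Sum>n. \<phi> (R n) (S n) else 0)"

definition proj_tensor ::
  "('k::{real_normed_field, euclidean_space} \<Rightarrow> 'x::banach \<Rightarrow> 'x) \<Rightarrow>
    ('x \<Rightarrow> 'x) set \<Rightarrow> ('x \<Rightarrow> 'x) set \<Rightarrow> ('x, 'k) tensor set" where
  "proj_tensor s U V = {tensor_series s U V R S | R S. abs_convergent U V R S}"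

definition proj_norm ::
  "('k::{real_normed_field, euclidean_space} \<Rightarrow> 'x::banach \<Rightarrow> 'x) \<Rightarrow>
    ('x \<Rightarrow> 'x) set \<Rightarrow> ('x \<Rightarrow> 'x) set \<Rightarrow> ('x, 'k) tensor \<Rightarrow> real" where
  "proj_norm s U V u =
     Inf {\<Sum>n. onorm (R n) * onorm (S n) | R S.
       abs_convergent U V R S \<and> u = tensor_series s U V R S}"

text \<open>\<open>W (R \<otimes> S) = W R \<otimes> S\<close> and \<open>(R \<otimes> S) W = R \<otimes> S W\<close>\<close>

definition left_act ::
  "('k::{real_normed_field, euclidean_space} \<Rightarrow> 'x::banach \<Rightarrow> 'x) \<Rightarrow>
    ('x \<Rightarrow> 'x) set \<Rightarrow> ('x \<Rightarrow> 'x) set \<Rightarrow> ('x \<Rightarrow> 'x) \<Rightarrow> ('x, 'k) tensor \<Rightarrow> ('x, 'k) tensor" where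
  "left_act s U V W u =
     (\<lambda>\<phi>. if \<phi> \<in> bounded_bilinear_forms s U V then u (\<lambda>R S. \<phi> (W \<circ> R) S) else 0)"

definition right_act ::
  "('k::{real_normed_field, euclidean_space} \<Rightarrow> 'x::banach \<Rightarrow> 'x) \<Rightarrow>
    ('x \<Rightarrow> 'x) set \<Rightarrow> ('x \<Rightarrow> 'x) set \<Rightarrow> ('x \<Rightarrow> 'x) \<Rightarrow> ('x, 'k) tensor \<Rightarrow> ('x, 'k) tensor" where
  "right_act s U V W u =
     (\<lambda>\<phi>. if \<phi> \<in> bounded_bilinear_forms s U V then u (\<lambda>R S. \<phi> R (S \<circ> W)) else 0)"

text \<open>
  The product map \<open>\<pi> (R \<otimes> S) = R S\<close>. The value does not depend on the representing series,
  because the forms \<open>(R, S) \<mapsto> f (R (S x))\<close> with a bounded functional \<open>f\<close> are bounded and bilinear.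
\<close>

definition tensor_mult ::
  "('k::{real_normed_field, euclidean_space} \<Rightarrow> 'x::banach \<Rightarrow> 'x) \<Rightarrow>
    ('x \<Rightarrow> 'x) set \<Rightarrow> ('x \<Rightarrow> 'x) set \<Rightarrow> ('x, 'k) tensor \<Rightarrow> 'x \<Rightarrow> 'x" where
  "tensor_mult s U V u =
     (THE C. \<exists>R S. abs_convergent U V R S \<and> u = tensor_series s U V R S \<and>
        C = (\<lambda>x. \<Sum>n. R n (S n x)))"


subsection \<open>Amenability and generalized diagonals\<close>

text \<open>
  Amenability of a closed subalgebra of the bounded operators, as existence of an approximate
  diagonal. A bounded net of tensors enters through the proper filter of its tails.
\<close>

definition amenable ::
  "('k::{real_normed_field, euclidean_space} \<Rightarrow> 'x::banach \<Rightarrow> 'x) \<Rightarrow> ('x \<Rightarrow> 'x) set \<Rightarrow> bool" where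
  "amenable s \<A> \<longleftrightarrow>
     (\<exists>F :: ('x, 'k) tensor filter. F \<noteq> bot \<and>
        (\<exists>M. \<forall>\<^sub>F d in F. d \<in> proj_tensor s \<A> \<A> \<and> proj_norm s \<A> \<A> d \<le> M) \<and>
        (\<forall>a\<in>\<A>. ((\<lambda>d. onorm (\<lambda>x. tensor_mult s \<A> \<A> d (a x) - a x)) \<longlongrightarrow> 0) F) \<and>
        (\<forall>a\<in>\<A>. ((\<lambda>d. proj_norm s \<A> \<A>
            (\<lambda>\<phi>. left_act s \<A> \<A> a d \<phi> - right_act s \<A> \<A> a d \<phi>)) \<longlongrightarrow> 0) F))"

text \<open>
  Used for finite-dimensional subspaces \<open>Y\<close>, \<open>Z\<close> and a subalgebra \<open>\<A>\<close> of the operators on \<open>Z\<close>;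
  \<open>\<Delta>\<close> lies in the projective tensor product of \<open>\<F>(Y, Z)\<close> and \<open>\<F>(Z, Y)\<close>.
\<close>

definition generalized_diagonal ::
  "('k::{real_normed_field, euclidean_space} \<Rightarrow> 'x::banach \<Rightarrow> 'x) \<Rightarrow>
    'x set \<Rightarrow> 'x set \<Rightarrow> ('x \<Rightarrow> 'x) set \<Rightarrow> ('x, 'k) tensor \<Rightarrow> bool" where
  "generalized_diagonal s Y Z \<A> \<Delta> \<longleftrightarrow>
     (let U = finite_rank_ops s Y Z; V = finite_rank_ops s Z Y in
        \<Delta> \<in> proj_tensor s U V \<and>
        (\<forall>W\<in>\<A>. left_act s U V W \<Delta> = right_act s U V W \<Delta>) \<and>
        (\<forall>W\<in>\<A>. tensor_mult s U V \<Delta> \<circ> W = W))"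


subsection \<open>Nets\<close>

definition directed_set :: "'i set \<Rightarrow> ('i \<Rightarrow> 'i \<Rightarrow> bool) \<Rightarrow> bool" where
  "directed_set A le \<longleftrightarrow>
     A \<noteq> {} \<and> reflp_on A le \<and> transp_on A le \<and>
     (\<forall>a\<in>A. \<forall>b\<in>A. \<exists>c\<in>A. le a c \<and> le b c)"

definition tails :: "'i set \<Rightarrow> ('i \<Rightarrow> 'i \<Rightarrow> bool) \<Rightarrow> 'i filter" where
  "tails A le = (INF a\<in>A. principal {b\<in>A. le a b})"

end

theory Submission
  imports Defs
begin

text \<open>
  Given generalized diagonals \<open>\<Delta>\<^sub>\<alpha>\<close>, the tensors \<open>\<Sum>n. R\<^sub>n P\<^sub>\<beta> \<otimes> S\<^sub>n P\<^sub>\<alpha>\<close> (where \<open>\<Delta>\<^sub>\<alpha> = \<Sum>n. R\<^sub>n \<otimes> S\<^sub>n\<close>)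
  form an approximate diagonal, because \<open>P\<^sub>\<alpha> a P\<^sub>\<alpha>\<close> converges to \<open>a\<close> in norm for approximable \<open>a\<close>.

  Conversely, let \<open>d = \<Sum>n. R\<^sub>n \<otimes> S\<^sub>n\<close> be a member of an approximate diagonal. The compression
  \<open>\<Sum>n. P\<^sub>\<alpha> R\<^sub>n | X\<^sub>\<beta> \<otimes> P\<^sub>\<beta> S\<^sub>n | X\<^sub>\<alpha>\<close> almost commutes with the operators on the
  finite-dimensional space \<open>X\<^sub>\<alpha>\<close>, with an error independent of \<open>\<beta>\<close>, and for large \<open>\<beta>\<close> the trace of
  its image under \<open>\<pi>\<close> is close to \<open>dim X\<^sub>\<alpha>\<close>. Averaging over matrix units makes it commute exactly,
  at a small cost in norm, and \<open>\<pi>\<close> then maps it to a multiple of the identity close to 1.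
\<close>

subsection \<open>Bounded maps and their operator norm\<close>

text \<open>The dimension of X_\<alpha> is not controlled, so every error that grows with it has to
  be made small before it enters the bound. This dictates the order of choices: the tolerances
  depend on \<alpha>, then \<open>d\<close> is taken far enough along the approximate diagonal, and
  \<beta> comes last, because the speed at which P_\<beta> may be dropped from the products R_n
  P_\<beta> S_n depends on \<open>d\<close>. A single scalar suffices for this last choice: after
  averaging, \<pi> gives \<open>t\<close> times the identity, where \<open>t\<close> is the trace
  before averaging. Dividing by \<open>t\<close>, which has at least half the expected size,
  produces the factor 2 in the final constant 2 (N N (M + 1) + 1); here M bounds the approximate
  diagonal and N the projections. Tensors are functionals on bilinear forms, so identities between
  tensors are checked by comparing forms on single pairs (R, S), while norm estimates are read off
  the representing series. Evaluating \<pi> requires functionals that separate points; the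
  coordinates of the vectors P_\<alpha> x supply them.\<close>

definition bounded_map :: "('a::real_normed_vector \<Rightarrow> 'b::real_normed_vector) \<Rightarrow> bool" where
  "bounded_map T \<longleftrightarrow> (\<exists>B. \<forall>x. norm (T x) \<le> B * norm x)"

lemma bounded_mapI: "(\<And>x. norm (T x) \<le> B * norm x) \<Longrightarrow> bounded_map T"
  by (auto simp: bounded_map_def)

lemma bounded_map_bdd_above:
  assumes "bounded_map T"
  shows "bdd_above (range (\<lambda>x. norm (T x) / norm x))"
proof -
  from assms obtain B where B: "\<And>x. norm (T x) \<le> B * norm x" by (auto simp: bounded_map_def)
  have "norm (T y) / norm y \<le> max B 0" for y
  proof (cases "norm y = 0")
    case False
    have "norm (T y) \<le> max B 0 * norm y"
      by (rule order_trans[OF B]) (intro mult_right_mono; simp)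
    with False show ?thesis by (simp add: pos_divide_le_eq)
  qed simp
  then show ?thesis by (rule bdd_aboveI2)
qed

text \<open>An operator on a proper subspace, extended by 0, is not linear on the whole space, so
  the estimate has to rest on boundedness alone.\<close>

lemma norm_le_onorm:
  assumes "bounded_map T"
  shows "norm (T x) \<le> onorm T * norm x"
proof (cases "norm x = 0")
  case True
  then show ?thesis using assms by (metis bounded_map_def mult_zero_right)
next
  case False
  have "norm (T x) / norm x \<le> onorm T"
    unfolding onorm_def by (intro cSUP_upper UNIV_I bounded_map_bdd_above assms)
  with False show ?thesis by (simp add: pos_divide_le_eq)
qed

lemma onorm_nonneg:
  fixes T :: "'a::real_normed_vector \<Rightarrow> 'b::real_normed_vector"
  assumes "bounded_map T"
  shows "0 \<le> onorm T"
proof -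
  \<comment> \<open>Division by 0 yields 0, so the supremum is taken over a set containing
    0.\<close>
  have "norm (T 0) / norm (0::'a) \<le> onorm T"
    unfolding onorm_def by (intro cSUP_upper UNIV_I bounded_map_bdd_above assms)
  then show ?thesis by simp
qed

lemma bounded_map_add:
  assumes "bounded_map S" "bounded_map T"
  shows "bounded_map (\<lambda>x. S x + T x)"
  by (rule bounded_mapI[where B = "onorm S + onorm T"])
    (use assms in \<open>auto simp: distrib_right intro!: norm_triangle_mono norm_le_onorm\<close>)

lemma onorm_add_le:
  assumes "bounded_map S" "bounded_map T"
  shows "onorm (\<lambda>x. S x + T x) \<le> onorm S + onorm T"
  by (rule onorm_bound)
    (use assms in \<open>auto simp: distrib_right onorm_nonneg intro!: norm_triangle_mono norm_le_onorm
      add_nonneg_nonneg\<close>)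

lemma bounded_map_compose:
  assumes "bounded_map S" "bounded_map T"
  shows "bounded_map (\<lambda>x. S (T x))"
proof (rule bounded_mapI[where B = "onorm S * onorm T"])
  fix x
  have "norm (S (T x)) \<le> onorm S * norm (T x)" using assms by (simp add: norm_le_onorm)
  also have "\<dots> \<le> onorm S * (onorm T * norm x)"
    using assms by (intro mult_left_mono norm_le_onorm onorm_nonneg)
  finally show "norm (S (T x)) \<le> onorm S * onorm T * norm x" by (simp add: mult.assoc)
qed

lemma onorm_compose_le:
  assumes "bounded_map S" "bounded_map T"
  shows "onorm (\<lambda>x. S (T x)) \<le> onorm S * onorm T"
proof (rule onorm_bound)
  fix x
  have "norm (S (T x)) \<le> onorm S * norm (T x)" using assms by (simp add: norm_le_onorm)
  also have "\<dots> \<le> onorm S * (onorm T * norm x)"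
    using assms by (intro mult_left_mono norm_le_onorm onorm_nonneg)
  finally show "norm (S (T x)) \<le> onorm S * onorm T * norm x" by (simp add: mult.assoc)
qed (use assms in \<open>simp add: onorm_nonneg\<close>)

lemma bounded_map_minus:
  assumes "bounded_map S" "bounded_map T"
  shows "bounded_map (\<lambda>x. S x - T x)"
proof -
  have "bounded_map (\<lambda>x. - T x)" using assms(2) by (simp add: bounded_map_def)
  from bounded_map_add[OF assms(1) this] show ?thesis by simp
qed

lemma bounded_map_compose_minus:
  assumes "bounded_map S" "bounded_map T" "bounded_map R"
  shows "bounded_map (\<lambda>x. S (T x) - R x)"
  using bounded_map_compose[OF assms(1,2)] assms(3) by (rule bounded_map_minus)

section \<open>Scalars from \<open>'k\<close> and finite-dimensional spans\<close>

locale banach_over =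
  fixes s :: "'k::{real_normed_field, euclidean_space} \<Rightarrow> 'x::banach \<Rightarrow> 'x"
  assumes banach_space: "banach_space_over s"
begin

text \<open>From here on \<open>span\<close>, \<open>independent\<close> and \<open>subspace\<close>
  refer to the scalars \<open>'k\<close>, not to the reals.\<close>

sublocale vector_space s
  using banach_space by (simp add: banach_space_over_def)

lemma scale_of_real: "s (of_real r) x = r *\<^sub>R x"
  and norm_scale: "norm (s c x) = norm c * norm x"
  using banach_space by (simp_all add: banach_space_over_def)

lemma bounded_bilinear_scale: "bounded_bilinear s"
proof
  show "s (r *\<^sub>R a) b = r *\<^sub>R s a b" for r a b
    by (simp add: scale_of_real[symmetric] scaleR_conv_of_real)
  show "s a (r *\<^sub>R b) = r *\<^sub>R s a b" for r a b
    by (simp add: scale_of_real[symmetric] mult.commute)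
  show "\<exists>K. \<forall>a b. norm (s a b) \<le> norm a * norm b * K"
    by (auto simp: norm_scale intro!: exI[of _ 1])
qed (simp_all add: scale_left_distrib scale_right_distrib)

lemma bounded_map_scale: "bounded_map T \<Longrightarrow> bounded_map (\<lambda>x. s c (T x))"
  by (rule bounded_mapI[where B = "norm c * onorm T"])
    (auto simp: norm_scale mult.assoc intro!: mult_left_mono norm_le_onorm)

lemma onorm_scale_le: "bounded_map T \<Longrightarrow> onorm (\<lambda>x. s c (T x)) \<le> norm c * onorm T"
  by (rule onorm_bound)
    (auto simp: norm_scale mult.assoc onorm_nonneg intro!: mult_left_mono norm_le_onorm)

text \<open>Induction on the basis: the bound for \<open>B\<close> makes \<open>span B\<close>
  complete and hence closed, so a new vector \<open>a\<close> outside it has positive distance from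
  it, and this distance bounds the coefficient of \<open>a\<close>.\<close>

lemma coordinates_bounded:
  assumes "finite B" "independent B"
  shows "\<exists>C. 0 \<le> C \<and> (\<forall>c. (\<Sum>b\<in>B. norm (c b)) \<le> C * norm (\<Sum>b\<in>B. s (c b) b))"
  using assms
proof (induction B rule: finite_induct)
  case empty
  show ?case by (auto intro!: exI[of _ 0])
next
  case (insert a B)
  from insert.prems have ind: "independent B" by (rule independent_mono) auto
  with insert.IH obtain C where C: "0 \<le> C"
    "\<And>c. (\<Sum>b\<in>B. norm (c b)) \<le> C * norm (\<Sum>b\<in>B. s (c b) b)" by blast
  have spanE: "\<exists>c. x = (\<Sum>b\<in>B. s (c b) b)" if "x \<in> span B" for x
    using that insert.hyps(1) by (auto simp: span_finite)
  \<comment> \<open>By the bound for \<open>B\<close>, a Cauchy sequence in the span has Cauchy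
    coordinates, and these converge in \<open>'k\<close>.\<close>
  have "complete (span B)"
  proof (rule completeI)
    fix f :: "nat \<Rightarrow> 'x" assume f: "\<forall>n. f n \<in> span B" and cau: "Cauchy f"
    from f have "\<forall>n. \<exists>c. f n = (\<Sum>b\<in>B. s (c b) b)" using spanE by blast
    then obtain c where c: "\<And>n. f n = (\<Sum>b\<in>B. s (c n b) b)" by metis
    have "Cauchy (\<lambda>n. c n b)" if b: "b \<in> B" for b
    proof (rule CauchyI)
      fix e :: real assume "e > 0"
      then have "e / (C + 1) > 0" using C by simp
      from CauchyD[OF cau this] obtain M where
        M: "\<And>m n. m \<ge> M \<Longrightarrow> n \<ge> M \<Longrightarrow> norm (f m - f n) < e / (C + 1)" by blast
      have "norm (c m b - c n b) < e" if "m \<ge> M" "n \<ge> M" for m n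
      proof -
        have "norm (c m b - c n b) \<le> (\<Sum>b\<in>B. norm (c m b - c n b))"
          using b insert.hyps(1) member_le_sum[of b B "\<lambda>b. norm (c m b - c n b)"] by simp
        also have "\<dots> \<le> C * norm (\<Sum>b\<in>B. s (c m b - c n b) b)" by (rule C)
        also have "(\<Sum>b\<in>B. s (c m b - c n b) b) = f m - f n"
          by (simp add: c scale_left_diff_distrib sum_subtractf)
        also have "C * norm (f m - f n) \<le> C * (e / (C + 1))"
          using M[OF that] C by (intro mult_left_mono) auto
        also have "\<dots> < e" using C \<open>e > 0\<close> by (simp add: field_simps)
        finally show ?thesis .
      qed
      then show "\<exists>M. \<forall>m\<ge>M. \<forall>n\<ge>M. norm (c m b - c n b) < e" by blast
    qed
    then have "\<forall>b\<in>B. \<exists>l. (\<lambda>n. c n b) \<longlonglongrightarrow> l"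
      by (auto simp: Cauchy_convergent_iff convergent_def)
    then obtain l where l: "\<And>b. b \<in> B \<Longrightarrow> (\<lambda>n. c n b) \<longlonglongrightarrow> l b" by metis
    have "f \<longlonglongrightarrow> (\<Sum>b\<in>B. s (l b) b)"
      unfolding c
      by (intro tendsto_sum bounded_bilinear.tendsto[OF bounded_bilinear_scale] l tendsto_const)
    moreover have "(\<Sum>b\<in>B. s (l b) b) \<in> span B" by (intro span_sum span_scale span_base)
    ultimately show "\<exists>l\<in>span B. f \<longlonglongrightarrow> l" by blast
  qed
  then have cl: "closed (span B)" by (rule complete_imp_closed)
  have "a \<notin> span B"
    using insert.prems insert.hyps(2) by (simp add: independent_insert)
  with cl obtain d where "d > 0" "ball a d \<subseteq> - span B"
    by (metis ComplI open_Compl open_contains_ball)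
  then have d: "d > 0" "\<And>x. x \<in> span B \<Longrightarrow> d \<le> dist a x"
    by (auto simp: subset_eq not_less[symmetric])
  \<comment> \<open>The distance estimate for \<open>a\<close>, scaled by \<open>k\<close>.\<close>
  have far: "norm k * d \<le> norm (s k a + x)" if x: "x \<in> span B" for k x
  proof (cases "k = 0")
    case False
    have "d \<le> dist a (s (- inverse k) x)" by (intro d span_scale x)
    also have "\<dots> = norm (a + s (inverse k) x)" by (simp add: dist_norm)
    finally have "norm k * d \<le> norm k * norm (a + s (inverse k) x)" by (intro mult_left_mono) auto
    also have "\<dots> = norm (s k (a + s (inverse k) x))" by (simp add: norm_scale)
    also have "s k (a + s (inverse k) x) = s k a + x"
      using False by (simp add: scale_right_distrib)
    finally show ?thesis .
  qed simp
  \<comment> \<open>The coefficient of \<open>a\<close> is at most \<open>norm ?z / d\<close>. The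
    remaining ones are at most \<open>C * norm ?y\<close> in total, and passing from
    \<open>?y\<close> to \<open>?z\<close> costs once more the coefficient of \<open>a\<close> times
    \<open>norm a\<close>.\<close>
  define D where "D = (1 + C * norm a) / d + C"
  have "(\<Sum>b\<in>insert a B. norm (c b)) \<le> D * norm (\<Sum>b\<in>insert a B. s (c b) b)" for c
  proof -
    let ?y = "\<Sum>b\<in>B. s (c b) b" and ?z = "\<Sum>b\<in>insert a B. s (c b) b"
    have z: "?z = s (c a) a + ?y" using insert.hyps by simp
    have "?y \<in> span B" by (intro span_sum span_scale span_base)
    from far[OF this, of "c a"] have ca: "norm (c a) \<le> norm ?z / d"
      using d by (simp add: z pos_le_divide_eq)
    have "norm ?y \<le> norm ?z + norm (s (c a) a)"
      using norm_triangle_ineq4[of ?z "s (c a) a"] by (simp add: z)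
    also have "\<dots> = norm ?z + norm (c a) * norm a" by (simp add: norm_scale)
    finally have y: "norm ?y \<le> norm ?z + norm (c a) * norm a" .
    have "(\<Sum>b\<in>insert a B. norm (c b)) = norm (c a) + (\<Sum>b\<in>B. norm (c b))"
      using insert.hyps by simp
    also have "\<dots> \<le> norm (c a) + C * norm ?y" using C by simp
    also have "\<dots> \<le> norm (c a) + C * (norm ?z + norm (c a) * norm a)"
      using C(1) y by (intro add_left_mono mult_left_mono)
    also have "\<dots> = norm (c a) * (1 + C * norm a) + C * norm ?z" by (simp add: algebra_simps)
    also have "\<dots> \<le> norm ?z / d * (1 + C * norm a) + C * norm ?z"
      using ca C(1) by (intro add_right_mono mult_right_mono) auto
    also have "\<dots> = D * norm ?z" by (simp add: D_def algebra_simps add_divide_distrib)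
    finally show ?thesis .
  qed
  moreover have "0 \<le> D" using C(1) d(1) by (simp add: D_def)
  ultimately show ?case by blast
qed

section \<open>Operators between subspaces and functionals\<close>

lemma bounded_opsD:
  assumes "T \<in> bounded_ops s Y Z"
  shows "x \<in> Y \<Longrightarrow> T x \<in> Z" "x \<notin> Y \<Longrightarrow> T x = 0"
    "x \<in> Y \<Longrightarrow> y \<in> Y \<Longrightarrow> T (x + y) = T x + T y" "x \<in> Y \<Longrightarrow> T (s c x) = s c (T x)"
  using assms by (auto simp: bounded_ops_def)

lemma bounded_ops_bounded_map:
  assumes "T \<in> bounded_ops s Y Z"
  shows "bounded_map T"
proof -
  from assms obtain B where B: "\<forall>x\<in>Y. norm (T x) \<le> B * norm x"
    and o: "\<forall>x. x \<notin> Y \<longrightarrow> T x = 0" by (auto simp: bounded_ops_def)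
  \<comment> \<open>\<open>B\<close> may be negative if Y has no nonzero vector; outside Y, where T
    vanishes, a nonnegative factor is required.\<close>
  have "norm (T x) \<le> max B 0 * norm x" for x
  proof (cases "x \<in> Y")
    case True
    with B have "norm (T x) \<le> B * norm x" by blast
    also have "\<dots> \<le> max B 0 * norm x" by (intro mult_right_mono) auto
    finally show ?thesis .
  qed (use o in simp)
  then show ?thesis by (rule bounded_mapI)
qed

lemma bounded_opsI:
  assumes "\<And>x. x \<in> Y \<Longrightarrow> T x \<in> Z" "\<And>x. x \<notin> Y \<Longrightarrow> T x = 0"
    "\<And>x y. x \<in> Y \<Longrightarrow> y \<in> Y \<Longrightarrow> T (x + y) = T x + T y"
    "\<And>c x. x \<in> Y \<Longrightarrow> T (s c x) = s c (T x)" "bounded_map T"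
  shows "T \<in> bounded_ops s Y Z"
  using assms by (auto simp: bounded_ops_def bounded_map_def)

lemma bounded_ops_zero:
  assumes "T \<in> bounded_ops s Y Z"
  shows "T 0 = 0"
  using norm_le_onorm[OF bounded_ops_bounded_map[OF assms], of 0] by simp

lemma bounded_ops_sum:
  assumes "T \<in> bounded_ops s Y Z" "subspace Y" "finite I" "\<And>i. i \<in> I \<Longrightarrow> f i \<in> Y"
  shows "T (\<Sum>i\<in>I. f i) = (\<Sum>i\<in>I. T (f i))"
  using assms(3,4)
proof (induction I rule: finite_induct)
  case empty
  show ?case by (simp add: bounded_ops_zero[OF assms(1)])
next
  case (insert i I)
  then have "T (f i + sum f I) = T (f i) + T (sum f I)"
    by (intro bounded_opsD(3)[OF assms(1)] subspace_sum[OF assms(2)]) auto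
  with insert show ?case by simp
qed

lemma bounded_ops_compose:
  assumes "S \<in> bounded_ops s Y Z" "T \<in> bounded_ops s X Y"
  shows "S \<circ> T \<in> bounded_ops s X Z"
proof (rule bounded_opsI)
  show "bounded_map (S \<circ> T)"
    using bounded_map_compose[OF bounded_ops_bounded_map[OF assms(1)] bounded_ops_bounded_map[OF
        assms(2)]]
    by (simp add: comp_def)
qed (simp_all add: bounded_opsD[OF assms(1)] bounded_opsD[OF assms(2)] bounded_ops_zero[OF
    assms(1)])

lemma dual_spaceD:
  assumes "f \<in> dual_space s"
  shows "f (x + y) = f x + f y" "f (s c x) = c * f x" "bounded_map f"
  using assms by (auto simp: dual_space_def bounded_map_def)

lemma dual_space_bounded_linear:
  assumes "f \<in> dual_space s"
  shows "bounded_linear f"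
proof (rule bounded_linear_intro[where K = "onorm f"])
  fix x r
  show "f (r *\<^sub>R x) = r *\<^sub>R f x"
    using dual_spaceD(2)[OF assms, of "of_real r" x]
      by (simp add: scale_of_real scaleR_conv_of_real)
  show "norm (f x) \<le> norm x * onorm f"
    using norm_le_onorm[OF dual_spaceD(3)[OF assms]] by (simp add: mult.commute)
qed (simp add: dual_spaceD(1)[OF assms])

lemma bounded_ops_bounded_linear:
  assumes "T \<in> bounded_ops s UNIV UNIV"
  shows "bounded_linear T"
proof (rule bounded_linear_intro[where K = "onorm T"])
  fix x r
  show "T (r *\<^sub>R x) = r *\<^sub>R T x"
    using bounded_opsD(4)[OF assms, of x "of_real r"] by (simp add: scale_of_real)
  show "norm (T x) \<le> norm x * onorm T"
    using norm_le_onorm[OF bounded_ops_bounded_map[OF assms]] by (simp add: mult.commute)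
qed (use bounded_opsD(3)[OF assms] in simp)

text \<open>The functionals are the coordinates of \<open>T x\<close> in a basis of the range. They
  are defined on the whole space because T is, and \<open>coordinates_bounded\<close> makes them
  bounded.\<close>

lemma finite_rank_expansion:
  assumes T: "T \<in> finite_rank_ops s UNIV UNIV"
  obtains B g where "finite B" "independent B" "B \<subseteq> range T" "\<And>b. b \<in> B \<Longrightarrow> g b \<in> dual_space s"
    "\<And>x. T x = (\<Sum>b\<in>B. s (g b x) b)"
proof -
  from T obtain F where F: "finite F" "range T \<subseteq> span F" and TB: "T \<in> bounded_ops s UNIV UNIV"
    by (auto simp: finite_rank_ops_def)
  obtain B where B: "B \<subseteq> range T" "independent B" "range T \<subseteq> span B"
    using basis_exists[of "range T"] by metis
  from B(1) F(2) have "B \<subseteq> span F" by blast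
  with F(1) B(2) have fin: "finite B" using independent_span_bound by blast
  from coordinates_bounded[OF fin B(2)] obtain C where C: "0 \<le> C"
    "\<And>c. (\<Sum>b\<in>B. norm (c b)) \<le> C * norm (\<Sum>b\<in>B. s (c b) b)" by blast
  define g where "g b x = representation B (T x) b" for b x
  have Tx: "T x \<in> span B" for x using B(3) by auto
  have expand: "T x = (\<Sum>b\<in>B. s (g b x) b)" for x
    unfolding g_def using sum_representation_eq[OF B(2) Tx fin] by simp
  have "g b \<in> dual_space s" if b: "b \<in> B" for b
  proof -
    have "g b (x + y) = g b x + g b y" for x y
      unfolding g_def using bounded_opsD(3)[OF TB, of x y] representation_add[OF B(2) Tx Tx] by simp
    moreover have "g b (s c x) = c * g b x" for c x
      unfolding g_def using bounded_opsD(4)[OF TB, of x c] representation_scale[OF B(2) Tx] by simp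
    moreover have "norm (g b x) \<le> C * onorm T * norm x" for x
    proof -
      have "norm (g b x) \<le> (\<Sum>b\<in>B. norm (g b x))"
        using b fin member_le_sum[of b B "\<lambda>b. norm (g b x)"] by simp
      also have "\<dots> \<le> C * norm (T x)" using C(2)[of "\<lambda>b. g b x"] by (simp add: expand)
      also have "\<dots> \<le> C * (onorm T * norm x)"
        using C(1) by (intro mult_left_mono norm_le_onorm bounded_ops_bounded_map[OF TB])
      finally show ?thesis by (simp add: mult.assoc)
    qed
    ultimately show ?thesis unfolding dual_space_def by blast
  qed
  with fin B expand that show ?thesis by blast
qed

lemma approximable_bounded: "T \<in> approximable_ops s \<Longrightarrow> T \<in> bounded_ops s UNIV UNIV"
  by (simp add: approximable_ops_def)

section \<open>Approximable projections\<close>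

lemma projection_range_subspace:
  assumes PB: "P \<in> bounded_ops s UNIV UNIV" and PP: "\<And>x. P (P x) = P x"
  shows "subspace (range P)"
proof (rule subspaceI)
  show "0 \<in> range P" using bounded_ops_zero[OF PB] by (auto intro: range_eqI[of _ P 0])
  show "x + y \<in> range P" if "x \<in> range P" "y \<in> range P" for x y
  proof -
    from that have "P (x + y) = x + y" by (auto simp: bounded_opsD(3)[OF PB] PP)
    then show ?thesis by (metis rangeI)
  qed
  show "s c x \<in> range P" if "x \<in> range P" for c x
  proof -
    from that have "P (s c x) = s c x" by (auto simp: bounded_opsD(4)[OF PB] PP)
    then show ?thesis by (metis rangeI)
  qed
qed

text \<open>A projection at distance less than 1 from a finite-rank operator \<open>S\<close> has finite rank,
  because \<open>S\<close> is injective on its range.\<close>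

lemma approximable_projection_finite_rank:
  assumes P: "P \<in> approximable_ops s" and idem: "P \<circ> P = P"
  shows "P \<in> finite_rank_ops s UNIV UNIV"
proof -
  have PB: "P \<in> bounded_ops s UNIV UNIV" using P by (rule approximable_bounded)
  from P obtain S where S: "S \<in> finite_rank_ops s UNIV UNIV" and lt: "onorm (\<lambda>x. P x - S x) < 1"
    unfolding approximable_ops_def using zero_less_one by blast
  from S obtain F where F: "finite F" "range S \<subseteq> span F" and SB: "S \<in> bounded_ops s UNIV UNIV"
    by (auto simp: finite_rank_ops_def)
  have bd: "bounded_map (\<lambda>x. P x - S x)"
    using PB SB by (intro bounded_map_minus bounded_ops_bounded_map)
  have PP: "P (P x) = P x" for x using idem by (metis comp_apply)
  have sub: "subspace (range P)" using PB PP by (rule projection_range_subspace)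
  have hom: "module_hom s s S"
    unfolding module_hom_iff
    using module_axioms bounded_opsD(3,4)[OF SB UNIV_I] by simp
  have inj: "inj_on S (range P)"
  proof (rule inj_onI)
    fix y z assume yz: "y \<in> range P" "z \<in> range P" "S y = S z"
    define x where "x = y - z"
    have x: "x \<in> range P" "S x = 0"
      using yz subspace_diff[OF sub] by (simp_all add: x_def module_hom.diff[OF hom])
    \<comment> \<open>With \<open>P x = x\<close> and \<open>S x = 0\<close> the norm of x equals
      that of \<open>P x - S x\<close>, hence is at most a factor below 1 times itself.\<close>
    from x have "P x = x" using PP by auto
    with norm_le_onorm[OF bd, of x] x have "norm x \<le> onorm (\<lambda>x. P x - S x) * norm x" by simp
    then have "(1 - onorm (\<lambda>x. P x - S x)) * norm x \<le> 0" by (simp add: algebra_simps)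
    with lt have "x = 0" by (simp add: mult_le_0_iff)
    then show "y = z" by (simp add: x_def)
  qed
  obtain B where B: "B \<subseteq> range P" "independent B" "range P \<subseteq> span B"
    using basis_exists[of "range P"] by metis
  have spB: "span B \<subseteq> range P" using B(1) sub by (rule span_minimal)
  with inj have injB: "inj_on S (span B)" by (rule inj_on_subset)
  have "independent (S ` B)"
    using B(2) injB by (rule module_hom.independent_injective_image[OF hom])
  moreover have "S ` B \<subseteq> span F" using F by blast
  ultimately have "finite (S ` B)" using independent_span_bound[OF F(1)] by blast
  moreover have "inj_on S B" using injB span_superset by (rule inj_on_subset)
  ultimately have "finite B" by (rule finite_imageD)
  with B(3) PB show ?thesis by (auto simp: finite_rank_ops_def)
qed

text \<open>The basis lies in the range, so P fixes its members; uniqueness of coordinates then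
  makes the functionals biorthogonal to it.\<close>

lemma projection_expansion:
  assumes P: "P \<in> approximable_ops s" and idem: "P \<circ> P = P"
  obtains B g where "finite B" "B \<subseteq> range P" "\<And>b. b \<in> B \<Longrightarrow> g b \<in> dual_space s"
    "\<And>x. P x = (\<Sum>b\<in>B. s (g b x) b)"
    "\<And>b c. b \<in> B \<Longrightarrow> c \<in> B \<Longrightarrow> g b c = (if b = c then 1 else 0)"
proof -
  from finite_rank_expansion[OF approximable_projection_finite_rank[OF assms]]
  obtain B g where B: "finite B" "independent B" "B \<subseteq> range P" "\<And>b. b \<in> B \<Longrightarrow> g b \<in> dual_space s"
    and ex: "\<And>x. P x = (\<Sum>b\<in>B. s (g b x) b)" by metis
  have "g b c = (if b = c then 1 else 0)" if b: "b \<in> B" and c: "c \<in> B" for b c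
  proof -
    have "P c = c" using c B(3) idem by (metis comp_apply imageE subsetD)
    moreover have "(\<Sum>b\<in>B. s (if b = c then 1 else 0) b) = c"
      using c B(1) by (simp add: if_distrib[of "\<lambda>k. s k _"] sum.delta cong: if_cong)
    ultimately have "(\<Sum>b\<in>B. s (g b c - (if b = c then 1 else 0)) b) = 0"
      by (simp add: scale_left_diff_distrib sum_subtractf ex[symmetric])
    from independentD[OF B(2,1) subset_refl this b] show ?thesis by simp
  qed
  with B ex that show ?thesis by blast
qed

end

subsection \<open>Tensors and bounded bilinear forms\<close>

text \<open>Serves to merge the representing series of two tensors into one, the first at even and
  the second at odd positions.\<close>

lemma sums_interleave:
  fixes f g :: "nat \<Rightarrow> 'a::real_normed_vector"
  assumes "f sums x" "g sums y"
  shows "(\<lambda>n. if even n then f (n div 2) else g (n div 2)) sums (x + y)"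
proof -
  have "(\<lambda>n. if even n then f (n div 2) else 0) sums x"
    using assms(1)
    by (subst sums_mono_reindex[of "\<lambda>n. 2 * n", symmetric]) (auto simp: strict_mono_def elim!:
        evenE)
  moreover have "(\<lambda>n. if odd n then g (n div 2) else 0) sums y"
    using assms(2)
    by (subst sums_mono_reindex[of "\<lambda>n. 2 * n + 1", symmetric])
      (auto simp: strict_mono_def elim!: oddE)
  ultimately have "(\<lambda>n. (if even n then f (n div 2) else 0) + (if odd n then g (n div 2) else 0))
      sums (x + y)"
    by (rule sums_add)
  then show ?thesis by (rule back_subst[of "\<lambda>f. f sums _"]) auto
qed

context banach_over
begin

abbreviation forms :: "('x \<Rightarrow> 'x) set \<Rightarrow> ('x \<Rightarrow> 'x) set \<Rightarrow> (('x \<Rightarrow> 'x) \<Rightarrow> ('x \<Rightarrow> 'x) \<Rightarrow> 'k) set" where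
  "forms \<equiv> bounded_bilinear_forms s"

text \<open>The common interface of the finite-rank operators between two subspaces and of the
  approximable operators, so that one theory of tensors covers the small spaces and the whole
  algebra.\<close>

definition op_space :: "('x \<Rightarrow> 'x) set \<Rightarrow> bool" where
  "op_space U \<longleftrightarrow> (\<lambda>x. 0) \<in> U \<and> (\<forall>R\<in>U. \<forall>R'\<in>U. (\<lambda>x. R x + R' x) \<in> U) \<and>
     (\<forall>c. \<forall>R\<in>U. (\<lambda>x. s c (R x)) \<in> U) \<and> (\<forall>R\<in>U. bounded_map R)"

lemma op_spaceD:
  assumes "op_space U"
  shows "(\<lambda>x. 0) \<in> U" "R \<in> U \<Longrightarrow> R' \<in> U \<Longrightarrow> (\<lambda>x. R x + R' x) \<in> U"
    "R \<in> U \<Longrightarrow> (\<lambda>x. s c (R x)) \<in> U" "R \<in> U \<Longrightarrow> bounded_map R"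
  using assms by (auto simp: op_space_def)

lemma op_space_sum:
  assumes "op_space U" "finite I" "\<And>i. i \<in> I \<Longrightarrow> R i \<in> U"
  shows "(\<lambda>x. \<Sum>i\<in>I. R i x) \<in> U"
  using assms(2,3)
  by (induction I rule: finite_induct) (auto intro: op_spaceD[OF assms(1)])

text \<open>Bounded linear maps between operator spaces, of norm at most C. Multiplication by an
  operator on either side, restriction and compression are all of this kind.\<close>

definition op_map :: "('x \<Rightarrow> 'x) set \<Rightarrow> ('x \<Rightarrow> 'x) set \<Rightarrow> real \<Rightarrow> (('x \<Rightarrow> 'x) \<Rightarrow> 'x \<Rightarrow> 'x) \<Rightarrow> bool" where
  "op_map U U' C \<Phi> \<longleftrightarrow> 0 \<le> C \<and> (\<forall>R\<in>U. \<Phi> R \<in> U' \<and> onorm (\<Phi> R) \<le> C * onorm R) \<and>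
     (\<forall>R\<in>U. \<forall>R'\<in>U. \<Phi> (\<lambda>x. R x + R' x) = (\<lambda>x. \<Phi> R x + \<Phi> R' x)) \<and>
     (\<forall>c. \<forall>R\<in>U. \<Phi> (\<lambda>x. s c (R x)) = (\<lambda>x. s c (\<Phi> R x)))"

lemma op_mapD:
  assumes "op_map U U' C \<Phi>"
  shows "0 \<le> C" "R \<in> U \<Longrightarrow> \<Phi> R \<in> U'" "R \<in> U \<Longrightarrow> onorm (\<Phi> R) \<le> C * onorm R"
    "R \<in> U \<Longrightarrow> R' \<in> U \<Longrightarrow> \<Phi> (\<lambda>x. R x + R' x) = (\<lambda>x. \<Phi> R x + \<Phi> R' x)"
    "R \<in> U \<Longrightarrow> \<Phi> (\<lambda>x. s c (R x)) = (\<lambda>x. s c (\<Phi> R x))"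
  using assms by (auto simp: op_map_def)

lemma op_map_id: "op_map U U 1 (\<lambda>R. R)"
  by (simp add: op_map_def)

lemma formsD:
  assumes "\<phi> \<in> forms U V"
  shows "R \<in> U \<Longrightarrow> R' \<in> U \<Longrightarrow> S \<in> V \<Longrightarrow> \<phi> (\<lambda>x. R x + R' x) S = \<phi> R S + \<phi> R' S"
    "R \<in> U \<Longrightarrow> S \<in> V \<Longrightarrow> S' \<in> V \<Longrightarrow> \<phi> R (\<lambda>x. S x + S' x) = \<phi> R S + \<phi> R S'"
    "R \<in> U \<Longrightarrow> S \<in> V \<Longrightarrow> \<phi> (\<lambda>x. s c (R x)) S = c * \<phi> R S"
    "R \<in> U \<Longrightarrow> S \<in> V \<Longrightarrow> \<phi> R (\<lambda>x. s c (S x)) = c * \<phi> R S"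
    "\<exists>B. \<forall>R\<in>U. \<forall>S\<in>V. norm (\<phi> R S) \<le> B * onorm R * onorm S"
  using assms by (auto simp: bounded_bilinear_forms_def)

lemma forms_sum_left:
  assumes "\<phi> \<in> forms U V" "op_space U" "finite I" "\<And>i. i \<in> I \<Longrightarrow> R i \<in> U" "S \<in> V"
  shows "\<phi> (\<lambda>x. \<Sum>i\<in>I. s (c i) (R i x)) S = (\<Sum>i\<in>I. c i * \<phi> (R i) S)"
  using assms(3,4)
proof (induction I rule: finite_induct)
  case empty
  show ?case
    using formsD(3)[OF assms(1) op_spaceD(1)[OF assms(2)] assms(5), of 0] by simp
next
  case (insert i I)
  have "\<phi> (\<lambda>x. s (c i) (R i x) + (\<Sum>i\<in>I. s (c i) (R i x))) S
      = c i * \<phi> (R i) S + \<phi> (\<lambda>x. \<Sum>i\<in>I. s (c i) (R i x)) S"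
    using insert.prems insert.hyps assms
    by (subst formsD(1)[OF assms(1)]) (auto intro!: op_spaceD[OF assms(2)] op_space_sum simp:
        formsD(3)[OF assms(1)])
  with insert show ?case by simp
qed

lemma forms_sum_right:
  assumes "\<phi> \<in> forms U V" "op_space V" "finite I" "\<And>i. i \<in> I \<Longrightarrow> S i \<in> V" "R \<in> U"
  shows "\<phi> R (\<lambda>x. \<Sum>i\<in>I. s (c i) (S i x)) = (\<Sum>i\<in>I. c i * \<phi> R (S i))"
  using assms(3,4)
proof (induction I rule: finite_induct)
  case empty
  show ?case
    using formsD(4)[OF assms(1,5) op_spaceD(1)[OF assms(2)], of 0] by simp
next
  case (insert i I)
  have "\<phi> R (\<lambda>x. s (c i) (S i x) + (\<Sum>i\<in>I. s (c i) (S i x)))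
      = c i * \<phi> R (S i) + \<phi> R (\<lambda>x. \<Sum>i\<in>I. s (c i) (S i x))"
    using insert.prems insert.hyps assms
    by (subst formsD(2)[OF assms(1)]) (auto intro!: op_spaceD[OF assms(2)] op_space_sum simp:
        formsD(4)[OF assms(1)])
  with insert show ?case by simp
qed

lemma forms_add:
  assumes "\<phi> \<in> forms U V" "\<psi> \<in> forms U V" "op_space U" "op_space V"
  shows "(\<lambda>R S. \<phi> R S + \<psi> R S) \<in> forms U V"
proof -
  obtain B B' where "\<forall>R\<in>U. \<forall>S\<in>V. norm (\<phi> R S) \<le> B * onorm R * onorm S"
    "\<forall>R\<in>U. \<forall>S\<in>V. norm (\<psi> R S) \<le> B' * onorm R * onorm S"
    using formsD(5)[OF assms(1)] formsD(5)[OF assms(2)] by blast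
  then have "\<forall>R\<in>U. \<forall>S\<in>V. norm (\<phi> R S + \<psi> R S) \<le> (B + B') * onorm R * onorm S"
    by (auto simp: distrib_right intro!: norm_triangle_mono)
  then show ?thesis
    using formsD(1-4)[OF assms(1)] formsD(1-4)[OF assms(2)]
    unfolding bounded_bilinear_forms_def by (auto simp: distrib_left)
qed

lemma forms_zero: "(\<lambda>R S. 0) \<in> forms U V"
  by (auto simp: bounded_bilinear_forms_def intro!: exI[of _ 0])

lemma forms_scale:
  assumes "\<phi> \<in> forms U V"
  shows "(\<lambda>R S. c * \<phi> R S) \<in> forms U V"
proof -
  obtain B where B: "\<forall>R\<in>U. \<forall>S\<in>V. norm (\<phi> R S) \<le> B * onorm R * onorm S"
    using formsD(5)[OF assms(1)] by blast
  have "\<forall>R\<in>U. \<forall>S\<in>V. norm (c * \<phi> R S) \<le> (norm c * B) * onorm R * onorm S"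
    using B by (auto simp: norm_mult mult.assoc intro!: mult_left_mono)
  then show ?thesis
    using formsD(1-4)[OF assms(1)]
    unfolding bounded_bilinear_forms_def by (auto simp: distrib_left)
qed

lemma forms_sum:
  assumes "finite I" "\<And>i. i \<in> I \<Longrightarrow> \<phi> i \<in> forms U V" "op_space U" "op_space V"
  shows "(\<lambda>R S. \<Sum>i\<in>I. \<phi> i R S) \<in> forms U V"
  using assms(1,2)
  by (induction I rule: finite_induct) (auto simp: forms_zero intro!: forms_add assms(3,4))

text \<open>The conditions on a form only involve arguments from U and V, which are closed under the
  operations used. This matters because the value of a tensor depends on whether its argument is a
  form.\<close>

lemma forms_cong:
  assumes "op_space U" "op_space V" "\<And>R S. R \<in> U \<Longrightarrow> S \<in> V \<Longrightarrow> \<phi> R S = \<psi> R S"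
  shows "\<phi> \<in> forms U V \<longleftrightarrow> \<psi> \<in> forms U V"
proof -
  have "\<psi> \<in> forms U V" if "\<phi> \<in> forms U V" "\<And>R S. R \<in> U \<Longrightarrow> S \<in> V \<Longrightarrow> \<phi> R S = \<psi> R S" for \<phi> \<psi>
    using formsD[OF that(1)] op_spaceD(2,3)[OF assms(1)] op_spaceD(2,3)[OF assms(2)]
    unfolding bounded_bilinear_forms_def by (simp add: that(2)[symmetric])
  from this[of \<phi> \<psi>] this[of \<psi> \<phi>] assms(3) show ?thesis by auto
qed

text \<open>Dual to the tensor product of \<Phi> and \<Psi>: tensors are pushed forward by pulling
  forms back.\<close>

lemma forms_pullback:
  assumes \<phi>: "\<phi> \<in> forms U' V'" and \<Phi>: "op_map U U' C \<Phi>" and \<Psi>: "op_map V V' D \<Psi>"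
    and U: "op_space U" "op_space V" "op_space U'" "op_space V'"
  shows "(\<lambda>R S. \<phi> (\<Phi> R) (\<Psi> S)) \<in> forms U V"
proof -
  obtain B where B: "\<And>R S. R \<in> U' \<Longrightarrow> S \<in> V' \<Longrightarrow> norm (\<phi> R S) \<le> B * onorm R * onorm S"
    using formsD(5)[OF \<phi>] by blast
  \<comment> \<open>The absolute value is there because the bound of a form comes with no
    sign.\<close>
  have "norm (\<phi> (\<Phi> R) (\<Psi> S)) \<le> (\<bar>B\<bar> * C * D) * onorm R * onorm S" if R: "R \<in> U" and S: "S \<in> V"
    for R S
  proof -
    have nn: "0 \<le> onorm (\<Phi> R)" "0 \<le> onorm (\<Psi> S)" "0 \<le> onorm R" "0 \<le> onorm S"
      using op_spaceD(4)[OF U(3) op_mapD(2)[OF \<Phi> R]] op_spaceD(4)[OF U(4) op_mapD(2)[OF \<Psi> S]]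
        op_spaceD(4)[OF U(1) R] op_spaceD(4)[OF U(2) S] by (auto intro: onorm_nonneg)
    have "norm (\<phi> (\<Phi> R) (\<Psi> S)) \<le> B * onorm (\<Phi> R) * onorm (\<Psi> S)"
      using R S by (intro B op_mapD[OF \<Phi>] op_mapD[OF \<Psi>])
    also have "\<dots> = B * (onorm (\<Phi> R) * onorm (\<Psi> S))" by simp
    also have "\<dots> \<le> \<bar>B\<bar> * (onorm (\<Phi> R) * onorm (\<Psi> S))"
      using nn by (intro mult_right_mono) auto
    also have "\<dots> \<le> \<bar>B\<bar> * ((C * onorm R) * (D * onorm S))"
      using nn op_mapD(1)[OF \<Phi>]
      by (intro mult_left_mono mult_mono op_mapD(3)[OF \<Phi> R] op_mapD(3)[OF \<Psi> S] mult_nonneg_nonneg)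
          auto
    finally show ?thesis by (simp add: mult_ac)
  qed
  then show ?thesis
    using formsD(1-4)[OF \<phi>] op_mapD(2)[OF \<Phi>] op_mapD(2)[OF \<Psi>]
    unfolding bounded_bilinear_forms_def by (auto simp: op_mapD(4,5)[OF \<Phi>] op_mapD(4,5)[OF \<Psi>])
qed

section \<open>Tensors as absolutely convergent series\<close>

lemma forms_summable:
  assumes "abs_convergent U V R S" "\<phi> \<in> forms U V"
  shows "summable (\<lambda>n. \<phi> (R n) (S n))"
proof -
  obtain B where B: "\<forall>R\<in>U. \<forall>S\<in>V. norm (\<phi> R S) \<le> B * onorm R * onorm S"
    using formsD(5)[OF assms(2)] by blast
  have "summable (\<lambda>n. B * (onorm (R n) * onorm (S n)))"
    using assms(1) by (simp add: abs_convergent_def summable_mult)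
  then show ?thesis
    by (rule summable_comparison_test'[where N = 0])
      (use B assms(1) in \<open>auto simp: abs_convergent_def mult.assoc\<close>)
qed

text \<open>Membership in the tensor product and a norm bound in one predicate. For a function that
  is no tensor, \<open>proj_norm\<close> is an infimum over the empty set, so a bound on
  \<open>proj_norm\<close> alone carries no information.\<close>

definition tensor_le :: "('x \<Rightarrow> 'x) set \<Rightarrow> ('x \<Rightarrow> 'x) set \<Rightarrow> ('x, 'k) tensor \<Rightarrow> real \<Rightarrow> bool" where
  "tensor_le U V u r \<longleftrightarrow> (\<exists>R S. abs_convergent U V R S \<and> u = tensor_series s U V R S \<and>
     (\<Sum>n. onorm (R n) * onorm (S n)) \<le> r)"

lemma tensor_le_mem: "tensor_le U V u r \<Longrightarrow> u \<in> proj_tensor s U V"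
  by (auto simp: tensor_le_def proj_tensor_def)

lemma abs_convergent_nonneg:
  assumes "abs_convergent U V R S" "op_space U" "op_space V"
  shows "0 \<le> onorm (R n) * onorm (S n)" "0 \<le> (\<Sum>n. onorm (R n) * onorm (S n))"
proof -
  show *: "0 \<le> onorm (R n) * onorm (S n)" for n
    using assms(1) op_spaceD(4)[OF assms(2)] op_spaceD(4)[OF assms(3)]
    by (auto simp: abs_convergent_def intro!: mult_nonneg_nonneg onorm_nonneg)
  show "0 \<le> (\<Sum>n. onorm (R n) * onorm (S n))"
    using assms(1) * by (auto simp: abs_convergent_def intro: suminf_nonneg)
qed

lemma proj_norm_le:
  assumes "tensor_le U V u r" "op_space U" "op_space V"
  shows "proj_norm s U V u \<le> r"
proof -
  from assms(1) obtain R S where RS: "abs_convergent U V R S" "u = tensor_series s U V R S"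
    "(\<Sum>n. onorm (R n) * onorm (S n)) \<le> r" by (auto simp: tensor_le_def)
  have "proj_norm s U V u \<le> (\<Sum>n. onorm (R n) * onorm (S n))"
    unfolding proj_norm_def
    using RS abs_convergent_nonneg(2)[OF _ assms(2,3)]
    by (intro cInf_lower bdd_belowI[of _ 0]) auto
  with RS show ?thesis by simp
qed

lemma proj_norm_nonneg:
  assumes "u \<in> proj_tensor s U V" "op_space U" "op_space V"
  shows "0 \<le> proj_norm s U V u"
  unfolding proj_norm_def
  using assms(1) abs_convergent_nonneg(2)[OF _ assms(2,3)]
  by (intro cInf_greatest) (auto simp: proj_tensor_def)

text \<open>The inequality in the premise is strict because the infimum over the representing series
  need not be attained.\<close>

lemma tensor_le_proj_norm:
  assumes "u \<in> proj_tensor s U V" "proj_norm s U V u < r"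
  shows "tensor_le U V u r"
proof -
  have "\<exists>q\<in>{\<Sum>n. onorm (R n) * onorm (S n) | R S.
       abs_convergent U V R S \<and> u = tensor_series s U V R S}. q < r"
    by (rule cInf_lessD) (use assms in \<open>auto simp: proj_tensor_def proj_norm_def\<close>)
  then show ?thesis unfolding tensor_le_def by (auto intro: less_imp_le)
qed

lemma tensor_le_add:
  assumes "tensor_le U V u q" "tensor_le U V v r"
  shows "tensor_le U V (\<lambda>\<phi>. u \<phi> + v \<phi>) (q + r)"
proof -
  from assms obtain R S R' S' where *: "abs_convergent U V R S" "u = tensor_series s U V R S"
    "(\<Sum>n. onorm (R n) * onorm (S n)) \<le> q" "abs_convergent U V R' S'" "v = tensor_series s U V R' S'"
    "(\<Sum>n. onorm (R' n) * onorm (S' n)) \<le> r" by (auto simp: tensor_le_def)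
  define T where "T n = (if even n then R (n div 2) else R' (n div 2))" for n
  define T' where "T' n = (if even n then S (n div 2) else S' (n div 2))" for n
  have "(\<lambda>n. if even n then onorm (R (n div 2)) * onorm (S (n div 2))
      else onorm (R' (n div 2)) * onorm (S' (n div 2))) sums
      ((\<Sum>n. onorm (R n) * onorm (S n)) + (\<Sum>n. onorm (R' n) * onorm (S' n)))"
    using * by (intro sums_interleave[of "\<lambda>n. onorm (R n) * onorm (S n)" _ "\<lambda>n. onorm (R' n)
        * onorm (S' n)"]
        summable_sums) (auto simp: abs_convergent_def)
  then have sums: "(\<lambda>n. onorm (T n) * onorm (T' n)) sums
      ((\<Sum>n. onorm (R n) * onorm (S n)) + (\<Sum>n. onorm (R' n) * onorm (S' n)))"
    by (rule back_subst[of "\<lambda>f. f sums _"]) (auto simp: T_def T'_def)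
  have ac: "abs_convergent U V T T'"
    using * sums_summable[OF sums] by (auto simp: abs_convergent_def T_def T'_def)
  have "u \<phi> + v \<phi> = tensor_series s U V T T' \<phi>" for \<phi>
  proof (cases "\<phi> \<in> forms U V")
    case True
    have "(\<lambda>n. if even n then \<phi> (R (n div 2)) (S (n div 2)) else \<phi> (R' (n div 2)) (S' (n div 2)))
        sums
      ((\<Sum>n. \<phi> (R n) (S n)) + (\<Sum>n. \<phi> (R' n) (S' n)))"
      using forms_summable[OF *(1) True] forms_summable[OF *(4) True]
      by (intro sums_interleave[of "\<lambda>n. \<phi> (R n) (S n)" _ "\<lambda>n. \<phi> (R' n) (S' n)"] summable_sums)
    then have "(\<lambda>n. \<phi> (T n) (T' n)) sums ((\<Sum>n. \<phi> (R n) (S n)) + (\<Sum>n. \<phi> (R' n) (S' n)))"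
      by (rule back_subst[of "\<lambda>f. f sums _"]) (auto simp: T_def T'_def)
    with True show ?thesis by (simp add: * tensor_series_def sums_unique[symmetric])
  qed (simp add: * tensor_series_def)
  with ac sums_unique[OF sums] *(3,6) show ?thesis unfolding tensor_le_def by (intro exI[of _ T]
      exI[of _ T']) auto
qed

text \<open>The map \<open>\<Phi> \<otimes> \<Psi>\<close>; \<open>U\<close> and \<open>V\<close> carry the target.\<close>

definition tensor_map :: "('x \<Rightarrow> 'x) set \<Rightarrow> ('x \<Rightarrow> 'x) set \<Rightarrow> (('x \<Rightarrow> 'x) \<Rightarrow> 'x \<Rightarrow> 'x) \<Rightarrow>
    (('x \<Rightarrow> 'x) \<Rightarrow> 'x \<Rightarrow> 'x) \<Rightarrow> ('x, 'k) tensor \<Rightarrow> ('x, 'k) tensor" where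
  "tensor_map U V \<Phi> \<Psi> u = (\<lambda>\<phi>. if \<phi> \<in> forms U V then u (\<lambda>R S. \<phi> (\<Phi> R) (\<Psi> S)) else 0)"

lemma left_act_eq: "left_act s U V W = tensor_map U V (\<lambda>R. W \<circ> R) (\<lambda>S. S)"
  and right_act_eq: "right_act s U V W = tensor_map U V (\<lambda>R. R) (\<lambda>S. S \<circ> W)"
  by (auto simp: left_act_def right_act_def tensor_map_def)

text \<open>The two maps are applied to the terms of a representing series, which multiplies the sum
  of norms by at most \<open>C * D\<close>.\<close>

lemma tensor_le_map:
  assumes u: "tensor_le U V u r" and \<Phi>: "op_map U U' C \<Phi>" and \<Psi>: "op_map V V' D \<Psi>"
    and U: "op_space U" "op_space V" "op_space U'" "op_space V'"
  shows "tensor_le U' V' (tensor_map U' V' \<Phi> \<Psi> u) (C * D * r)"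
proof -
  from u obtain R S where RS: "abs_convergent U V R S" "u = tensor_series s U V R S"
    "(\<Sum>n. onorm (R n) * onorm (S n)) \<le> r" by (auto simp: tensor_le_def)
  have mem: "R n \<in> U" "S n \<in> V" for n using RS(1) by (auto simp: abs_convergent_def)
  have mem': "\<Phi> (R n) \<in> U'" "\<Psi> (S n) \<in> V'" for n
    using mem op_mapD(2)[OF \<Phi>] op_mapD(2)[OF \<Psi>] by auto
  have CD: "0 \<le> C" "0 \<le> D" using op_mapD(1) \<Phi> \<Psi> by auto
  have nn: "0 \<le> onorm (R n)" "0 \<le> onorm (S n)" "0 \<le> onorm (\<Phi> (R n))" "0 \<le> onorm (\<Psi> (S n))" for n
    using mem mem' op_spaceD(4)[OF U(1)] op_spaceD(4)[OF U(2)] op_spaceD(4)[OF U(3)]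
        op_spaceD(4)[OF U(4)]
    by (auto intro!: onorm_nonneg)
  have le: "onorm (\<Phi> (R n)) * onorm (\<Psi> (S n)) \<le> C * D * (onorm (R n) * onorm (S n))" for n
  proof -
    have "onorm (\<Phi> (R n)) * onorm (\<Psi> (S n)) \<le> (C * onorm (R n)) * (D * onorm (S n))"
      using mem nn CD by (intro mult_mono op_mapD(3)[OF \<Phi>] op_mapD(3)[OF \<Psi>]) auto
    then show ?thesis by (simp add: mult_ac)
  qed
  have sm: "summable (\<lambda>n. C * D * (onorm (R n) * onorm (S n)))"
    using RS(1) by (simp add: abs_convergent_def summable_mult)
  have sm': "summable (\<lambda>n. onorm (\<Phi> (R n)) * onorm (\<Psi> (S n)))"
    using le nn by (intro summable_comparison_test'[OF sm, where N = 0]) (auto simp: abs_mult)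
  have ac: "abs_convergent U' V' (\<lambda>n. \<Phi> (R n)) (\<lambda>n. \<Psi> (S n))"
    using sm' mem' by (simp add: abs_convergent_def)
  have "(\<Sum>n. onorm (\<Phi> (R n)) * onorm (\<Psi> (S n))) \<le> (\<Sum>n. C * D * (onorm (R n) * onorm (S n)))"
    by (rule suminf_le[OF le sm' sm])
  also have "\<dots> = C * D * (\<Sum>n. onorm (R n) * onorm (S n))"
    using RS(1) by (intro suminf_mult) (simp add: abs_convergent_def)
  also have "\<dots> \<le> C * D * r" using RS(3) CD by (intro mult_left_mono) auto
  finally have "(\<Sum>n. onorm (\<Phi> (R n)) * onorm (\<Psi> (S n))) \<le> C * D * r" .
  \<comment> \<open>Pulling back a form on the target gives a form on the source, so the case
    distinctions hidden in the two tensors agree.\<close>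
  moreover have "tensor_map U' V' \<Phi> \<Psi> u = tensor_series s U' V' (\<lambda>n. \<Phi> (R n)) (\<lambda>n. \<Psi> (S n))"
    using forms_pullback[OF _ \<Phi> \<Psi> U] by (auto simp: tensor_map_def RS(2) tensor_series_def)
  ultimately show ?thesis using ac unfolding tensor_le_def by blast
qed

text \<open>Multiplication by \<open>c\<close> is the map that scales the left factor, so the bound
  is an instance of \<open>tensor_le_map\<close>.\<close>

lemma tensor_le_scale:
  assumes "tensor_le U V u r" "op_space U" "op_space V"
  shows "tensor_le U V (\<lambda>\<phi>. c * u \<phi>) (norm c * r)"
proof -
  have "op_map U U (norm c) (\<lambda>R x. s c (R x))"
    using op_spaceD[OF assms(2)]
    by (auto simp: op_map_def scale_right_distrib onorm_scale_le scale_left_commute[of c])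
  from tensor_le_map[OF assms(1) this op_map_id assms(2,3,2,3)]
  have *: "tensor_le U V (tensor_map U V (\<lambda>R x. s c (R x)) (\<lambda>R. R) u) (norm c * r)" by simp
  from assms(1) obtain R S where RS: "abs_convergent U V R S" "u = tensor_series s U V R S"
    by (auto simp: tensor_le_def)
  have mem: "R n \<in> U" "S n \<in> V" for n using RS(1) by (auto simp: abs_convergent_def)
  have "tensor_map U V (\<lambda>R x. s c (R x)) (\<lambda>R. R) u \<phi> = c * u \<phi>" for \<phi>
  proof (cases "\<phi> \<in> forms U V")
    case True
    have "(\<lambda>R S. \<phi> (\<lambda>x. s c (R x)) S) \<in> forms U V"
      using forms_scale[OF True, of c]
      by (subst forms_cong[OF assms(2,3), where \<psi> = "\<lambda>R S. c * \<phi> R S"])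
        (auto simp: formsD(3)[OF True])
    with True show ?thesis
      by (simp add: tensor_map_def RS(2) tensor_series_def formsD(3)[OF True] mem
          suminf_mult[OF forms_summable[OF RS(1) True]])
  qed (simp add: tensor_map_def RS(2) tensor_series_def)
  then have "tensor_map U V (\<lambda>R x. s c (R x)) (\<lambda>R. R) u = (\<lambda>\<phi>. c * u \<phi>)" by auto
  with * show ?thesis by simp
qed

lemma tensor_le_sum:
  assumes "finite I" "\<And>i. i \<in> I \<Longrightarrow> tensor_le U V (u i) (r i)" "op_space U" "op_space V"
  shows "tensor_le U V (\<lambda>\<phi>. \<Sum>i\<in>I. u i \<phi>) (\<Sum>i\<in>I. r i)"
  using assms(1,2)
proof (induction I rule: finite_induct)
  case empty
  have "abs_convergent U V (\<lambda>n x. 0) (\<lambda>n x. 0)"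
    using op_spaceD(1)[OF assms(3)] op_spaceD(1)[OF assms(4)]
      by (auto simp: abs_convergent_def onorm_zero)
  moreover have "(\<lambda>\<phi>. 0) = tensor_series s U V (\<lambda>n x. 0) (\<lambda>n x. 0)"
  proof
    fix \<phi> show "0 = tensor_series s U V (\<lambda>n x. 0) (\<lambda>n x. 0) \<phi>"
    proof (cases "\<phi> \<in> forms U V")
      \<comment> \<open>By homogeneity with the scalar 0, a form vanishes on the zero
        operator.\<close>
      case True
      from formsD(3)[OF True op_spaceD(1)[OF assms(3)] op_spaceD(1)[OF assms(4)], of 0]
      show ?thesis by (simp add: tensor_series_def)
    qed (simp add: tensor_series_def)
  qed
  ultimately show ?case
    unfolding tensor_le_def by (intro exI[of _ "\<lambda>n x. 0"]) (auto simp: onorm_zero)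
next
  case (insert i I)
  then have "tensor_le U V (\<lambda>\<phi>. u i \<phi> + (\<Sum>i\<in>I. u i \<phi>)) (r i + sum r I)"
    by (intro tensor_le_add) auto
  with insert show ?case by simp
qed

text \<open>The main device for identities between tensors: they reduce to identities on single
  pairs of operators. It also covers arguments that are not forms, since then neither function is
  one and both values are 0.\<close>

lemma tensor_cong:
  assumes u: "u \<in> proj_tensor s U V" and U: "op_space U" "op_space V"
    and eq: "\<And>R S. R \<in> U \<Longrightarrow> S \<in> V \<Longrightarrow> \<phi> R S = \<psi> R S"
  shows "u \<phi> = u \<psi>"
  using u forms_cong[OF U eq] eq by (auto simp: proj_tensor_def tensor_series_def
      abs_convergent_def)

lemma tensor_form_sum:
  assumes u: "u \<in> proj_tensor s U V" and U: "op_space U" "op_space V"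
    and I: "finite I" "\<And>i. i \<in> I \<Longrightarrow> \<phi> i \<in> forms U V"
  shows "u (\<lambda>R S. \<Sum>i\<in>I. \<phi> i R S) = (\<Sum>i\<in>I. u (\<phi> i))"
proof -
  from u obtain R S where RS: "abs_convergent U V R S" "u = tensor_series s U V R S"
    by (auto simp: proj_tensor_def)
  show ?thesis
    using I forms_sum[OF I U] forms_summable[OF RS(1)]
    by (simp add: RS(2) tensor_series_def suminf_sum)
qed

lemma tensor_form_add:
  assumes u: "u \<in> proj_tensor s U V" and U: "op_space U" "op_space V"
    and \<phi>: "\<phi> \<in> forms U V" "\<psi> \<in> forms U V"
  shows "u (\<lambda>R S. \<phi> R S + \<psi> R S) = u \<phi> + u \<psi>"
proof -
  from u obtain R S where RS: "abs_convergent U V R S" "u = tensor_series s U V R S"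
    by (auto simp: proj_tensor_def)
  show ?thesis
    using \<phi> forms_add[OF \<phi> U] forms_summable[OF RS(1)]
    by (simp add: RS(2) tensor_series_def suminf_add)
qed

lemma tensor_form_scale:
  assumes u: "u \<in> proj_tensor s U V" and \<phi>: "\<phi> \<in> forms U V"
  shows "u (\<lambda>R S. c * \<phi> R S) = c * u \<phi>"
proof -
  from u obtain R S where RS: "abs_convergent U V R S" "u = tensor_series s U V R S"
    by (auto simp: proj_tensor_def)
  show ?thesis
    using \<phi> forms_scale[OF \<phi>] forms_summable[OF RS(1)]
    by (simp add: RS(2) tensor_series_def suminf_mult)
qed

section \<open>The product map seen through functionals\<close>

lemma form_apply:
  assumes U: "U \<subseteq> bounded_ops s Y Z" and V: "V \<subseteq> bounded_ops s Z Y" and Y: "subspace Y"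
    and f: "f \<in> dual_space s"
  shows "(\<lambda>R S. f (R (S x))) \<in> forms U V"
proof -
  \<comment> \<open>Holds for all x: outside Z the extension takes the value 0, which lies in
    Y.\<close>
  have S: "S x \<in> Y" if "S \<in> V" for S
    using that V bounded_opsD(1,2)[of S Z Y x] subspace_0[OF Y] by (cases "x \<in> Z") auto
  have "norm (f (R (S x))) \<le> (onorm f * norm x) * onorm R * onorm S" if R: "R \<in> U" and S: "S \<in> V"
    for R S
  proof -
    have b: "bounded_map R" "bounded_map S" "bounded_map f"
      using R S U V dual_spaceD(3)[OF f] by (auto intro: bounded_ops_bounded_map)
    have "norm (f (R (S x))) \<le> onorm f * (onorm R * (onorm S * norm x))"
      using b by (intro order_trans[OF norm_le_onorm] mult_left_mono onorm_nonneg norm_le_onorm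
          order_trans[OF norm_le_onorm] order_refl) auto
    then show ?thesis by (simp add: mult_ac)
  qed
  moreover have "f (R (S x + S' x)) = f (R (S x)) + f (R (S' x))"
    if "R \<in> U" "S \<in> V" "S' \<in> V" for R S S'
    using bounded_opsD(3)[OF subsetD[OF U that(1)] S[OF that(2)] S[OF that(3)]]
    by (simp add: dual_spaceD(1)[OF f])
  moreover have "f (R (s c (S x))) = c * f (R (S x))" if "R \<in> U" "S \<in> V" for R S c
    using bounded_opsD(4)[OF subsetD[OF U that(1)] S[OF that(2)]]
    by (simp add: dual_spaceD(2)[OF f])
  ultimately show ?thesis
    unfolding bounded_bilinear_forms_def
    by (auto simp: dual_spaceD(1,2)[OF f] simp del: norm_le_zero_iff intro!: exI[of _
        "onorm f * norm x"])
qed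

text \<open>The property of the space that makes the product map well defined on tensors. It is
  carried as a premise until projections are available to prove it.\<close>

definition separated :: bool where
  "separated \<longleftrightarrow> (\<forall>x. (\<forall>f\<in>dual_space s. f x = 0) \<longrightarrow> x = 0)"

lemma separated_eqI:
  assumes separated "\<And>f. f \<in> dual_space s \<Longrightarrow> f x = f y"
  shows "x = y"
proof -
  have "f (x - y) = 0" if "f \<in> dual_space s" for f
    using assms(2)[OF that] linear_diff[OF bounded_linear.linear[OF dual_space_bounded_linear[OF
        that]], of x y] by simp
  with assms(1) have "x - y = 0" unfolding separated_def by blast
  then show ?thesis by simp
qed

text \<open>The definite description is justified as follows: a functional f sends the sum at x to
  the value of the tensor at the form \<open>f (R (S x))\<close>, so two series of the same tensor
  have sums that no f distinguishes.\<close>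

lemma tensor_mult_series:
  assumes sep: separated
    and U: "U \<subseteq> bounded_ops s Y Z" and V: "V \<subseteq> bounded_ops s Z Y" and Y: "subspace Y"
    and RS: "abs_convergent U V R S"
  shows "tensor_mult s U V (tensor_series s U V R S) = (\<lambda>x. \<Sum>n. R n (S n x))"
    and "summable (\<lambda>n. R n (S n x))"
    and "norm (\<Sum>n. R n (S n x)) \<le> (\<Sum>n. onorm (R n) * onorm (S n)) * norm x"
proof -
  have val: "summable (\<lambda>n. R n (S n x)) \<and>
      norm (\<Sum>n. R n (S n x)) \<le> (\<Sum>n. onorm (R n) * onorm (S n)) * norm x \<and>
      (\<forall>f\<in>dual_space s. f (\<Sum>n. R n (S n x)) = tensor_series s U V R S (\<lambda>R S. f (R (S x))))"
    if ac: "abs_convergent U V R S" for R S x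
  proof -
    have sm: "summable (\<lambda>n. onorm (R n) * onorm (S n))" using ac by (simp add: abs_convergent_def)
    then have sm': "summable (\<lambda>n. onorm (R n) * onorm (S n) * norm x)" by (rule summable_mult2)
    have le: "norm (R n (S n x)) \<le> onorm (R n) * onorm (S n) * norm x" for n
    proof -
      have b: "bounded_map (R n)" "bounded_map (S n)"
        using ac U V by (auto simp: abs_convergent_def intro: bounded_ops_bounded_map)
      then have "norm (R n (S n x)) \<le> onorm (R n) * (onorm (S n) * norm x)"
        by (intro order_trans[OF norm_le_onorm] mult_left_mono onorm_nonneg norm_le_onorm)
      then show ?thesis by (simp add: mult.assoc)
    qed
    have "summable (\<lambda>n. R n (S n x))" using sm' le by (rule summable_comparison_test'[where N = 0])
    moreover have "norm (\<Sum>n. R n (S n x)) \<le> (\<Sum>n. onorm (R n) * onorm (S n)) * norm x"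
      using norm_suminf_le[OF le sm'] suminf_mult2[OF sm] by simp
    ultimately show ?thesis
      using form_apply[OF U V Y]
        by (auto simp: tensor_series_def bounded_linear.suminf[OF dual_space_bounded_linear])
  qed
  let ?u = "tensor_series s U V R S"
  show "tensor_mult s U V ?u = (\<lambda>x. \<Sum>n. R n (S n x))"
    unfolding tensor_mult_def
  proof (rule the_equality)
    show "\<exists>R' S'. abs_convergent U V R' S' \<and> ?u = tensor_series s U V R' S' \<and>
        (\<lambda>x. \<Sum>n. R n (S n x)) = (\<lambda>x. \<Sum>n. R' n (S' n x))" using RS by blast
    fix C assume "\<exists>R' S'. abs_convergent U V R' S' \<and> ?u = tensor_series s U V R' S' \<and>
        C = (\<lambda>x. \<Sum>n. R' n (S' n x))"
    then obtain R' S' where RS': "abs_convergent U V R' S'" "?u = tensor_series s U V R' S'"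
        "C = (\<lambda>x. \<Sum>n. R' n (S' n x))" by blast
    have "(\<Sum>n. R' n (S' n x)) = (\<Sum>n. R n (S n x))" for x
      by (rule separated_eqI[OF sep])
        (use val[OF RS, of x] val[OF RS'(1), of x] RS'(2) in auto)
    then show "C = (\<lambda>x. \<Sum>n. R n (S n x))" by (simp add: RS'(3))
  qed
  show "summable (\<lambda>n. R n (S n x))"
    and "norm (\<Sum>n. R n (S n x)) \<le> (\<Sum>n. onorm (R n) * onorm (S n)) * norm x"
    using val[OF RS, of x] by auto
qed

text \<open>Turns every claim about \<pi> into an evaluation of the tensor at a form, to which
  \<open>tensor_cong\<close> applies.\<close>

lemma dual_tensor_mult:
  assumes sep: separated
    and U: "U \<subseteq> bounded_ops s Y Z" and V: "V \<subseteq> bounded_ops s Z Y" and Y: "subspace Y"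
    and u: "u \<in> proj_tensor s U V" and f: "f \<in> dual_space s"
  shows "f (tensor_mult s U V u x) = u (\<lambda>R S. f (R (S x)))"
proof -
  from u obtain R S where RS: "abs_convergent U V R S" "u = tensor_series s U V R S"
    by (auto simp: proj_tensor_def)
  note series = tensor_mult_series[OF sep U V Y RS(1)]
  show ?thesis
    using bounded_linear.suminf[OF dual_space_bounded_linear[OF f] series(2), of x]
    unfolding RS(2) series(1) by (simp add: tensor_series_def form_apply[OF U V Y f])
qed

lemma bounded_map_tensor_mult:
  assumes sep: separated
    and U: "U \<subseteq> bounded_ops s Y Z" and V: "V \<subseteq> bounded_ops s Z Y" and Y: "subspace Y"
    and u: "u \<in> proj_tensor s U V"
  shows "bounded_map (tensor_mult s U V u)"
proof -
  from u obtain R S where RS: "abs_convergent U V R S" "u = tensor_series s U V R S"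
    by (auto simp: proj_tensor_def)
  show ?thesis
    unfolding RS(2) tensor_mult_series(1)[OF sep U V Y RS(1)]
    by (rule bounded_mapI) (rule tensor_mult_series(3)[OF sep U V Y RS(1)])
qed

end

subsection \<open>Finite-rank and approximable operators\<close>

text \<open>By directedness and transitivity the tails form a filter base, so one tail
  decides.\<close>

lemma eventually_tails:
  assumes "directed_set A le"
  shows "eventually Q (tails A le) \<longleftrightarrow> (\<exists>a\<in>A. \<forall>b\<in>A. le a b \<longrightarrow> Q b)"
proof -
  have "eventually Q (tails A le) \<longleftrightarrow> (\<exists>a\<in>A. eventually Q (principal {b \<in> A. le a b}))"
    unfolding tails_def
  proof (rule eventually_INF_base)
    show "A \<noteq> {}" using assms by (simp add: directed_set_def)
    fix a b assume ab: "a \<in> A" "b \<in> A"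
    then obtain c where c: "c \<in> A" "le a c" "le b c" using assms unfolding directed_set_def by blast
    have "transp_on A le" using assms by (simp add: directed_set_def)
    then have "le a d \<and> le b d" if "d \<in> A" "le c d" for d
      using that c ab by (meson transp_onD)
    then show "\<exists>x\<in>A. principal {b \<in> A. le x b}
        \<le> inf (principal {b \<in> A. le a b}) (principal {ba \<in> A. le b ba})"
      using c(1) by (intro bexI[of _ c]) auto
  qed
  then show ?thesis by (auto simp: eventually_principal)
qed

lemma tails_neq_bot: "directed_set A le \<Longrightarrow> tails A le \<noteq> bot"
  by (auto simp: trivial_limit_def eventually_tails directed_set_def reflp_on_def)

lemma eventually_tails_mem: "directed_set A le \<Longrightarrow> eventually (\<lambda>a. a \<in> A) (tails A le)"
  by (auto simp: eventually_tails directed_set_def)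

context banach_over
begin

text \<open>The inclusion of Y, extended by 0. Composition with it on the right restricts an
  operator to Y within the encoding.\<close>

definition restr :: "'x set \<Rightarrow> 'x \<Rightarrow> 'x" where
  "restr Y x = (if x \<in> Y then x else 0)"

lemma restr_bounded_ops: "subspace Y \<Longrightarrow> restr Y \<in> bounded_ops s Y UNIV"
  by (rule bounded_opsI)
    (auto simp: restr_def subspace_add subspace_scale intro!: bounded_mapI[of _ 1])

lemma onorm_restr_le: "onorm (restr Y) \<le> 1"
  by (rule onorm_bound) (auto simp: restr_def)

lemma finite_rank_bounded: "T \<in> finite_rank_ops s Y Z \<Longrightarrow> T \<in> bounded_ops s Y Z"
  by (simp add: finite_rank_ops_def)

lemma finite_rank_compose_right:
  assumes "T \<in> finite_rank_ops s Y Z" "Q \<in> bounded_ops s X Y"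
  shows "T \<circ> Q \<in> finite_rank_ops s X Z"
proof -
  from assms(1) obtain B where "finite B" "T ` Y \<subseteq> span B" by (auto simp: finite_rank_ops_def)
  moreover have "(T \<circ> Q) ` X \<subseteq> T ` Y" using bounded_opsD(1)[OF assms(2)] by auto
  ultimately show ?thesis
    using bounded_ops_compose[OF finite_rank_bounded[OF assms(1)] assms(2)]
    unfolding finite_rank_ops_def by blast
qed

lemma finite_rank_compose_left:
  assumes L: "L \<in> bounded_ops s UNIV Z" and T: "T \<in> finite_rank_ops s Y UNIV"
  shows "L \<circ> T \<in> finite_rank_ops s Y Z"
proof -
  from T obtain B where B: "finite B" "T ` Y \<subseteq> span B" by (auto simp: finite_rank_ops_def)
  have "module_hom s s L"
    unfolding module_hom_iff using module_axioms bounded_opsD(3,4)[OF L UNIV_I] by simp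
  then have "L ` span B = span (L ` B)" by (rule module_hom.span_image[symmetric])
  with B have "(L \<circ> T) ` Y \<subseteq> span (L ` B)" by auto
  with B(1) bounded_ops_compose[OF L finite_rank_bounded[OF T]] show ?thesis
    unfolding finite_rank_ops_def by blast
qed

lemma finite_rank_codomain:
  assumes "T \<in> finite_rank_ops s Y Z" "T ` Y \<subseteq> Z'"
  shows "T \<in> finite_rank_ops s Y Z'"
proof -
  have T: "T \<in> bounded_ops s Y Z" using assms(1) by (rule finite_rank_bounded)
  have "T \<in> bounded_ops s Y Z'"
    by (rule bounded_opsI)
      (use assms(2) in \<open>simp_all add: bounded_opsD[OF T] bounded_ops_bounded_map[OF T] image_subset_iff\<close>)
  with assms(1) show ?thesis by (simp add: finite_rank_ops_def)
qed

lemma bounded_ops_add: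
  assumes "R \<in> bounded_ops s Y Z" "T \<in> bounded_ops s Y Z" "subspace Z"
  shows "(\<lambda>x. R x + T x) \<in> bounded_ops s Y Z"
  by (rule bounded_opsI)
    (use assms in \<open>auto simp: bounded_opsD[OF assms(1)] bounded_opsD[OF assms(2)] subspace_add
      scale_right_distrib intro: bounded_map_add bounded_ops_bounded_map\<close>)

lemma bounded_ops_scale:
  assumes "R \<in> bounded_ops s Y Z" "subspace Z"
  shows "(\<lambda>x. s c (R x)) \<in> bounded_ops s Y Z"
  by (rule bounded_opsI)
    (use assms in \<open>auto simp: bounded_opsD[OF assms(1)] subspace_scale
      scale_right_distrib scale_left_commute[of c] intro: bounded_map_scale
          bounded_ops_bounded_map\<close>)

lemma bounded_ops_null: "subspace Z \<Longrightarrow> (\<lambda>x. 0) \<in> bounded_ops s Y Z"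
  by (rule bounded_opsI) (auto simp: subspace_0 intro!: bounded_mapI[of _ 0])

lemma op_space_finite_rank:
  assumes "subspace Z"
  shows "op_space (finite_rank_ops s Y Z)"
proof -
  have "(\<lambda>x. 0) \<in> finite_rank_ops s Y Z"
    using bounded_ops_null[OF assms] by (auto simp: finite_rank_ops_def intro!: exI[of _ "{}"])
  moreover have "(\<lambda>x. R x + T x) \<in> finite_rank_ops s Y Z"
    if R: "R \<in> finite_rank_ops s Y Z" and T: "T \<in> finite_rank_ops s Y Z" for R T
  proof -
    from R T obtain B B' where B: "finite B" "R ` Y \<subseteq> span B" "finite B'" "T ` Y \<subseteq> span B'"
      by (auto simp: finite_rank_ops_def)
    have "R x + T x \<in> span (B \<union> B')" if "x \<in> Y" for x
      using B(2,4) that span_mono[of B "B \<union> B'"] span_mono[of B' "B \<union> B'"] by (intro span_add) auto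
    then have "(\<lambda>x. R x + T x) ` Y \<subseteq> span (B \<union> B')" by auto
    with B(1,3) bounded_ops_add[OF finite_rank_bounded[OF R] finite_rank_bounded[OF T] assms]
    show ?thesis unfolding finite_rank_ops_def by blast
  qed
  moreover have "(\<lambda>x. s c (R x)) \<in> finite_rank_ops s Y Z" if R: "R \<in> finite_rank_ops s Y Z" for c R
  proof -
    from R obtain B where B: "finite B" "R ` Y \<subseteq> span B" by (auto simp: finite_rank_ops_def)
    then have "(\<lambda>x. s c (R x)) ` Y \<subseteq> span B" by (auto intro!: span_scale)
    with B(1) bounded_ops_scale[OF finite_rank_bounded[OF R] assms]
    show ?thesis unfolding finite_rank_ops_def by blast
  qed
  ultimately show ?thesis
    using bounded_ops_bounded_map[OF finite_rank_bounded] unfolding op_space_def by blast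
qed

lemma rank_one_finite_rank:
  assumes f: "f \<in> dual_space s"
  shows "(\<lambda>x. s (f x) b) \<in> finite_rank_ops s UNIV UNIV"
proof -
  have "(\<lambda>x. s (f x) b) \<in> bounded_ops s UNIV UNIV"
  proof (rule bounded_opsI)
    show "bounded_map (\<lambda>x. s (f x) b)"
    proof (rule bounded_mapI)
      fix x
      have "norm (f x) * norm b \<le> (onorm f * norm x) * norm b"
        by (rule mult_right_mono[OF norm_le_onorm[OF dual_spaceD(3)[OF f]] norm_ge_zero])
      then show "norm (s (f x) b) \<le> (onorm f * norm b) * norm x" by (simp add: norm_scale mult_ac)
    qed
  qed (simp_all add: dual_spaceD(1,2)[OF f] scale_left_distrib)
  moreover have "range (\<lambda>x. s (f x) b) \<subseteq> span {b}" by (auto intro: span_scale span_base)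
  ultimately show ?thesis unfolding finite_rank_ops_def by blast
qed

text \<open>For a basis vector \<open>b\<close> and a coordinate functional \<open>f\<close> this is
  a matrix unit on Z.\<close>

lemma rank_one_restr_finite_rank:
  assumes f: "f \<in> dual_space s" and Z: "subspace Z" "b \<in> Z"
  shows "(\<lambda>x. if x \<in> Z then s (f x) b else 0) \<in> finite_rank_ops s Z Z"
proof -
  have "(\<lambda>x. s (f x) b) \<circ> restr Z \<in> finite_rank_ops s Z Z"
    by (rule finite_rank_codomain[OF finite_rank_compose_right[OF rank_one_finite_rank[OF f]
        restr_bounded_ops[OF Z(1)]]])
      (use subspace_scale[OF Z] in auto)
  moreover have "(\<lambda>x. s (f x) b) \<circ> restr Z = (\<lambda>x. if x \<in> Z then s (f x) b else 0)"
    using dual_spaceD(2)[OF f, of 0 0] by (auto simp: restr_def fun_eq_iff)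
  ultimately show ?thesis by simp
qed

section \<open>The ideal of approximable operators\<close>

lemma approximableE:
  assumes "T \<in> approximable_ops s" "0 < e"
  obtains S where "S \<in> finite_rank_ops s UNIV UNIV" "onorm (\<lambda>x. T x - S x) < e"
    "bounded_map (\<lambda>x. T x - S x)"
  using assms bounded_map_minus[OF bounded_ops_bounded_map bounded_ops_bounded_map]
    finite_rank_bounded unfolding approximable_ops_def by blast

text \<open>The multiple \<open>C * e\<close> lets each closure property state its natural error;
  the rescaling by \<open>C + 1\<close>, which is positive even for C = 0, is done once
  here.\<close>

lemma approximableI:
  assumes T: "T \<in> bounded_ops s UNIV UNIV" and C: "0 \<le> C"
    and approx: "\<And>e. 0 < e \<Longrightarrow> \<exists>S \<in> finite_rank_ops s UNIV UNIV. onorm (\<lambda>x. T x - S x) \<le> C * e"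
  shows "T \<in> approximable_ops s"
proof -
  have "\<exists>S \<in> finite_rank_ops s UNIV UNIV. onorm (\<lambda>x. T x - S x) < e" if "0 < e" for e
  proof -
    from C that have "0 < e / (C + 1)" by simp
    from approx[OF this] obtain S where S: "S \<in> finite_rank_ops s UNIV UNIV"
      "onorm (\<lambda>x. T x - S x) \<le> C * (e / (C + 1))" by blast
    have "C * (e / (C + 1)) < e" using C that by (simp add: field_simps)
    with S show ?thesis by (intro bexI[of _ S]) auto
  qed
  with T show ?thesis by (auto simp: approximable_ops_def)
qed

lemma finite_rank_approximable:
  assumes "T \<in> finite_rank_ops s UNIV UNIV"
  shows "T \<in> approximable_ops s"
  by (rule approximableI[where C = 0])
    (use assms finite_rank_bounded[OF assms] in \<open>auto intro!: bexI[of _ T] simp: onorm_zero\<close>)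

lemma approximable_compose_left:
  assumes L: "L \<in> bounded_ops s UNIV UNIV" and T: "T \<in> approximable_ops s"
  shows "L \<circ> T \<in> approximable_ops s"
proof (rule approximableI[where C = "onorm L"])
  show "L \<circ> T \<in> bounded_ops s UNIV UNIV"
    using L approximable_bounded[OF T] by (rule bounded_ops_compose)
  show "0 \<le> onorm L" using L by (intro onorm_nonneg bounded_ops_bounded_map)
  fix e :: real assume "0 < e"
  from approximableE[OF T this] obtain S where S: "S \<in> finite_rank_ops s UNIV UNIV"
    "onorm (\<lambda>x. T x - S x) < e" "bounded_map (\<lambda>x. T x - S x)" by metis
  have "(\<lambda>x. (L \<circ> T) x - (L \<circ> S) x) = (\<lambda>x. L (T x - S x))"
    using linear_diff[OF bounded_linear.linear[OF bounded_ops_bounded_linear[OF L]]]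
      by (simp add: comp_def)
  moreover have "onorm (\<lambda>x. L (T x - S x)) \<le> onorm L * onorm (\<lambda>x. T x - S x)"
    by (rule onorm_compose_le[OF bounded_ops_bounded_map[OF L] S(3)])
  moreover have "onorm L * onorm (\<lambda>x. T x - S x) \<le> onorm L * e"
    using S(2) L by (intro mult_left_mono onorm_nonneg bounded_ops_bounded_map) auto
  ultimately show "\<exists>S\<in>finite_rank_ops s UNIV UNIV. onorm (\<lambda>x. (L \<circ> T) x - S x) \<le> onorm L * e"
    using finite_rank_compose_left[OF L S(1)] by (intro bexI[of _ "L \<circ> S"]) auto
qed

lemma approximable_compose_right:
  assumes L: "L \<in> bounded_ops s UNIV UNIV" and T: "T \<in> approximable_ops s"
  shows "T \<circ> L \<in> approximable_ops s"
proof (rule approximableI[where C = "onorm L"])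
  show "T \<circ> L \<in> bounded_ops s UNIV UNIV"
    using approximable_bounded[OF T] L by (rule bounded_ops_compose)
  show "0 \<le> onorm L" using L by (intro onorm_nonneg bounded_ops_bounded_map)
  fix e :: real assume "0 < e"
  from approximableE[OF T this] obtain S where S: "S \<in> finite_rank_ops s UNIV UNIV"
    "onorm (\<lambda>x. T x - S x) < e" "bounded_map (\<lambda>x. T x - S x)" by metis
  have "onorm (\<lambda>x. T (L x) - S (L x)) \<le> onorm (\<lambda>x. T x - S x) * onorm L"
    using onorm_compose_le[OF S(3), of L] L by (simp add: bounded_ops_bounded_map)
  moreover have "onorm (\<lambda>x. T x - S x) * onorm L \<le> e * onorm L"
    using S(2) L by (intro mult_right_mono onorm_nonneg bounded_ops_bounded_map) auto
  ultimately show "\<exists>S\<in>finite_rank_ops s UNIV UNIV. onorm (\<lambda>x. (T \<circ> L) x - S x) \<le> onorm L * e"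
    using finite_rank_compose_right[OF S(1) L]
      by (intro bexI[of _ "S \<circ> L"]) (auto simp: mult.commute)
qed

lemma op_space_approximable: "op_space (approximable_ops s)"
proof -
  have "(\<lambda>x. 0) \<in> approximable_ops s"
    by (intro finite_rank_approximable op_spaceD(1)[OF op_space_finite_rank]) (rule subspace_UNIV)
  moreover have "(\<lambda>x. R x + T x) \<in> approximable_ops s"
    if R: "R \<in> approximable_ops s" and T: "T \<in> approximable_ops s" for R T
  proof (rule approximableI[where C = 2])
    show "(\<lambda>x. R x + T x) \<in> bounded_ops s UNIV UNIV"
      using R T by (intro bounded_ops_add approximable_bounded subspace_UNIV)
    fix e :: real assume e: "0 < e"
    obtain S where S: "S \<in> finite_rank_ops s UNIV UNIV"
      "onorm (\<lambda>x. R x - S x) < e" "bounded_map (\<lambda>x. R x - S x)" using approximableE[OF R e] by metis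
    obtain S' where S': "S' \<in> finite_rank_ops s UNIV UNIV"
      "onorm (\<lambda>x. T x - S' x) < e" "bounded_map (\<lambda>x. T x - S' x)" using approximableE[OF T e]
        by metis
    have "onorm (\<lambda>x. R x + T x - (S x + S' x)) = onorm (\<lambda>x. (R x - S x) + (T x - S' x))"
      by (simp add: algebra_simps)
    also have "\<dots> \<le> onorm (\<lambda>x. R x - S x) + onorm (\<lambda>x. T x - S' x)"
      by (rule onorm_add_le[OF S(3) S'(3)])
    also have "\<dots> \<le> 2 * e" using S(2) S'(2) by simp
    finally show "\<exists>S\<in>finite_rank_ops s UNIV UNIV. onorm (\<lambda>x. R x + T x - S x) \<le> 2 * e"
      using op_spaceD(2)[OF op_space_finite_rank[OF subspace_UNIV] S(1) S'(1)]
      by (intro bexI[of _ "\<lambda>x. S x + S' x"])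
  qed simp
  moreover have "(\<lambda>x. s c (R x)) \<in> approximable_ops s" if R: "R \<in> approximable_ops s" for c R
  proof -
    \<comment> \<open>A scalar multiple is a composition with a homothety, so the ideal property
      applies.\<close>
    have "(\<lambda>x. s c x) \<in> bounded_ops s UNIV UNIV"
      by (rule bounded_opsI)
        (auto simp: scale_right_distrib scale_left_commute[of c] norm_scale intro!:
            bounded_mapI[of _ "norm c"])
    from approximable_compose_left[OF this R] show ?thesis by (simp add: comp_def)
  qed
  ultimately show ?thesis
    using bounded_ops_bounded_map[OF approximable_bounded] unfolding op_space_def by blast
qed

section \<open>Maps between operator spaces induced by composition\<close>

lemma op_map_left:
  assumes L: "L \<in> bounded_ops s Z Z'" and U: "U \<subseteq> bounded_ops s Y Z"
    and mem: "\<And>R. R \<in> U \<Longrightarrow> L \<circ> R \<in> U'"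
  shows "op_map U U' (onorm L) (\<lambda>R. L \<circ> R)"
proof -
  have b: "bounded_map L" using L by (rule bounded_ops_bounded_map)
  have "onorm (L \<circ> R) \<le> onorm L * onorm R" if "R \<in> U" for R
    using onorm_compose_le[OF b bounded_ops_bounded_map[OF subsetD[OF U that]]]
      by (simp add: comp_def)
  \<comment> \<open>L is additive on Z only. For x in Y both values lie in Z; for other x both are 0
    and \<open>L 0 = 0\<close>.\<close>
  moreover have "L (R x + R' x) = L (R x) + L (R' x)" if "R \<in> U" "R' \<in> U" for R R' x
    using bounded_opsD(1,2)[OF subsetD[OF U that(1)], of x] bounded_opsD(1,2)[OF subsetD[OF U
        that(2)], of x]
      bounded_opsD(3)[OF L, of "R x" "R' x"] bounded_ops_zero[OF L] by (cases "x \<in> Y") auto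
  moreover have "L (s c (R x)) = s c (L (R x))" if "R \<in> U" for R x c
    using bounded_opsD(1,2)[OF subsetD[OF U that], of x]
      bounded_opsD(4)[OF L, of "R x"] bounded_ops_zero[OF L] by (cases "x \<in> Y") auto
  ultimately show ?thesis using mem onorm_nonneg[OF b] by (auto simp: op_map_def)
qed

lemma op_map_right:
  assumes Q: "bounded_map Q" and U: "op_space U" and mem: "\<And>R. R \<in> U \<Longrightarrow> R \<circ> Q \<in> U'"
  shows "op_map U U' (onorm Q) (\<lambda>R. R \<circ> Q)"
proof -
  have "onorm (R \<circ> Q) \<le> onorm R * onorm Q" if "R \<in> U" for R
    using onorm_compose_le[OF op_spaceD(4)[OF U that] Q] by (simp add: comp_def)
  then show ?thesis
    using mem onorm_nonneg[OF Q] by (auto simp: op_map_def comp_def mult.commute)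
qed

lemma op_map_comp:
  assumes \<Phi>: "op_map U U' C \<Phi>" and \<Psi>: "op_map U' U'' D \<Psi>"
  shows "op_map U U'' (D * C) (\<lambda>R. \<Psi> (\<Phi> R))"
proof -
  have "onorm (\<Psi> (\<Phi> R)) \<le> D * C * onorm R" if "R \<in> U" for R
  proof -
    have "onorm (\<Psi> (\<Phi> R)) \<le> D * onorm (\<Phi> R)" by (intro op_mapD(3)[OF \<Psi>] op_mapD(2)[OF \<Phi>] that)
    also have "\<dots> \<le> D * (C * onorm R)"
      by (intro mult_left_mono op_mapD(3)[OF \<Phi>] that op_mapD(1)[OF \<Psi>])
    finally show ?thesis by (simp add: mult.assoc)
  qed
  then show ?thesis
    using op_mapD(1)[OF \<Phi>] op_mapD(1)[OF \<Psi>] op_mapD(2)[OF \<Phi>] op_mapD(2)[OF \<Psi>]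
    by (auto simp: op_map_def op_mapD(4,5)[OF \<Phi>] op_mapD(4,5)[OF \<Psi>])
qed

lemma op_map_mono:
  assumes "op_map U U' C \<Phi>" "C \<le> D" "op_space U"
  shows "op_map U U' D \<Phi>"
proof -
  have "onorm (\<Phi> R) \<le> D * onorm R" if "R \<in> U" for R
    using op_mapD(3)[OF assms(1) that] mult_right_mono[OF assms(2) onorm_nonneg[OF op_spaceD(4)[OF
        assms(3) that]]]
    by linarith
  with assms(1,2) show ?thesis by (auto simp: op_map_def)
qed

lemma tensor_le_mono: "tensor_le U V u q \<Longrightarrow> q \<le> r \<Longrightarrow> tensor_le U V u r"
  unfolding tensor_le_def by (blast intro: order_trans)

text \<open>Density argument: the errors depend on the operator in a Lipschitz way with a constant
  that is uniform along the net, so convergence passes from finite-rank operators to their norm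
  limits.\<close>

lemma approximable_tendsto_zero:
  assumes fr: "\<And>S. S \<in> finite_rank_ops s UNIV UNIV \<Longrightarrow> ((\<lambda>\<alpha>. e \<alpha> S) \<longlongrightarrow> 0) F"
    and nonneg: "eventually (\<lambda>\<alpha>. \<forall>T\<in>approximable_ops s. 0 \<le> e \<alpha> T) F" and C: "0 \<le> C"
    and lip: "eventually (\<lambda>\<alpha>. \<forall>T\<in>approximable_ops s. \<forall>S\<in>finite_rank_ops s UNIV UNIV.
      e \<alpha> T \<le> e \<alpha> S + C * onorm (\<lambda>x. T x - S x)) F"
    and T: "T \<in> approximable_ops s"
  shows "((\<lambda>\<alpha>. e \<alpha> T) \<longlongrightarrow> (0::real)) F"
proof (rule tendstoI)
  fix r :: real assume r: "0 < r"
  then have "0 < r / (2 * (C + 1))" using C by simp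
  from approximableE[OF T this] obtain S where S: "S \<in> finite_rank_ops s UNIV UNIV"
    "onorm (\<lambda>x. T x - S x) < r / (2 * (C + 1))" by metis
  have "C * onorm (\<lambda>x. T x - S x) \<le> C * (r / (2 * (C + 1)))"
    using S(2) C by (intro mult_left_mono) auto
  also have "\<dots> \<le> r / 2" using C r by (simp add: field_simps)
  finally have le: "C * onorm (\<lambda>x. T x - S x) \<le> r / 2" .
  have "eventually (\<lambda>\<alpha>. dist (e \<alpha> S) 0 < r / 2) F" using fr[OF S(1)] r by (intro tendstoD) auto
  with nonneg lip show "eventually (\<lambda>\<alpha>. dist (e \<alpha> T) 0 < r) F"
  proof eventually_elim
    case (elim \<alpha>)
    have "e \<alpha> T \<le> e \<alpha> S + C * onorm (\<lambda>x. T x - S x)" using elim(2) T S(1) by blast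
    moreover have "0 \<le> e \<alpha> T" using elim(1) T by blast
    ultimately show ?case using elim(3) le by (simp add: dist_real_def)
  qed
qed

lemma tensor_le_diff:
  assumes "tensor_le U V u q" "tensor_le U V v r" "op_space U" "op_space V"
  shows "tensor_le U V (\<lambda>\<phi>. u \<phi> - v \<phi>) (q + r)"
  using tensor_le_add[OF assms(1) tensor_le_scale[OF assms(2-4), of "- 1"]] by simp

lemma left_act_add:
  assumes u: "u \<in> proj_tensor s U V" and U: "op_space U" "op_space V"
    and W: "op_map U U C (\<lambda>R. W \<circ> R)" and W': "op_map U U D (\<lambda>R. W' \<circ> R)"
  shows "left_act s U V (\<lambda>x. W x + W' x) u \<phi> = left_act s U V W u \<phi> + left_act s U V W' u \<phi>"
proof (cases "\<phi> \<in> forms U V")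
  case True
  have "u (\<lambda>R S. \<phi> ((\<lambda>x. W x + W' x) \<circ> R) S) = u (\<lambda>R S. \<phi> (W \<circ> R) S + \<phi> (W' \<circ> R) S)"
  proof (rule tensor_cong[OF u U])
    fix R S assume RS: "R \<in> U" "S \<in> V"
    have "(\<lambda>x. W x + W' x) \<circ> R = (\<lambda>x. (W \<circ> R) x + (W' \<circ> R) x)" by auto
    with formsD(1)[OF True op_mapD(2)[OF W RS(1)] op_mapD(2)[OF W' RS(1)] RS(2)]
    show "\<phi> ((\<lambda>x. W x + W' x) \<circ> R) S = \<phi> (W \<circ> R) S + \<phi> (W' \<circ> R) S" by simp
  qed
  also have "\<dots> = u (\<lambda>R S. \<phi> (W \<circ> R) S) + u (\<lambda>R S. \<phi> (W' \<circ> R) S)"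
    using forms_pullback[OF True W op_map_id U U] forms_pullback[OF True W' op_map_id U U]
    by (rule tensor_form_add[OF u U])
  finally show ?thesis using True by (simp add: left_act_def)
qed (simp add: left_act_def)

text \<open>Here the two acting operators end up inside S. Since S is additive on its domain only,
  additivity at the values of W and W' is a separate premise.\<close>

lemma right_act_add:
  assumes u: "u \<in> proj_tensor s U V" and U: "op_space U" "op_space V"
    and W: "op_map V V C (\<lambda>S. S \<circ> W)" and W': "op_map V V D (\<lambda>S. S \<circ> W')"
    and lin: "\<And>S x. S \<in> V \<Longrightarrow> S (W x + W' x) = S (W x) + S (W' x)"
  shows "right_act s U V (\<lambda>x. W x + W' x) u \<phi> = right_act s U V W u \<phi> + right_act s U V W' u \<phi>"
proof (cases "\<phi> \<in> forms U V")
  case True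
  have "u (\<lambda>R S. \<phi> R (S \<circ> (\<lambda>x. W x + W' x))) = u (\<lambda>R S. \<phi> R (S \<circ> W) + \<phi> R (S \<circ> W'))"
  proof (rule tensor_cong[OF u U])
    fix R S assume RS: "R \<in> U" "S \<in> V"
    have "S \<circ> (\<lambda>x. W x + W' x) = (\<lambda>x. (S \<circ> W) x + (S \<circ> W') x)"
      using lin[OF RS(2)] by auto
    with formsD(2)[OF True RS(1) op_mapD(2)[OF W RS(2)] op_mapD(2)[OF W' RS(2)]]
    show "\<phi> R (S \<circ> (\<lambda>x. W x + W' x)) = \<phi> R (S \<circ> W) + \<phi> R (S \<circ> W')" by simp
  qed
  also have "\<dots> = u (\<lambda>R S. \<phi> R (S \<circ> W)) + u (\<lambda>R S. \<phi> R (S \<circ> W'))"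
    using forms_pullback[OF True op_map_id W U U] forms_pullback[OF True op_map_id W' U U]
    by (rule tensor_form_add[OF u U])
  finally show ?thesis using True by (simp add: right_act_def)
qed (simp add: right_act_def)

abbreviation \<A> :: "('x \<Rightarrow> 'x) set" where "\<A> \<equiv> approximable_ops s"

lemma op_map_approximable:
  assumes "W \<in> bounded_ops s UNIV UNIV"
  shows "op_map \<A> \<A> (onorm W) (\<lambda>R. W \<circ> R)" "op_map \<A> \<A> (onorm W) (\<lambda>R. R \<circ> W)"
  using op_map_left[OF assms _ approximable_compose_left[OF assms], of \<A> UNIV] approximable_bounded
    op_map_right[OF bounded_ops_bounded_map[OF assms] op_space_approximable
        approximable_compose_right[OF assms]]
  by auto

subsection \<open>Averaging over matrix units\<close>

text \<open>Averaging over the standard matrix units \<open>e b c\<close> turns \<open>\<Delta>\<close> into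
  \<open>\<Sum>b c. e b c \<Delta> e c b\<close>, which commutes exactly with all operators on \<open>Z\<close> and which \<open>\<pi>\<close> maps to a
  multiple of the identity. Since \<open>\<Sum>b c. e b c e c b = card B\<close>, it differs from \<open>card B \<cdot> \<Delta>\<close> only
  by the commutators of \<open>\<Delta>\<close> with the matrix units.\<close>

lemma averaged_diagonal:
  fixes Y Z B :: "'x set" and g :: "'x \<Rightarrow> 'x \<Rightarrow> 'k"
  defines "e \<equiv> \<lambda>b c x. if x \<in> Z then s (g c x) b else 0"
    and "U \<equiv> finite_rank_ops s Y Z" and "V \<equiv> finite_rank_ops s Z Y"
  assumes sep: separated and Y: "subspace Y" and Z: "subspace Z"
    and B: "finite B" "B \<subseteq> Z" and g: "\<And>b. b \<in> B \<Longrightarrow> g b \<in> dual_space s"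
    and expand: "\<And>x. x \<in> Z \<Longrightarrow> x = (\<Sum>b\<in>B. s (g b x) b)"
    and biorth: "\<And>b c. b \<in> B \<Longrightarrow> c \<in> B \<Longrightarrow> g b c = (if b = c then 1 else 0)"
    and \<Delta>: "tensor_le U V \<Delta> r" and r: "0 \<le> r"
    and comm: "\<And>b c. b \<in> B \<Longrightarrow> c \<in> B \<Longrightarrow>
      tensor_le U V (\<lambda>\<phi>. left_act s U V (e b c) \<Delta> \<phi> - right_act s U V (e b c) \<Delta> \<phi>) \<epsilon>"
    and small: "(\<Sum>i\<in>B \<times> B. onorm (e (fst i) (snd i)) * \<epsilon>) \<le> card B"
    and trace: "norm (\<Delta> (\<lambda>R S. \<Sum>c\<in>B. g c (R (S c))) - of_nat (card B)) \<le> card B / 2"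
  shows "\<exists>\<Delta>'. generalized_diagonal s Y Z (finite_rank_ops s Z Z) \<Delta>' \<and>
    proj_norm s U V \<Delta>' \<le> 2 * (r + 1)"
proof -
  have op: "op_space U" "op_space V"
    using Y Z by (auto simp: U_def V_def intro: op_space_finite_rank)
  have UB: "U \<subseteq> bounded_ops s Y Z" "V \<subseteq> bounded_ops s Z Y"
    by (auto simp: U_def V_def finite_rank_bounded)
  have RZ: "R y \<in> Z" if "R \<in> U" for R y
    using bounded_opsD(1,2)[OF subsetD[OF UB(1) that], of y] subspace_0[OF Z]
      by (cases "y \<in> Y") auto
  have SY: "S y \<in> Y" if "S \<in> V" for S y
    using bounded_opsD(1,2)[OF subsetD[OF UB(2) that], of y] subspace_0[OF Y]
      by (cases "y \<in> Z") auto
  have eFR: "e b c \<in> finite_rank_ops s Z Z" if "b \<in> B" "c \<in> B" for b c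
    unfolding e_def using that B(2) by (intro rank_one_restr_finite_rank g Z) auto
  have om: "op_map U U (onorm W) (\<lambda>R. W \<circ> R)" "op_map V V (onorm W) (\<lambda>S. S \<circ> W)"
    if W: "W \<in> finite_rank_ops s Z Z" for W
  proof -
    show "op_map U U (onorm W) (\<lambda>R. W \<circ> R)"
      by (rule op_map_left[OF finite_rank_bounded[OF W] UB(1)])
        (auto simp: U_def intro: finite_rank_compose_right[OF W] finite_rank_bounded)
    show "op_map V V (onorm W) (\<lambda>S. S \<circ> W)"
      by (rule op_map_right[OF bounded_ops_bounded_map[OF finite_rank_bounded[OF W]] op(2)])
        (auto simp: V_def intro: finite_rank_compose_right finite_rank_bounded[OF W])
  qed
  have D: "\<Delta> \<in> proj_tensor s U V" using \<Delta> by (rule tensor_le_mem)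
  define I where "I = B \<times> B"
  define T where "T i = e (fst i) (snd i)" for i
  define T' where "T' i = e (snd i) (fst i)" for i
  have I: "finite I" using B(1) by (simp add: I_def)
  have T: "T i \<in> finite_rank_ops s Z Z" "T' i \<in> finite_rank_ops s Z Z" if "i \<in> I" for i
    using that eFR by (auto simp: T_def T'_def I_def)
  have form1: "(\<lambda>R S. \<phi> (T i \<circ> R) (S \<circ> T' i)) \<in> forms U V" if "\<phi> \<in> forms U V" "i \<in> I" for \<phi> i
    by (rule forms_pullback[OF that(1) om(1)[OF T(1)[OF that(2)]] om(2)[OF T(2)[OF that(2)]] op op])
  \<comment> \<open>Passing from \<phi> to \<open>avg \<phi>\<close> is dual to replacing \<Delta>
    by the sum of the tensors e_bc \<Delta> e_cb; \<open>T i\<close> acts on the left and the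
    transposed unit \<open>T' i\<close> on the right.\<close>
  define avg where "avg \<phi> = (\<lambda>R S. \<Sum>i\<in>I. \<phi> (T i \<circ> R) (S \<circ> T' i))"
    for \<phi> :: "('x \<Rightarrow> 'x) \<Rightarrow> ('x \<Rightarrow> 'x) \<Rightarrow> 'k"
  define \<Delta>\<^sub>1 where "\<Delta>\<^sub>1 \<phi> = (if \<phi> \<in> forms U V then \<Delta> (avg \<phi>) else 0)" for \<phi>
  \<comment> \<open>The trace of \<pi>(\<Delta>) on Z, written with the coordinate functionals.
    Averaging turns \<pi>(\<Delta>) into \<open>t\<close> times the identity, hence the division by
    \<open>t\<close> in \<Delta>'.\<close>
  define t where "t = \<Delta> (\<lambda>R S. \<Sum>c\<in>B. g c (R (S c)))"
  define \<Delta>' where "\<Delta>' = (\<lambda>\<phi>. inverse t * \<Delta>\<^sub>1 \<phi>)"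
  define \<delta> where "\<delta> i = (\<lambda>\<phi>. left_act s U V (T' i) \<Delta> \<phi> - right_act s U V (T' i) \<Delta> \<phi>)" for i

  \<comment> \<open>Each summand is e_bc \<Delta> e_cb = e_bc e_cb \<Delta> - e_bc (e_cb \<Delta> -
    \<Delta> e_cb), where the bracket is the commutator \<open>\<delta>\<close>. The products e_bc
    e_cb = e_bb do not depend on c, and summing them over b gives the identity of Z.\<close>
  have diff: "\<Delta>\<^sub>1 \<phi> = of_nat (card B) * \<Delta> \<phi> - (\<Sum>i\<in>I. tensor_map U V (\<lambda>R. T i \<circ> R) (\<lambda>S. S) (\<delta> i) \<phi>)"
    for \<phi>
  proof (cases "\<phi> \<in> forms U V")
    case True
    have pb: "(\<lambda>R S. \<phi> (T i \<circ> R) S) \<in> forms U V" if "i \<in> I" for i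
      by (rule forms_pullback[OF True om(1)[OF T(1)[OF that]] op_map_id op op])
    have pb': "(\<lambda>R S. \<phi> (T i \<circ> (T' i \<circ> R)) S) \<in> forms U V" if "i \<in> I" for i
      by (rule forms_pullback[OF pb[OF that] om(1)[OF T(2)[OF that]] op_map_id op op])
    have "tensor_map U V (\<lambda>R. T i \<circ> R) (\<lambda>S. S) (\<delta> i) \<phi>
        = \<Delta> (\<lambda>R S. \<phi> (T i \<circ> (T' i \<circ> R)) S) - \<Delta> (\<lambda>R S. \<phi> (T i \<circ> R) (S \<circ> T' i))" if "i \<in> I" for i
      using True pb[OF that] by (simp add: tensor_map_def \<delta>_def left_act_def right_act_def)
    then have "(\<Sum>i\<in>I. tensor_map U V (\<lambda>R. T i \<circ> R) (\<lambda>S. S) (\<delta> i) \<phi>)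
        = (\<Sum>i\<in>I. \<Delta> (\<lambda>R S. \<phi> (T i \<circ> (T' i \<circ> R)) S)) - (\<Sum>i\<in>I. \<Delta> (\<lambda>R S. \<phi> (T i \<circ> R) (S \<circ> T' i)))"
      by (simp add: sum_subtractf)
    also have "(\<Sum>i\<in>I. \<Delta> (\<lambda>R S. \<phi> (T i \<circ> R) (S \<circ> T' i))) = \<Delta>\<^sub>1 \<phi>"
      using True tensor_form_sum[OF D op I form1[OF True]] by (simp add: \<Delta>\<^sub>1_def avg_def)
    also have "(\<Sum>i\<in>I. \<Delta> (\<lambda>R S. \<phi> (T i \<circ> (T' i \<circ> R)) S)) = \<Delta> (\<lambda>R S. \<Sum>i\<in>I. \<phi> (T i \<circ> (T' i \<circ> R)) S)"
      by (rule tensor_form_sum[OF D op I pb', symmetric])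
    also have "\<dots> = \<Delta> (\<lambda>R S. of_nat (card B) * \<phi> R S)"
    proof (rule tensor_cong[OF D op])
      fix R S assume RS: "R \<in> U" "S \<in> V"
      have "(\<Sum>i\<in>I. \<phi> (T i \<circ> (T' i \<circ> R)) S) = (\<Sum>b\<in>B. \<Sum>c\<in>B. \<phi> (e b c \<circ> (e c b \<circ> R)) S)"
        by (simp add: I_def T_def T'_def sum.cartesian_product case_prod_beta)
      also have "\<dots> = (\<Sum>b\<in>B. \<Sum>c\<in>B. \<phi> (e b b \<circ> R) S)"
      proof (intro sum.cong refl)
        fix b c assume bc: "b \<in> B" "c \<in> B"
        have "e b c (e c b (R x)) = e b b (R x)" for x
          using RZ[OF RS(1)] bc B(2) subspace_scale[OF Z, of c]
          by (simp add: e_def dual_spaceD(2)[OF g] biorth subset_iff)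
        then have "e b c \<circ> (e c b \<circ> R) = e b b \<circ> R" by auto
        then show "\<phi> (e b c \<circ> (e c b \<circ> R)) S = \<phi> (e b b \<circ> R) S" by simp
      qed
      also have "\<dots> = of_nat (card B) * (\<Sum>b\<in>B. 1 * \<phi> (e b b \<circ> R) S)"
        by (simp add: sum_distrib_left)
      also have "(\<Sum>b\<in>B. 1 * \<phi> (e b b \<circ> R) S) = \<phi> (\<lambda>x. \<Sum>b\<in>B. s 1 ((e b b \<circ> R) x)) S"
        using op_mapD(2)[OF om(1)[OF eFR]] RS by (intro forms_sum_left[OF True op(1) B(1),
            symmetric]) auto
      also have "(\<lambda>x. \<Sum>b\<in>B. s 1 ((e b b \<circ> R) x)) = R"
        using expand[OF RZ[OF RS(1)], symmetric] RZ[OF RS(1)] by (simp add: e_def)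
      finally show "(\<Sum>i\<in>I. \<phi> (T i \<circ> (T' i \<circ> R)) S) = of_nat (card B) * \<phi> R S" .
    qed
    also have "\<dots> = of_nat (card B) * \<Delta> \<phi>" by (rule tensor_form_scale[OF D True])
    finally have eq: "(\<Sum>i\<in>I. tensor_map U V (\<lambda>R. T i \<circ> R) (\<lambda>S. S) (\<delta> i) \<phi>)
      = of_nat (card B) * \<Delta> \<phi> - \<Delta>\<^sub>1 \<phi>" .
    show ?thesis unfolding eq by simp
  next
    \<comment> \<open>Outside the forms all three terms are 0 by the convention for tensors.\<close>
    case False
    then show ?thesis using D by (auto simp: \<Delta>\<^sub>1_def tensor_map_def proj_tensor_def
        tensor_series_def)
  qed
  have "tensor_le U V (\<lambda>\<phi>. of_nat (card B) * \<Delta> \<phi>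
      - (\<Sum>i\<in>I. tensor_map U V (\<lambda>R. T i \<circ> R) (\<lambda>S. S) (\<delta> i) \<phi>))
      (norm (of_nat (card B) :: 'k) * r + (\<Sum>i\<in>I. onorm (T i) * 1 * \<epsilon>))"
  proof (intro tensor_le_diff tensor_le_scale[OF \<Delta>] tensor_le_sum I op)
    fix i assume i: "i \<in> I"
    have "tensor_le U V (\<delta> i) \<epsilon>" using i comm by (auto simp: \<delta>_def T'_def I_def)
    then show "tensor_le U V (tensor_map U V (\<lambda>R. T i \<circ> R) (\<lambda>S. S) (\<delta> i)) (onorm (T i) * 1 * \<epsilon>)"
      by (rule tensor_le_map[OF _ om(1)[OF T(1)[OF i]] op_map_id op op])
  qed
  then have "tensor_le U V \<Delta>\<^sub>1 (norm (of_nat (card B) :: 'k) * r + (\<Sum>i\<in>I. onorm (T i) * 1 * \<epsilon>))"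
    unfolding diff[abs_def] .
  \<comment> \<open>By \<open>small\<close> the commutators together cost at most
    \<open>card B\<close>, which is one extra unit per dimension.\<close>
  then have "tensor_le U V \<Delta>\<^sub>1 (card B * (r + 1))"
    by (rule tensor_le_mono) (use small in \<open>simp add: T_def I_def algebra_simps\<close>)
  from tensor_le_scale[OF this op, of "inverse t"]
  have "tensor_le U V \<Delta>' (norm (inverse t) * (card B * (r + 1)))" by (simp add: \<Delta>'_def)
  \<comment> \<open>Since \<open>t\<close> is within \<open>card B / 2\<close> of
    \<open>card B\<close>, dividing by it cancels the factor \<open>card B\<close> up to a factor
    2.\<close>
  moreover have t0: "real (card B) \<le> 2 * norm t"
    using norm_triangle_ineq3[of "of_nat (card B)" t] trace
    by (simp add: t_def[symmetric] norm_minus_commute)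
  have "norm (inverse t) * (card B * (r + 1)) \<le> 2 * (r + 1)"
  proof -
    have "norm (inverse t) * card B \<le> 2"
    proof (cases "t = 0")
      case False
      then have "0 < norm t" by simp
      with t0 show ?thesis unfolding norm_inverse by (simp add: field_simps)
    qed simp
    from mult_right_mono[OF this, of "r + 1"] r show ?thesis by (simp add: mult.assoc)
  qed
  ultimately have \<Delta>'_le: "tensor_le U V \<Delta>' (2 * (r + 1))" by (rule tensor_le_mono)
  then have D': "\<Delta>' \<in> proj_tensor s U V" by (rule tensor_le_mem)

  have bilinear: "left_act s U V W \<Delta>' = right_act s U V W \<Delta>'" if W: "W \<in> finite_rank_ops s Z Z"
    for W
  proof
    fix \<phi>
    note WB = finite_rank_bounded[OF W]
    have WZ: "W x \<in> Z" for x
      using bounded_opsD(1,2)[OF WB, of x] subspace_0[OF Z] by (cases "x \<in> Z") auto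
    show "left_act s U V W \<Delta>' \<phi> = right_act s U V W \<Delta>' \<phi>"
    proof (cases "\<phi> \<in> forms U V")
      case True
      have fl: "(\<lambda>R S. \<phi> (W \<circ> R) S) \<in> forms U V"
        by (rule forms_pullback[OF True om(1)[OF W] op_map_id op op])
      have fr: "(\<lambda>R S. \<phi> R (S \<circ> W)) \<in> forms U V"
        by (rule forms_pullback[OF True op_map_id om(2)[OF W] op op])
      have "\<Delta> (avg (\<lambda>R S. \<phi> (W \<circ> R) S)) = \<Delta> (avg (\<lambda>R S. \<phi> R (S \<circ> W)))"
      proof (rule tensor_cong[OF D op])
        fix R S assume RS: "R \<in> U" "S \<in> V"
        have mem: "e b c \<circ> R \<in> U" "S \<circ> e b c \<in> V" if "b \<in> B" "c \<in> B" for b c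
          using op_mapD(2)[OF om(1)[OF eFR[OF that]] RS(1)] op_mapD(2)[OF om(2)[OF eFR[OF that]]
              RS(2)] by auto
        \<comment> \<open>Column expansion: W e_bc is the sum over a of \<open>g a (W b)\<close>
          times e_ac.\<close>
        have L: "\<phi> (W \<circ> (e b c \<circ> R)) (S \<circ> e c b) = (\<Sum>a\<in>B. g a (W b) * \<phi> (e a c \<circ> R) (S \<circ> e c b))"
          if bc: "b \<in> B" "c \<in> B" for b c
        proof -
          have "W (e b c z) = (\<Sum>a\<in>B. s (g a (W b)) (e a c z))" if z: "z \<in> Z" for z
          proof -
            have "W (e b c z) = s (g c z) (W b)" using z bc B(2) bounded_opsD(4)[OF WB, of b]
              by (auto simp: e_def)
            also have "\<dots> = s (g c z) (\<Sum>a\<in>B. s (g a (W b)) a)" using expand[OF WZ[of b]] by simp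
            also have "\<dots> = (\<Sum>a\<in>B. s (g a (W b)) (e a c z))"
              using z by (simp add: scale_sum_right e_def mult.commute)
            finally show ?thesis .
          qed
          with RZ[OF RS(1)] have "W \<circ> (e b c \<circ> R) = (\<lambda>x. \<Sum>a\<in>B. s (g a (W b)) ((e a c \<circ> R) x))"
            by auto
          moreover have "\<phi> (\<lambda>x. \<Sum>a\<in>B. s (g a (W b)) ((e a c \<circ> R) x)) (S \<circ> e c b)
              = (\<Sum>a\<in>B. g a (W b) * \<phi> (e a c \<circ> R) (S \<circ> e c b))"
            by (rule forms_sum_left[OF True op(1) B(1), where R = "\<lambda>a. e a c \<circ> R"]) (intro mem bc;
                assumption)+
          ultimately show ?thesis by simp
        qed
        \<comment> \<open>Row expansion: e_cb W is the sum over a of \<open>g b (W a)\<close> times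
          e_ca.\<close>
        have R: "\<phi> (e b c \<circ> R) (S \<circ> e c b \<circ> W) = (\<Sum>a\<in>B. g b (W a) * \<phi> (e b c \<circ> R) (S \<circ> e c a))"
          if bc: "b \<in> B" "c \<in> B" for b c
        proof -
          have "S (e c b (W z)) = (\<Sum>a\<in>B. s (g b (W a)) (S (e c a z)))" if z: "z \<in> Z" for z
          proof -
            have "W z = (\<Sum>a\<in>B. s (g a z) (W a))"
            proof -
              have "W z = W (\<Sum>a\<in>B. s (g a z) a)" using expand[OF z] by simp
              also have "\<dots> = (\<Sum>a\<in>B. W (s (g a z) a))"
                using B(2) by (intro bounded_ops_sum[OF WB Z B(1)] subspace_scale[OF Z]) auto
              also have "\<dots> = (\<Sum>a\<in>B. s (g a z) (W a))"
                using B(2) by (intro sum.cong refl bounded_opsD(4)[OF WB]) auto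
              finally show ?thesis .
            qed
            then have "g b (W z) = (\<Sum>a\<in>B. g a z * g b (W a))"
              using linear_sum[OF bounded_linear.linear[OF dual_space_bounded_linear[OF g[OF
                  bc(1)]]], of "\<lambda>a. s (g a z) (W a)" B]
              by (simp add: dual_spaceD(2)[OF g[OF bc(1)]])
            then have "e c b (W z) = (\<Sum>a\<in>B. s (g b (W a)) (e c a z))"
              using z WZ by (simp add: e_def scale_sum_left mult.commute)
            also have "S \<dots> = (\<Sum>a\<in>B. S (s (g b (W a)) (e c a z)))"
              using bc B(2) z
              by (intro bounded_ops_sum[OF subsetD[OF UB(2) RS(2)] Z B(1)] subspace_scale[OF Z])
                (auto simp: e_def subspace_scale[OF Z])
            also have "\<dots> = (\<Sum>a\<in>B. s (g b (W a)) (S (e c a z)))"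
              using bc B(2) z
              by (intro sum.cong refl bounded_opsD(4)[OF subsetD[OF UB(2) RS(2)]])
                (auto simp: e_def subspace_scale[OF Z])
            finally show ?thesis .
          qed
          moreover have "S (e c b (W z)) = (\<Sum>a\<in>B. s (g b (W a)) (S (e c a z)))" if z: "z \<notin> Z" for z
            using z bounded_opsD(2)[OF WB z] bounded_ops_zero[OF subsetD[OF UB(2) RS(2)]]
              subspace_0[OF Z] dual_spaceD(2)[OF g[OF bc(1)], of 0 0]
            by (simp add: e_def)
          ultimately have "S \<circ> e c b \<circ> W = (\<lambda>x. \<Sum>a\<in>B. s (g b (W a)) ((S \<circ> e c a) x))"
            by (auto simp: fun_eq_iff)
          moreover have "\<phi> (e b c \<circ> R) (\<lambda>x. \<Sum>a\<in>B. s (g b (W a)) ((S \<circ> e c a) x))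
              = (\<Sum>a\<in>B. g b (W a) * \<phi> (e b c \<circ> R) (S \<circ> e c a))"
            by (rule forms_sum_right[OF True op(2) B(1), where S = "\<lambda>a. S \<circ> e c a"]) (intro mem
                bc; assumption)+
          ultimately show ?thesis by simp
        qed
        have "avg (\<lambda>R S. \<phi> (W \<circ> R) S) R S = (\<Sum>b\<in>B. \<Sum>c\<in>B. \<phi> (W \<circ> (e b c \<circ> R)) (S \<circ> e c b))"
          by (simp add: avg_def I_def T_def T'_def sum.cartesian_product case_prod_beta)
        also have "\<dots> = (\<Sum>b\<in>B. \<Sum>c\<in>B. \<Sum>a\<in>B. g a (W b) * \<phi> (e a c \<circ> R) (S \<circ> e c b))"
          by (intro sum.cong refl L)
        \<comment> \<open>Reordering so that b becomes the innermost index; the inner sum is then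
          the row expansion with the names a and b exchanged.\<close>
        also have "\<dots> = (\<Sum>b\<in>B. \<Sum>a\<in>B. \<Sum>c\<in>B. g a (W b) * \<phi> (e a c \<circ> R) (S \<circ> e c b))"
          by (intro sum.cong refl sum.swap)
        also have "\<dots> = (\<Sum>a\<in>B. \<Sum>b\<in>B. \<Sum>c\<in>B. g a (W b) * \<phi> (e a c \<circ> R) (S \<circ> e c b))"
          by (rule sum.swap)
        also have "\<dots> = (\<Sum>a\<in>B. \<Sum>c\<in>B. \<Sum>b\<in>B. g a (W b) * \<phi> (e a c \<circ> R) (S \<circ> e c b))"
          by (intro sum.cong refl sum.swap)
        also have "\<dots> = (\<Sum>a\<in>B. \<Sum>c\<in>B. \<phi> (e a c \<circ> R) (S \<circ> e c a \<circ> W))"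
          by (intro sum.cong refl R[symmetric])
        also have "\<dots> = avg (\<lambda>R S. \<phi> R (S \<circ> W)) R S"
          by (simp add: avg_def I_def T_def T'_def sum.cartesian_product case_prod_beta)
        finally show "avg (\<lambda>R S. \<phi> (W \<circ> R) S) R S = avg (\<lambda>R S. \<phi> R (S \<circ> W)) R S" .
      qed
      then show ?thesis using True fl fr by (simp add: left_act_def right_act_def \<Delta>'_def \<Delta>\<^sub>1_def)
    qed (simp add: left_act_def right_act_def)
  qed

  have unit: "tensor_mult s U V \<Delta>' z = z" if z: "z \<in> Z" for z
  proof (rule separated_eqI[OF sep])
    fix f assume f: "f \<in> dual_space s"
    note linf = linear_sum[OF bounded_linear.linear[OF dual_space_bounded_linear[OF f]]]
    have trace_form: "(\<lambda>R S. \<Sum>c\<in>B. g c (R (S c))) \<in> forms U V"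
      by (intro forms_sum B(1) op form_apply[OF UB Y] g)
    have "f (tensor_mult s U V \<Delta>' z) = \<Delta>' (\<lambda>R S. f (R (S z)))"
      by (rule dual_tensor_mult[OF sep UB Y D' f])
    also have "\<dots> = inverse t * \<Delta> (\<lambda>R S. \<Sum>i\<in>I. f ((T i \<circ> R) ((S \<circ> T' i) z)))"
      using form_apply[OF UB Y f] by (simp add: \<Delta>'_def \<Delta>\<^sub>1_def avg_def)
    also have "\<Delta> (\<lambda>R S. \<Sum>i\<in>I. f ((T i \<circ> R) ((S \<circ> T' i) z))) = \<Delta> (\<lambda>R S. f z * (\<Sum>c\<in>B. g c (R (S c))))"
    proof (rule tensor_cong[OF D op])
      fix R S assume RS: "R \<in> U" "S \<in> V"
      \<comment> \<open>The summand splits into a factor depending on b only and one depending on c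
        only. The first factors sum to \<open>f z\<close>, the second to the trace form.\<close>
      have "f (e b c (R (S (e c b z)))) = (g b z * f b) * g c (R (S c))" if bc: "b \<in> B" "c \<in> B"
        for b c
      proof -
        have "S (e c b z) = s (g b z) (S c)"
          using z bc B(2) bounded_opsD(4)[OF subsetD[OF UB(2) RS(2)], of c] by (auto simp: e_def)
        then have "R (S (e c b z)) = s (g b z) (R (S c))"
          using bounded_opsD(4)[OF subsetD[OF UB(1) RS(1)] SY[OF RS(2)]] by simp
        then show ?thesis
          using RZ[OF RS(1)] by (simp add: e_def subspace_scale[OF Z] dual_spaceD(2)[OF g[OF
              bc(2)]] dual_spaceD(2)[OF f])
      qed
      then have "(\<Sum>i\<in>I. f ((T i \<circ> R) ((S \<circ> T' i) z))) = (\<Sum>b\<in>B. \<Sum>c\<in>B. (g b z * f b) * g c (R (S c)))"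
        unfolding I_def T_def T'_def sum.cartesian_product by (intro sum.cong) auto
      also have "\<dots> = (\<Sum>b\<in>B. g b z * f b) * (\<Sum>c\<in>B. g c (R (S c)))"
        by (simp add: sum_product)
      also have "(\<Sum>b\<in>B. g b z * f b) = f z"
        using linf[of "\<lambda>b. s (g b z) b" B] expand[OF z] by (simp add: dual_spaceD(2)[OF f])
      finally show "(\<Sum>i\<in>I. f ((T i \<circ> R) ((S \<circ> T' i) z))) = f z * (\<Sum>c\<in>B. g c (R (S c)))" .
    qed
    also have "\<dots> = f z * t"
      unfolding t_def by (rule tensor_form_scale[OF D trace_form])
    also have "inverse t * (f z * t) = f z"
    proof (cases "t = 0")
      \<comment> \<open>A vanishing trace forces \<open>card B = 0\<close>, hence Z = {0}; the
        convention \<open>inverse 0 = 0\<close> is harmless here.\<close>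
      case True
      with t0 B(1) have "B = {}" by simp
      with expand[OF z] have "z = 0" by simp
      then show ?thesis using dual_spaceD(2)[OF f, of 0 0] by simp
    qed simp
    finally show "f (tensor_mult s U V \<Delta>' z) = f z" .
  qed
  have "generalized_diagonal s Y Z (finite_rank_ops s Z Z) \<Delta>'"
    unfolding generalized_diagonal_def Let_def U_def[symmetric] V_def[symmetric]
  proof (intro conjI ballI D' bilinear)
    fix W assume W: "W \<in> finite_rank_ops s Z Z"
    have "W x \<in> Z" for x
      using bounded_opsD(1,2)[OF finite_rank_bounded[OF W], of x] subspace_0[OF Z]
        by (cases "x \<in> Z") auto
    then show "tensor_mult s U V \<Delta>' \<circ> W = W" using unit by auto
  qed
  with proj_norm_le[OF \<Delta>'_le op] show ?thesis by blast
qed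

end

subsection \<open>Nets of projections\<close>

lemma norm_add_diff_le: "norm (a + (b - c)) \<le> norm a + (norm b + norm c)"
  using norm_triangle_ineq[of a "b - c"] norm_triangle_ineq4[of b c] by linarith

text \<open>The bound is normalised to \<open>1 \<le> N\<close>, which makes it a positive factor in
  all later estimates.\<close>

locale projection_net = banach_over s
  for s :: "'k::{real_normed_field, euclidean_space} \<Rightarrow> 'x::banach \<Rightarrow> 'x" +
  fixes A :: "'i set" and le :: "'i \<Rightarrow> 'i \<Rightarrow> bool" and P :: "'i \<Rightarrow> 'x \<Rightarrow> 'x" and N :: real
  assumes directed: "directed_set A le"
    and approximable: "\<alpha> \<in> A \<Longrightarrow> P \<alpha> \<in> approximable_ops s"
    and idem: "\<alpha> \<in> A \<Longrightarrow> P \<alpha> \<circ> P \<alpha> = P \<alpha>"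
    and N: "1 \<le> N" and onorm_P: "\<alpha> \<in> A \<Longrightarrow> onorm (P \<alpha>) \<le> N"
    and strong: "((\<lambda>\<alpha>. P \<alpha> x) \<longlongrightarrow> x) (tails A le)"
    and strong_dual: "f \<in> dual_space s \<Longrightarrow>
      ((\<lambda>\<alpha>. onorm (\<lambda>x. (f \<circ> P \<alpha>) x - f x)) \<longlongrightarrow> 0) (tails A le)"
begin

lemmas P_bounded = approximable_bounded[OF approximable]
lemmas P_bounded_map = bounded_ops_bounded_map[OF P_bounded]

lemma P_idem: "\<alpha> \<in> A \<Longrightarrow> P \<alpha> (P \<alpha> x) = P \<alpha> x"
  using idem by (metis comp_apply)

lemma P_range: "\<alpha> \<in> A \<Longrightarrow> x \<in> range (P \<alpha>) \<Longrightarrow> P \<alpha> x = x"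
  by (auto simp: P_idem)

lemma subspace_range: "\<alpha> \<in> A \<Longrightarrow> subspace (range (P \<alpha>))"
  by (rule projection_range_subspace[OF P_bounded P_idem])

lemma P_finite_rank:
  assumes \<alpha>: "\<alpha> \<in> A"
  shows "P \<alpha> \<in> finite_rank_ops s UNIV (range (P \<alpha>))"
  using approximable_projection_finite_rank[OF approximable[OF \<alpha>] idem[OF \<alpha>]] subset_refl
  by (rule finite_rank_codomain)

text \<open>This is the identity operator of X_\<alpha>. Inserted for W, it turns the second
  condition on a generalized diagonal into \<pi>(\<Delta>) being the identity on X_\<alpha>.\<close>

lemma restr_finite_rank:
  assumes \<alpha>: "\<alpha> \<in> A"
  shows "restr (range (P \<alpha>)) \<in> finite_rank_ops s (range (P \<alpha>)) (range (P \<alpha>))"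
proof -
  have "(P \<alpha> \<circ> restr (range (P \<alpha>))) x = restr (range (P \<alpha>)) x" for x
    using P_range[OF \<alpha>, of x] bounded_ops_zero[OF P_bounded[OF \<alpha>]]
    unfolding restr_def comp_def by presburger
  then have "P \<alpha> \<circ> restr (range (P \<alpha>)) = restr (range (P \<alpha>))" by (rule ext)
  with finite_rank_compose_right[OF P_finite_rank[OF \<alpha>] restr_bounded_ops[OF subspace_range[OF \<alpha>]]]
  show ?thesis by simp
qed

text \<open>If all functionals vanish at x, so do the coordinates of P_\<alpha> x; thus P_\<alpha> x
  = 0 for all \<alpha>, and strong convergence gives x = 0.\<close>

lemma separated: separated
  unfolding separated_def
proof (intro allI impI)
  fix x assume x: "\<forall>f\<in>dual_space s. f x = 0"
  have "P \<alpha> x = 0" if \<alpha>: "\<alpha> \<in> A" for \<alpha>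
  proof -
    from projection_expansion[OF approximable[OF \<alpha>] idem[OF \<alpha>]] obtain B g where
      "\<And>b. b \<in> B \<Longrightarrow> g b \<in> dual_space s" "\<And>x. P \<alpha> x = (\<Sum>b\<in>B. s (g b x) b)" by metis
    with x have "P \<alpha> x = (\<Sum>b\<in>B. 0)" by (metis (no_types, lifting) scale_zero_left sum.cong)
    then show ?thesis by simp
  qed
  then have "eventually (\<lambda>\<alpha>. 0 = P \<alpha> x) (tails A le)"
    by (intro eventually_mono[OF eventually_tails_mem[OF directed]]) auto
  from Lim_transform_eventually[OF tendsto_const this] have "((\<lambda>\<alpha>. P \<alpha> x) \<longlongrightarrow> 0) (tails A le)" .
  from tendsto_unique[OF tails_neq_bot[OF directed] strong this] show "x = 0" .
qed

text \<open>For a finite-rank operator only the finitely many basis vectors of its range have to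
  converge under P_\<alpha>, so strong convergence becomes norm convergence. Density does the
  rest.\<close>

lemma P_left_tendsto:
  assumes "T \<in> approximable_ops s"
  shows "((\<lambda>\<alpha>. onorm (\<lambda>x. P \<alpha> (T x) - T x)) \<longlongrightarrow> 0) (tails A le)"
proof (rule approximable_tendsto_zero[where C = "N + 1", OF _ _ _ _ assms])
  fix S assume S: "S \<in> finite_rank_ops s UNIV UNIV"
  from finite_rank_expansion[OF this] obtain B g where B: "finite B"
      "\<And>b. b \<in> B \<Longrightarrow> g b \<in> dual_space s"
    and ex: "\<And>x. S x = (\<Sum>b\<in>B. s (g b x) b)" by metis
  have "((\<lambda>\<alpha>. \<Sum>b\<in>B. onorm (g b) * norm (P \<alpha> b - b)) \<longlongrightarrow> (\<Sum>b\<in>B. onorm (g b) * norm (b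
      - b))) (tails A le)"
    by (intro tendsto_intros strong)
  then have lim: "((\<lambda>\<alpha>. \<Sum>b\<in>B. onorm (g b) * norm (P \<alpha> b - b)) \<longlongrightarrow> 0) (tails A le)" by simp
  have "norm (onorm (\<lambda>x. P \<alpha> (S x) - S x)) \<le> (\<Sum>b\<in>B. onorm (g b) * norm (P \<alpha> b - b))" if \<alpha>: "\<alpha> \<in> A"
    for \<alpha>
  proof -
    have "norm (P \<alpha> (S x) - S x) \<le> (\<Sum>b\<in>B. onorm (g b) * norm (P \<alpha> b - b)) * norm x" for x
    proof -
      have "P \<alpha> (S x) = (\<Sum>b\<in>B. s (g b x) (P \<alpha> b))"
        unfolding ex using bounded_opsD(4)[OF P_bounded[OF \<alpha>] UNIV_I]
        by (subst bounded_ops_sum[OF P_bounded[OF \<alpha>] subspace_UNIV B(1)]) auto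
      then have "P \<alpha> (S x) - S x = (\<Sum>b\<in>B. s (g b x) (P \<alpha> b - b))"
        by (simp add: ex scale_right_diff_distrib sum_subtractf)
      also have "norm \<dots> \<le> (\<Sum>b\<in>B. norm (s (g b x) (P \<alpha> b - b)))" by (rule norm_sum)
      also have "\<dots> \<le> (\<Sum>b\<in>B. (onorm (g b) * norm x) * norm (P \<alpha> b - b))"
        unfolding norm_scale using B(2)
          by (intro sum_mono mult_right_mono norm_le_onorm dual_spaceD(3)) auto
      finally show ?thesis by (simp add: sum_distrib_left mult_ac)
    qed
    moreover have "0 \<le> (\<Sum>b\<in>B. onorm (g b) * norm (P \<alpha> b - b))"
      using B(2) by (intro sum_nonneg mult_nonneg_nonneg onorm_nonneg dual_spaceD(3)) auto
    ultimately have "onorm (\<lambda>x. P \<alpha> (S x) - S x) \<le> (\<Sum>b\<in>B. onorm (g b) * norm (P \<alpha> b - b))"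
      by (intro onorm_bound) auto
    moreover have "0 \<le> onorm (\<lambda>x. P \<alpha> (S x) - S x)"
      using P_bounded_map[OF \<alpha>] bounded_ops_bounded_map[OF finite_rank_bounded[OF S]]
      by (intro onorm_nonneg bounded_map_compose_minus)
    ultimately show ?thesis by simp
  qed
  with eventually_tails_mem[OF directed]
  show "((\<lambda>\<alpha>. onorm (\<lambda>x. P \<alpha> (S x) - S x)) \<longlongrightarrow> 0) (tails A le)"
    by (intro Lim_null_comparison[OF _ lim]) (auto elim: eventually_mono)
next
  show "eventually (\<lambda>\<alpha>. \<forall>T\<in>approximable_ops s. 0 \<le> onorm (\<lambda>x. P \<alpha> (T x) - T x)) (tails A le)"
  proof (rule eventually_mono[OF eventually_tails_mem[OF directed]], intro ballI)
    fix \<alpha> T assume "\<alpha> \<in> A" "T \<in> approximable_ops s"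
    then show "0 \<le> onorm (\<lambda>x. P \<alpha> (T x) - T x)"
      by (intro onorm_nonneg bounded_map_compose_minus P_bounded_map
          op_spaceD(4)[OF op_space_approximable])
  qed
  show "eventually (\<lambda>\<alpha>. \<forall>T\<in>approximable_ops s. \<forall>S\<in>finite_rank_ops s UNIV UNIV.
      onorm (\<lambda>x. P \<alpha> (T x) - T x) \<le> onorm (\<lambda>x. P \<alpha> (S x) - S x) + (N + 1) * onorm (\<lambda>x. T x - S x))
          (tails A le)"
  proof (rule eventually_mono[OF eventually_tails_mem[OF directed]], intro ballI)
    fix \<alpha> T S assume \<alpha>: "\<alpha> \<in> A" and T: "T \<in> approximable_ops s" and S:
        "S \<in> finite_rank_ops s UNIV UNIV"
    have b: "bounded_map (P \<alpha>)" "bounded_map T" "bounded_map S"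
      using P_bounded_map[OF \<alpha>] op_spaceD(4)[OF op_space_approximable] T
          finite_rank_approximable[OF S] by auto
    have b': "bounded_map (\<lambda>x. T x - S x)" "bounded_map (\<lambda>x. P \<alpha> (S x) - S x)"
      using b by (blast intro: bounded_map_minus bounded_map_compose_minus)+
    show "onorm (\<lambda>x. P \<alpha> (T x) - T x) \<le> onorm (\<lambda>x. P \<alpha> (S x) - S x) + (N + 1) * onorm (\<lambda>x. T x
        - S x)"
    proof (rule onorm_bound)
      fix x
      \<comment> \<open>Replacing T by S changes the error by P_\<alpha> - I applied to T - S, which
        explains the Lipschitz constant \<open>N + 1\<close>.\<close>
      have "P \<alpha> (T x) - T x = (P \<alpha> (S x) - S x) + (P \<alpha> (T x - S x) - (T x - S x))"
        using linear_diff[OF bounded_linear.linear[OF bounded_ops_bounded_linear[OF P_bounded[OF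
            \<alpha>]]], of "T x" "S x"]
        by simp
      then have "norm (P \<alpha> (T x) - T x) \<le> norm (P \<alpha> (S x) - S x) + (norm (P \<alpha> (T x - S x))
          + norm (T x - S x))"
        by (metis norm_add_diff_le)
      also have "norm (P \<alpha> (T x - S x)) \<le> N * norm (T x - S x)"
        by (rule order_trans[OF norm_le_onorm[OF b(1)]]) (intro mult_right_mono onorm_P \<alpha>; simp)
      also have "norm (P \<alpha> (S x) - S x) + (N * norm (T x - S x) + norm (T x - S x))
          = norm (P \<alpha> (S x) - S x) + (N + 1) * norm (T x - S x)" by (simp add: algebra_simps)
      also have "\<dots> \<le> onorm (\<lambda>x. P \<alpha> (S x) - S x) * norm x + (N + 1) * (onorm (\<lambda>x. T x
          - S x) * norm x)"
        using N by (intro add_mono mult_left_mono norm_le_onorm[OF b'(1)] norm_le_onorm[OF b'(2)])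
            auto
      finally show "norm (P \<alpha> (T x) - T x)
          \<le> (onorm (\<lambda>x. P \<alpha> (S x) - S x) + (N + 1) * onorm (\<lambda>x. T x - S x)) * norm x"
        by (simp add: algebra_simps)
    qed (use N onorm_nonneg[OF b'(1)] onorm_nonneg[OF b'(2)] in auto)
  qed
qed (use N in simp)

text \<open>Here P_\<alpha> acts on the coordinate functionals instead of the basis vectors, and the
  strong convergence of the adjoints enters.\<close>

lemma P_right_tendsto:
  assumes "T \<in> approximable_ops s"
  shows "((\<lambda>\<alpha>. onorm (\<lambda>x. T (P \<alpha> x) - T x)) \<longlongrightarrow> 0) (tails A le)"
proof (rule approximable_tendsto_zero[where C = "N + 1", OF _ _ _ _ assms])
  fix S assume S: "S \<in> finite_rank_ops s UNIV UNIV"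
  from finite_rank_expansion[OF this] obtain B g where B: "finite B"
      "\<And>b. b \<in> B \<Longrightarrow> g b \<in> dual_space s"
    and ex: "\<And>x. S x = (\<Sum>b\<in>B. s (g b x) b)" by metis
  have "((\<lambda>\<alpha>. \<Sum>b\<in>B. onorm (\<lambda>x. (g b \<circ> P \<alpha>) x - g b x) * norm b) \<longlongrightarrow> (\<Sum>b\<in>B. 0 * norm b)) (tails A le)"
    by (intro tendsto_intros strong_dual B(2))
  then have lim: "((\<lambda>\<alpha>. \<Sum>b\<in>B. onorm (\<lambda>x. (g b \<circ> P \<alpha>) x - g b x) * norm b) \<longlongrightarrow> 0) (tails A le)" by simp
  have "norm (onorm (\<lambda>x. S (P \<alpha> x) - S x)) \<le> (\<Sum>b\<in>B. onorm (\<lambda>x. (g b \<circ> P \<alpha>) x - g b x) * norm b)"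
    if \<alpha>: "\<alpha> \<in> A" for \<alpha>
  proof -
    have gb: "bounded_map (\<lambda>x. (g b \<circ> P \<alpha>) x - g b x)" if "b \<in> B" for b
      using dual_spaceD(3)[OF B(2)[OF that]] P_bounded_map[OF \<alpha>]
      unfolding comp_def by (intro bounded_map_compose_minus)
    have "norm (S (P \<alpha> x) - S x) \<le> (\<Sum>b\<in>B. onorm (\<lambda>x. (g b \<circ> P \<alpha>) x - g b x) * norm b) * norm x"
      for x
    proof -
      have "S (P \<alpha> x) - S x = (\<Sum>b\<in>B. s (g b (P \<alpha> x) - g b x) b)"
        by (simp add: ex scale_left_diff_distrib sum_subtractf)
      also have "norm \<dots> \<le> (\<Sum>b\<in>B. norm (s (g b (P \<alpha> x) - g b x) b))" by (rule norm_sum)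
      also have "\<dots> \<le> (\<Sum>b\<in>B. (onorm (\<lambda>x. (g b \<circ> P \<alpha>) x - g b x) * norm x) * norm b)"
        unfolding norm_scale using norm_le_onorm[OF gb, of _ x]
          by (intro sum_mono mult_right_mono) auto
      finally show ?thesis by (simp add: sum_distrib_left mult_ac)
    qed
    moreover have "0 \<le> (\<Sum>b\<in>B. onorm (\<lambda>x. (g b \<circ> P \<alpha>) x - g b x) * norm b)"
      using gb by (intro sum_nonneg mult_nonneg_nonneg onorm_nonneg) auto
    ultimately have "onorm (\<lambda>x. S (P \<alpha> x) - S x) \<le> (\<Sum>b\<in>B. onorm (\<lambda>x. (g b \<circ> P \<alpha>) x
        - g b x) * norm b)"
      by (intro onorm_bound) auto
    moreover have "0 \<le> onorm (\<lambda>x. S (P \<alpha> x) - S x)"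
      using P_bounded_map[OF \<alpha>] bounded_ops_bounded_map[OF finite_rank_bounded[OF S]]
      by (intro onorm_nonneg bounded_map_compose_minus)
    ultimately show ?thesis by simp
  qed
  with eventually_tails_mem[OF directed]
  show "((\<lambda>\<alpha>. onorm (\<lambda>x. S (P \<alpha> x) - S x)) \<longlongrightarrow> 0) (tails A le)"
    by (intro Lim_null_comparison[OF _ lim]) (auto elim: eventually_mono)
next
  show "eventually (\<lambda>\<alpha>. \<forall>T\<in>approximable_ops s. 0 \<le> onorm (\<lambda>x. T (P \<alpha> x) - T x)) (tails A le)"
  proof (rule eventually_mono[OF eventually_tails_mem[OF directed]], intro ballI)
    fix \<alpha> T assume "\<alpha> \<in> A" "T \<in> approximable_ops s"
    then show "0 \<le> onorm (\<lambda>x. T (P \<alpha> x) - T x)"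
      by (intro onorm_nonneg bounded_map_compose_minus P_bounded_map
          op_spaceD(4)[OF op_space_approximable])
  qed
  show "eventually (\<lambda>\<alpha>. \<forall>T\<in>approximable_ops s. \<forall>S\<in>finite_rank_ops s UNIV UNIV.
      onorm (\<lambda>x. T (P \<alpha> x) - T x) \<le> onorm (\<lambda>x. S (P \<alpha> x) - S x) + (N + 1) * onorm (\<lambda>x. T x - S x))
          (tails A le)"
  proof (rule eventually_mono[OF eventually_tails_mem[OF directed]], intro ballI)
    fix \<alpha> T S assume \<alpha>: "\<alpha> \<in> A" and T: "T \<in> approximable_ops s" and S:
        "S \<in> finite_rank_ops s UNIV UNIV"
    have b: "bounded_map (P \<alpha>)" "bounded_map T" "bounded_map S"
      using P_bounded_map[OF \<alpha>] op_spaceD(4)[OF op_space_approximable] T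
          finite_rank_approximable[OF S] by auto
    have b': "bounded_map (\<lambda>x. T x - S x)" "bounded_map (\<lambda>x. S (P \<alpha> x) - S x)"
      using b by (blast intro: bounded_map_minus bounded_map_compose_minus)+
    let ?D = "onorm (\<lambda>x. T x - S x)"
    show "onorm (\<lambda>x. T (P \<alpha> x) - T x) \<le> onorm (\<lambda>x. S (P \<alpha> x) - S x) + (N + 1) * ?D"
    proof (rule onorm_bound)
      fix x
      have "T (P \<alpha> x) - T x = (S (P \<alpha> x) - S x) + ((T (P \<alpha> x) - S (P \<alpha> x)) - (T x - S x))"
        by simp
      then have "norm (T (P \<alpha> x) - T x) \<le> norm (S (P \<alpha> x) - S x) + (norm (T (P \<alpha> x) - S (P \<alpha> x))
          + norm (T x - S x))"
        by (metis norm_add_diff_le)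
      also have "\<dots> \<le> onorm (\<lambda>x. S (P \<alpha> x) - S x) * norm x + (?D * (N * norm x) + ?D * norm x)"
      proof (intro add_mono)
        show "norm (S (P \<alpha> x) - S x) \<le> onorm (\<lambda>x. S (P \<alpha> x) - S x) * norm x"
          by (rule norm_le_onorm[OF b'(2)])
        show "norm (T x - S x) \<le> ?D * norm x" by (rule norm_le_onorm[OF b'(1)])
        have "norm (P \<alpha> x) \<le> N * norm x"
          by (rule order_trans[OF norm_le_onorm[OF b(1)]]) (intro mult_right_mono onorm_P \<alpha>; simp)
        then show "norm (T (P \<alpha> x) - S (P \<alpha> x)) \<le> ?D * (N * norm x)"
          by (intro order_trans[OF norm_le_onorm[OF b'(1)]] mult_left_mono onorm_nonneg b'(1))
      qed
      finally show "norm (T (P \<alpha> x) - T x) \<le> (onorm (\<lambda>x. S (P \<alpha> x) - S x) + (N + 1) * ?D) * norm x"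
        by (simp add: algebra_simps)
    qed (use N onorm_nonneg[OF b'(1)] onorm_nonneg[OF b'(2)] in auto)
  qed
qed (use N in simp)

subsection \<open>From generalized diagonals to an approximate diagonal\<close>

text \<open>The compression P_\<alpha> a P_\<alpha> is an operator on X_\<alpha> in disguise, so it
  commutes with the lifted tensor exactly; the commutator with \<open>a\<close> is that with the
  remainder. The factor \<open>N * N\<close> pays for the two projections.\<close>

lemma lifted_diagonal:
  fixes \<alpha> \<beta> :: 'i and \<Delta> :: "('x, 'k) tensor"
  defines "U \<equiv> finite_rank_ops s (range (P \<beta>)) (range (P \<alpha>))"
    and "V \<equiv> finite_rank_ops s (range (P \<alpha>)) (range (P \<beta>))"
  defines "d \<equiv> tensor_map \<A> \<A> (\<lambda>R. R \<circ> P \<beta>) (\<lambda>S. S \<circ> P \<alpha>) \<Delta>"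
  assumes \<alpha>: "\<alpha> \<in> A" and \<beta>: "\<beta> \<in> A"
    and gd: "generalized_diagonal s (range (P \<beta>)) (range (P \<alpha>))
      (finite_rank_ops s (range (P \<alpha>)) (range (P \<alpha>))) \<Delta>"
    and K: "proj_norm s U V \<Delta> \<le> K"
  shows "tensor_le \<A> \<A> d (N * N * (K + 1))"
    and "tensor_mult s \<A> \<A> d = P \<alpha>"
    and "a \<in> \<A> \<Longrightarrow> tensor_le \<A> \<A> (\<lambda>\<phi>. left_act s \<A> \<A> a d \<phi> - right_act s \<A> \<A> a d \<phi>)
      (2 * (onorm (\<lambda>x. a x - P \<alpha> (a (P \<alpha> x))) * (N * N * (K + 1))))"
proof -
  have sp: "subspace (range (P \<alpha>))" "subspace (range (P \<beta>))"
    using \<alpha> \<beta> by (auto intro: subspace_range)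
  have op: "op_space U" "op_space V" "op_space \<A>"
    using sp by (auto simp: U_def V_def intro: op_space_finite_rank op_space_approximable)
  have \<Delta>: "\<Delta> \<in> proj_tensor s U V"
    "\<And>W. W \<in> finite_rank_ops s (range (P \<alpha>)) (range (P \<alpha>)) \<Longrightarrow> left_act s U V W \<Delta>
        = right_act s U V W \<Delta>"
    "\<And>W. W \<in> finite_rank_ops s (range (P \<alpha>)) (range (P \<alpha>)) \<Longrightarrow> tensor_mult s U V \<Delta> \<circ> W = W"
    using gd by (simp_all add: generalized_diagonal_def Let_def U_def V_def)
  have UB: "U \<subseteq> bounded_ops s (range (P \<beta>)) (range (P \<alpha>))" "V \<subseteq> bounded_ops s (range (P \<alpha>))
      (range (P \<beta>))"
    by (auto simp: U_def V_def finite_rank_bounded)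
  have AB: "\<A> \<subseteq> bounded_ops s UNIV UNIV" by (auto intro: approximable_bounded)
  have PB: "P \<gamma> \<in> bounded_ops s UNIV (range (P \<gamma>))" if "\<gamma> \<in> A" for \<gamma>
    using P_finite_rank[OF that] by (rule finite_rank_bounded)
  have lift: "R \<circ> P \<gamma> \<in> \<A>" if "R \<in> finite_rank_ops s (range (P \<gamma>)) Z" "\<gamma> \<in> A" for R Z \<gamma>
    using finite_rank_compose_right[OF that(1) PB[OF that(2)]]
    by (intro finite_rank_approximable finite_rank_codomain[where Z' = UNIV]) auto
  have \<Phi>: "op_map U \<A> N (\<lambda>R. R \<circ> P \<beta>)"
    by (rule op_map_mono[OF op_map_right[OF P_bounded_map[OF \<beta>] op(1)] onorm_P[OF \<beta>] op(1)])
      (auto simp: U_def intro: lift \<beta>)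
  have \<Psi>: "op_map V \<A> N (\<lambda>S. S \<circ> P \<alpha>)"
    by (rule op_map_mono[OF op_map_right[OF P_bounded_map[OF \<alpha>] op(2)] onorm_P[OF \<alpha>] op(2)])
      (auto simp: V_def intro: lift \<alpha>)
  \<comment> \<open>One unit of room, as the infimum defining the norm may not be attained.\<close>
  have "tensor_le U V \<Delta> (K + 1)" using K by (intro tensor_le_proj_norm \<Delta>(1)) simp
  from tensor_le_map[OF this \<Phi> \<Psi> op(1,2,3,3)]
  show d_le: "tensor_le \<A> \<A> d (N * N * (K + 1))" by (simp add: d_def)
  then have d: "d \<in> proj_tensor s \<A> \<A>" by (rule tensor_le_mem)
  have d_eq: "d \<phi> = \<Delta> (\<lambda>R S. \<phi> (R \<circ> P \<beta>) (S \<circ> P \<alpha>))" if "\<phi> \<in> forms \<A> \<A>" for \<phi>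
    using that by (simp add: d_def tensor_map_def)
  have fix_range: "P \<gamma> (P \<gamma> x) = P \<gamma> x" if "\<gamma> \<in> A" for \<gamma> x using P_idem[OF that] .
  show "tensor_mult s \<A> \<A> d = P \<alpha>"
  proof
    fix x
    have "tensor_mult s \<A> \<A> d x = tensor_mult s U V \<Delta> (P \<alpha> x)"
    proof (rule separated_eqI[OF separated])
      fix f assume f: "f \<in> dual_space s"
      have "f (tensor_mult s \<A> \<A> d x) = d (\<lambda>R S. f (R (S x)))"
        by (rule dual_tensor_mult[OF separated AB AB subspace_UNIV d f])
      also have "\<dots> = \<Delta> (\<lambda>R S. f ((R \<circ> P \<beta>) ((S \<circ> P \<alpha>) x)))"
        by (rule d_eq[OF form_apply[OF AB AB subspace_UNIV f]])
      \<comment> \<open>S has its values in X_\<beta>, where the inserted projection P_\<beta> is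
        the identity.\<close>
      also have "\<dots> = \<Delta> (\<lambda>R S. f (R (S (P \<alpha> x))))"
      proof (rule tensor_cong[OF \<Delta>(1) op(1,2)])
        fix R S assume "R \<in> U" "S \<in> V"
        then have "S (P \<alpha> x) \<in> range (P \<beta>)"
          using bounded_opsD(1)[OF subsetD[OF UB(2)], of S "P \<alpha> x"] by blast
        from P_range[OF \<beta> this] show "f ((R \<circ> P \<beta>) ((S \<circ> P \<alpha>) x)) = f (R (S (P \<alpha> x)))" by simp
      qed
      also have "\<dots> = f (tensor_mult s U V \<Delta> (P \<alpha> x))"
        by (rule dual_tensor_mult[OF separated UB sp(2) \<Delta>(1) f, symmetric])
      finally show "f (tensor_mult s \<A> \<A> d x) = f (tensor_mult s U V \<Delta> (P \<alpha> x))" .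
    qed
    also have "\<dots> = P \<alpha> x"
      using fun_cong[OF \<Delta>(3)[OF restr_finite_rank[OF \<alpha>]], of "P \<alpha> x"] by (simp add: restr_def)
    finally show "tensor_mult s \<A> \<A> d x = P \<alpha> x" .
  qed
  assume a: "a \<in> \<A>"
  define a' where "a' = P \<alpha> \<circ> a \<circ> P \<alpha>"
  define e where "e x = a x - a' x" for x
  have a'A: "a' \<in> \<A>"
    unfolding a'_def using a by (intro approximable_compose_right approximable_compose_left
        P_bounded \<alpha>)
  have "(\<lambda>x. a x + s (- 1) (a' x)) \<in> \<A>" using a a'A by (intro op_spaceD(2,3)[OF op(3)])
  then have eA: "e \<in> \<A>" by (simp add: e_def[abs_def])
  \<comment> \<open>The same compression, as an operator on X_\<alpha>. It agrees with
    \<open>a'\<close> after any R with values in X_\<alpha> and intertwines P_\<alpha> with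
    \<open>a'\<close> on the other side.\<close>
  define W where "W = P \<alpha> \<circ> (a \<circ> restr (range (P \<alpha>)))"
  have W: "W \<in> finite_rank_ops s (range (P \<alpha>)) (range (P \<alpha>))"
    unfolding W_def
    by (intro finite_rank_compose_right[OF P_finite_rank[OF \<alpha>]] bounded_ops_compose[OF
        approximable_bounded[OF a]]
        restr_bounded_ops sp(1))
  have comm: "left_act s \<A> \<A> a' d \<phi> = right_act s \<A> \<A> a' d \<phi>" for \<phi>
  proof (cases "\<phi> \<in> forms \<A> \<A>")
    case True
    note oa' = op_map_approximable[OF approximable_bounded[OF a'A]]
    have \<psi>: "(\<lambda>R S. \<phi> (R \<circ> P \<beta>) (S \<circ> P \<alpha>)) \<in> forms U V"
      by (rule forms_pullback[OF True \<Phi> \<Psi> op(1,2,3,3)])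
    have "left_act s \<A> \<A> a' d \<phi> = d (\<lambda>R S. \<phi> (a' \<circ> R) S)" using True by (simp add: left_act_def)
    also have "\<dots> = \<Delta> (\<lambda>R S. \<phi> (a' \<circ> (R \<circ> P \<beta>)) (S \<circ> P \<alpha>))"
      by (rule d_eq[OF forms_pullback[OF True oa'(1) op_map_id op(3,3,3,3)]])
    also have "\<dots> = \<Delta> (\<lambda>R S. \<phi> ((W \<circ> R) \<circ> P \<beta>) (S \<circ> P \<alpha>))"
    proof (rule tensor_cong[OF \<Delta>(1) op(1,2)])
      fix R S assume R: "R \<in> U"
      have "R y \<in> range (P \<alpha>)" for y
        using bounded_opsD(1,2)[OF subsetD[OF UB(1) R], of y] subspace_0[OF sp(1)]
        by (cases "y \<in> range (P \<beta>)") auto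
      then have "a' (R y) = W (R y)" for y
        using P_range[OF \<alpha>, of "R y"] by (simp add: a'_def W_def restr_def)
      then have "a' \<circ> (R \<circ> P \<beta>) = (W \<circ> R) \<circ> P \<beta>" by auto
      then show "\<phi> (a' \<circ> (R \<circ> P \<beta>)) (S \<circ> P \<alpha>) = \<phi> ((W \<circ> R) \<circ> P \<beta>) (S \<circ> P \<alpha>)" by simp
    qed
    also have "\<dots> = left_act s U V W \<Delta> (\<lambda>R S. \<phi> (R \<circ> P \<beta>) (S \<circ> P \<alpha>))"
      using \<psi> by (simp add: left_act_def)
    also have "\<dots> = right_act s U V W \<Delta> (\<lambda>R S. \<phi> (R \<circ> P \<beta>) (S \<circ> P \<alpha>))"
      by (simp add: \<Delta>(2)[OF W])
    also have "\<dots> = \<Delta> (\<lambda>R S. \<phi> (R \<circ> P \<beta>) ((S \<circ> W) \<circ> P \<alpha>))"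
      using \<psi> by (simp add: right_act_def)
    also have "\<dots> = \<Delta> (\<lambda>R S. \<phi> (R \<circ> P \<beta>) ((S \<circ> P \<alpha>) \<circ> a'))"
    proof -
      have "W (P \<alpha> x) = P \<alpha> (a' x)" for x
        by (simp add: W_def a'_def restr_def fix_range[OF \<alpha>])
      then have "(S \<circ> W) \<circ> P \<alpha> = (S \<circ> P \<alpha>) \<circ> a'" for S :: "'x \<Rightarrow> 'x" by auto
      then show ?thesis by simp
    qed
    also have "\<dots> = d (\<lambda>R S. \<phi> R (S \<circ> a'))"
      by (rule d_eq[OF forms_pullback[OF True op_map_id oa'(2) op(3,3,3,3)], symmetric])
    also have "\<dots> = right_act s \<A> \<A> a' d \<phi>" using True by (simp add: right_act_def)
    finally show ?thesis .
  qed (simp add: left_act_def right_act_def)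
  have a_eq: "a = (\<lambda>x. e x + a' x)" by (simp add: e_def)
  note oe = op_map_approximable[OF approximable_bounded[OF eA]]
    and oa' = op_map_approximable[OF approximable_bounded[OF a'A]]
  have "left_act s \<A> \<A> a d \<phi> = left_act s \<A> \<A> e d \<phi> + left_act s \<A> \<A> a' d \<phi>" for \<phi>
    by (subst a_eq) (rule left_act_add[OF d op(3,3) oe(1) oa'(1)])
  moreover have "right_act s \<A> \<A> a d \<phi> = right_act s \<A> \<A> e d \<phi> + right_act s \<A> \<A> a' d \<phi>" for \<phi>
    by (subst a_eq)
      (rule right_act_add[OF d op(3,3) oe(2) oa'(2)],
        simp add: bounded_opsD(3)[OF approximable_bounded])
  ultimately have "(\<lambda>\<phi>. left_act s \<A> \<A> a d \<phi> - right_act s \<A> \<A> a d \<phi>)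
      = (\<lambda>\<phi>. left_act s \<A> \<A> e d \<phi> - right_act s \<A> \<A> e d \<phi>)"
    by (simp add: comm)
  moreover have "tensor_le \<A> \<A> (\<lambda>\<phi>. left_act s \<A> \<A> e d \<phi> - right_act s \<A> \<A> e d \<phi>)
      (onorm e * 1 * (N * N * (K + 1)) + 1 * onorm e * (N * N * (K + 1)))"
    unfolding left_act_eq right_act_eq
    by (intro tensor_le_diff tensor_le_map[OF d_le] oe op_map_id op)
  moreover have "onorm e = onorm (\<lambda>x. a x - P \<alpha> (a (P \<alpha> x)))"
    by (simp add: e_def[abs_def] a'_def)
  ultimately show "tensor_le \<A> \<A> (\<lambda>\<phi>. left_act s \<A> \<A> a d \<phi> - right_act s \<A> \<A> a d \<phi>)
      (2 * (onorm (\<lambda>x. a x - P \<alpha> (a (P \<alpha> x))) * (N * N * (K + 1))))"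
    by (simp add: mult_ac)
qed

text \<open>Up to sign, a - P a P is the sum of P a - a and P (a P - a), so both one-sided
  convergences and the bound on P are combined.\<close>

lemma compression_tendsto:
  assumes a: "a \<in> \<A>"
  shows "((\<lambda>\<alpha>. onorm (\<lambda>x. a x - P \<alpha> (a (P \<alpha> x)))) \<longlongrightarrow> 0) (tails A le)"
proof (rule Lim_null_comparison)
  show "((\<lambda>\<alpha>. onorm (\<lambda>x. P \<alpha> (a x) - a x) + N * onorm (\<lambda>x. a (P \<alpha> x) - a x)) \<longlongrightarrow> 0) (tails A le)"
    using tendsto_add[OF P_left_tendsto[OF a] tendsto_mult[OF tendsto_const P_right_tendsto[OF a],
        of N]] by simp
  show "\<forall>\<^sub>F \<alpha> in tails A le. norm (onorm (\<lambda>x. a x - P \<alpha> (a (P \<alpha> x))))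
      \<le> onorm (\<lambda>x. P \<alpha> (a x) - a x) + N * onorm (\<lambda>x. a (P \<alpha> x) - a x)"
  proof (rule eventually_mono[OF eventually_tails_mem[OF directed]])
    fix \<alpha> assume \<alpha>: "\<alpha> \<in> A"
    have ba: "bounded_map a" using a by (rule bounded_ops_bounded_map[OF approximable_bounded])
    note bP = P_bounded_map[OF \<alpha>]
    have b1: "bounded_map (\<lambda>x. P \<alpha> (a x) - a x)" by (rule bounded_map_compose_minus[OF bP ba ba])
    have b2: "bounded_map (\<lambda>x. a (P \<alpha> x) - a x)" by (rule bounded_map_compose_minus[OF ba bP ba])
    have b3: "bounded_map (\<lambda>x. a x - P \<alpha> (a (P \<alpha> x)))"
      by (rule bounded_map_minus[OF ba bounded_map_compose[OF bP bounded_map_compose[OF ba bP]]])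
    have "onorm (\<lambda>x. a x - P \<alpha> (a (P \<alpha> x)))
      \<le> onorm (\<lambda>x. P \<alpha> (a x) - a x) + N * onorm (\<lambda>x. a (P \<alpha> x) - a x)"
    proof (rule onorm_bound)
      fix x
      have "norm (a x - P \<alpha> (a (P \<alpha> x))) = norm ((P \<alpha> (a x) - a x) + P \<alpha> (a (P \<alpha> x) - a x))"
        using linear_diff[OF bounded_linear.linear[OF bounded_ops_bounded_linear[OF P_bounded[OF
            \<alpha>]]], of "a (P \<alpha> x)" "a x"]
        by (simp add: norm_minus_commute)
      also have "\<dots> \<le> norm (P \<alpha> (a x) - a x) + norm (P \<alpha> (a (P \<alpha> x) - a x))"
        by (rule norm_triangle_ineq)
      also have "\<dots> \<le> onorm (\<lambda>x. P \<alpha> (a x) - a x) * norm x + N * (onorm (\<lambda>x. a (P \<alpha> x)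
          - a x) * norm x)"
      proof (rule add_mono[OF norm_le_onorm[OF b1]])
        have "norm (P \<alpha> (a (P \<alpha> x) - a x)) \<le> onorm (P \<alpha>) * norm (a (P \<alpha> x) - a x)"
          by (rule norm_le_onorm[OF bP])
        also have "\<dots> \<le> N * (onorm (\<lambda>x. a (P \<alpha> x) - a x) * norm x)"
          using N by (intro mult_mono onorm_P[OF \<alpha>] norm_le_onorm[OF b2]) auto
        finally show "norm (P \<alpha> (a (P \<alpha> x) - a x)) \<le> N * (onorm (\<lambda>x. a (P \<alpha> x) - a x) * norm x)" .
      qed
      finally show "norm (a x - P \<alpha> (a (P \<alpha> x)))
          \<le> (onorm (\<lambda>x. P \<alpha> (a x) - a x) + N * onorm (\<lambda>x. a (P \<alpha> x) - a x)) * norm x"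
        by (simp add: algebra_simps)
    qed (use N onorm_nonneg[OF b1] onorm_nonneg[OF b2] in auto)
    with onorm_nonneg[OF b3] show "norm (onorm (\<lambda>x. a x - P \<alpha> (a (P \<alpha> x))))
      \<le> onorm (\<lambda>x. P \<alpha> (a x) - a x) + N * onorm (\<lambda>x. a (P \<alpha> x) - a x)" by simp
  qed
qed

lemma amenable_if_diagonals:
  assumes ex: "\<And>\<alpha>. \<alpha> \<in> A \<Longrightarrow> \<exists>\<beta>\<in>A. \<exists>\<Delta>.
       generalized_diagonal s (range (P \<beta>)) (range (P \<alpha>))
         (finite_rank_ops s (range (P \<alpha>)) (range (P \<alpha>))) \<Delta> \<and>
       proj_norm s (finite_rank_ops s (range (P \<beta>)) (range (P \<alpha>)))
         (finite_rank_ops s (range (P \<alpha>)) (range (P \<beta>))) \<Delta> \<le> K"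
  shows "amenable s \<A>"
proof -
  from ex obtain \<beta> \<Delta> where \<beta>: "\<And>\<alpha>. \<alpha> \<in> A \<Longrightarrow> \<beta> \<alpha> \<in> A"
    and \<Delta>: "\<And>\<alpha>. \<alpha> \<in> A \<Longrightarrow> generalized_diagonal s (range (P (\<beta> \<alpha>))) (range (P \<alpha>))
         (finite_rank_ops s (range (P \<alpha>)) (range (P \<alpha>))) (\<Delta> \<alpha>)"
      "\<And>\<alpha>. \<alpha> \<in> A \<Longrightarrow> proj_norm s (finite_rank_ops s (range (P (\<beta> \<alpha>))) (range (P \<alpha>)))
         (finite_rank_ops s (range (P \<alpha>)) (range (P (\<beta> \<alpha>)))) (\<Delta> \<alpha>) \<le> K"
    by metis
  define d where "d \<alpha> = tensor_map \<A> \<A> (\<lambda>R. R \<circ> P (\<beta> \<alpha>)) (\<lambda>S. S \<circ> P \<alpha>) (\<Delta> \<alpha>)" for \<alpha>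
  note lifted = lifted_diagonal[OF _ \<beta> \<Delta>, folded d_def]
  note op = op_space_approximable op_space_approximable
  \<comment> \<open>The approximate diagonal is indexed by the given net itself; the filter is the
    image of its tails.\<close>
  define F where "F = filtermap d (tails A le)"
  have "F \<noteq> bot" using tails_neq_bot[OF directed] by (simp add: F_def filtermap_bot_iff)
  moreover have "\<forall>\<^sub>F d in F. d \<in> proj_tensor s \<A> \<A> \<and> proj_norm s \<A> \<A> d \<le> N * N * (K + 1)"
    unfolding F_def eventually_filtermap
    by (rule eventually_mono[OF eventually_tails_mem[OF directed]])
      (use lifted(1) in \<open>auto intro: tensor_le_mem proj_norm_le op\<close>)
  \<comment> \<open>\<pi> maps the lifted tensor to P_\<alpha> exactly, so this is
    \<open>P_left_tendsto\<close>.\<close>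
  moreover have "((\<lambda>d. onorm (\<lambda>x. tensor_mult s \<A> \<A> d (a x) - a x)) \<longlongrightarrow> 0) F" if a: "a \<in> \<A>" for a
    unfolding F_def filterlim_filtermap
    by (rule Lim_transform_eventually[OF P_left_tendsto[OF a]],
        rule eventually_mono[OF eventually_tails_mem[OF directed]])
      (simp add: lifted(2))
  moreover have "((\<lambda>d. proj_norm s \<A> \<A> (\<lambda>\<phi>. left_act s \<A> \<A> a d \<phi> - right_act s \<A> \<A> a d \<phi>)) \<longlongrightarrow> 0) F"
    if a: "a \<in> \<A>" for a
    unfolding F_def filterlim_filtermap
  proof (rule Lim_null_comparison)
    show "((\<lambda>\<alpha>. 2 * (onorm (\<lambda>x. a x - P \<alpha> (a (P \<alpha> x))) * (N * N * (K + 1)))) \<longlongrightarrow> 0) (tails A le)"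
      using tendsto_mult[OF tendsto_const tendsto_mult[OF compression_tendsto[OF a]
          tendsto_const], of 2 "N * N * (K + 1)"]
      by simp
    show "\<forall>\<^sub>F \<alpha> in tails A le. norm (proj_norm s \<A> \<A> (\<lambda>\<phi>. left_act s \<A> \<A> a (d \<alpha>) \<phi>
        - right_act s \<A> \<A> a (d \<alpha>) \<phi>))
        \<le> 2 * (onorm (\<lambda>x. a x - P \<alpha> (a (P \<alpha> x))) * (N * N * (K + 1)))"
    proof (rule eventually_mono[OF eventually_tails_mem[OF directed]])
      fix \<alpha> assume "\<alpha> \<in> A"
      from lifted(3)[OF this this this this a] show
          "norm (proj_norm s \<A> \<A> (\<lambda>\<phi>. left_act s \<A> \<A> a (d \<alpha>) \<phi> - right_act s \<A> \<A> a (d \<alpha>) \<phi>))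
        \<le> 2 * (onorm (\<lambda>x. a x - P \<alpha> (a (P \<alpha> x))) * (N * N * (K + 1)))"
        using proj_norm_nonneg[OF tensor_le_mem op] proj_norm_le[OF _ op] by simp
    qed
  qed
  ultimately show ?thesis unfolding amenable_def by blast
qed

subsection \<open>From an approximate diagonal to generalized diagonals\<close>

text \<open>For each term of the series, P_\<beta> acts on the finitely many vectors S_k c, so
  strong convergence suffices; the limit and the sum are interchanged by dominated convergence of
  series.\<close>

lemma trace_tendsto:
  assumes d: "d \<in> proj_tensor s \<A> \<A>" and B: "finite B" and g: "\<And>c. c \<in> B \<Longrightarrow> g c \<in> dual_space s"
  shows "((\<lambda>\<beta>. d (\<lambda>R S. \<Sum>c\<in>B. g c (R (P \<beta> (S c))))) \<longlongrightarrow> d (\<lambda>R S. \<Sum>c\<in>B. g c (R (S c)))) (tails A le)"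
proof -
  note op = op_space_approximable
  have AB: "\<A> \<subseteq> bounded_ops s UNIV UNIV" by (auto intro: approximable_bounded)
  from d obtain R S where RS: "abs_convergent \<A> \<A> R S" "d = tensor_series s \<A> \<A> R S"
    by (auto simp: proj_tensor_def)
  have mem: "R n \<in> \<A>" "S n \<in> \<A>" for n using RS(1) by (auto simp: abs_convergent_def)
  have bR: "bounded_map (R n)" and bS: "bounded_map (S n)" for n
    using mem op_spaceD(4)[OF op] by auto
  have \<tau>: "(\<lambda>R S. \<Sum>c\<in>B. g c (R (S c))) \<in> forms \<A> \<A>"
    by (intro forms_sum B op form_apply[OF AB AB subspace_UNIV] g)
  have \<tau>\<beta>: "(\<lambda>R S. \<Sum>c\<in>B. g c (R (P \<beta> (S c)))) \<in> forms \<A> \<A>" if "\<beta> \<in> A" for \<beta>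
    using forms_pullback[OF \<tau> op_map_id op_map_approximable(1)[OF P_bounded[OF that]] op op op op]
      by simp
  \<comment> \<open>The factor N bounds all the P_\<beta> at once, so the dominating series does not
    depend on \<beta>.\<close>
  define L where "L = (\<Sum>c\<in>B. onorm (g c) * N * norm c)"
  have bound: "norm (\<Sum>c\<in>B. g c (R k (P \<beta> (S k c)))) \<le> L * (onorm (R k) * onorm (S k))" if \<beta>: "\<beta> \<in> A"
    for k \<beta>
  proof -
    have "norm (\<Sum>c\<in>B. g c (R k (P \<beta> (S k c)))) \<le> (\<Sum>c\<in>B. norm (g c (R k (P \<beta> (S k c)))))"
      by (rule norm_sum)
    also have "\<dots> \<le> (\<Sum>c\<in>B. (onorm (g c) * N * norm c) * (onorm (R k) * onorm (S k)))"
    proof (rule sum_mono)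
      fix c assume c: "c \<in> B"
      note bg = dual_spaceD(3)[OF g[OF c]]
      have "norm (P \<beta> (S k c)) \<le> onorm (P \<beta>) * norm (S k c)"
        by (rule norm_le_onorm[OF P_bounded_map[OF \<beta>]])
      also have "\<dots> \<le> N * (onorm (S k) * norm c)"
        using N by (intro mult_mono onorm_P[OF \<beta>] norm_le_onorm[OF bS]) auto
      finally have 1: "norm (P \<beta> (S k c)) \<le> N * (onorm (S k) * norm c)" .
      have "norm (R k (P \<beta> (S k c))) \<le> onorm (R k) * norm (P \<beta> (S k c))"
        by (rule norm_le_onorm[OF bR])
      also have "\<dots> \<le> onorm (R k) * (N * (onorm (S k) * norm c))"
        by (rule mult_left_mono[OF 1 onorm_nonneg[OF bR]])
      finally have 2: "norm (R k (P \<beta> (S k c))) \<le> onorm (R k) * (N * (onorm (S k) * norm c))" .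
      have "norm (g c (R k (P \<beta> (S k c)))) \<le> onorm (g c) * norm (R k (P \<beta> (S k c)))"
        by (rule norm_le_onorm[OF bg])
      also have "\<dots> \<le> onorm (g c) * (onorm (R k) * (N * (onorm (S k) * norm c)))"
        by (rule mult_left_mono[OF 2 onorm_nonneg[OF bg]])
      finally show "norm (g c (R k (P \<beta> (S k c))))
          \<le> (onorm (g c) * N * norm c) * (onorm (R k) * onorm (S k))"
        by (simp add: mult_ac)
    qed
    finally show ?thesis by (simp add: L_def sum_distrib_right)
  qed
  have "((\<lambda>\<beta>. \<Sum>k. \<Sum>c\<in>B. g c (R k (P \<beta> (S k c)))) \<longlongrightarrow> (\<Sum>k. \<Sum>c\<in>B. g c (R k (S k c)))) (tails A le)"
  proof (rule tannerys_theorem[THEN conjunct2, THEN conjunct2])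
    show "((\<lambda>\<beta>. \<Sum>c\<in>B. g c (R k (P \<beta> (S k c)))) \<longlongrightarrow> (\<Sum>c\<in>B. g c (R k (S k c)))) (tails A le)" for k
      by (intro tendsto_sum bounded_linear.tendsto[OF dual_space_bounded_linear[OF g]]
          bounded_linear.tendsto[OF bounded_ops_bounded_linear[OF subsetD[OF AB mem(1)]]] strong)
    have "eventually (\<lambda>x. snd x \<in> A) (at_top \<times>\<^sub>F tails A le)"
      using eventually_prodI[OF always_eventually eventually_tails_mem[OF directed], of "\<lambda>_. True"
          at_top]
      by simp
    then show "\<forall>\<^sub>F (k, \<beta>) in at_top \<times>\<^sub>F tails A le.
        norm (\<Sum>c\<in>B. g c (R k (P \<beta> (S k c)))) \<le> L * (onorm (R k) * onorm (S k))"
      by (rule eventually_mono) (auto intro: bound)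
    show "summable (\<lambda>k. L * (onorm (R k) * onorm (S k)))"
      using RS(1) by (simp add: abs_convergent_def summable_mult)
  qed (rule tails_neq_bot[OF directed])
  moreover have "d (\<lambda>R S. \<Sum>c\<in>B. g c (R (S c))) = (\<Sum>k. \<Sum>c\<in>B. g c (R k (S k c)))"
    using \<tau> by (simp add: RS(2) tensor_series_def)
  moreover have "\<forall>\<^sub>F \<beta> in tails A le. (\<Sum>k. \<Sum>c\<in>B. g c (R k (P \<beta> (S k c))))
      = d (\<lambda>R S. \<Sum>c\<in>B. g c (R (P \<beta> (S c))))"
    by (rule eventually_mono[OF eventually_tails_mem[OF directed]])
      (use \<tau>\<beta> in \<open>simp add: RS(2) tensor_series_def\<close>)
  ultimately show ?thesis by (simp add: Lim_transform_eventually)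
qed

text \<open>Compression intertwines the matrix units on X_\<alpha> with the rank-one operators on
  the whole space. The commutators of the compressed tensor are therefore compressions of those of
  \<open>d\<close> and stay small for every \<beta>, which leaves \<beta> free to be chosen for the
  trace.\<close>

lemma compressed_diagonal:
  fixes B :: "'x set" and g :: "'x \<Rightarrow> 'x \<Rightarrow> 'k"
  assumes \<alpha>: "\<alpha> \<in> A" and B: "finite B" "B \<subseteq> range (P \<alpha>)"
    and g: "\<And>b. b \<in> B \<Longrightarrow> g b \<in> dual_space s"
    and expand: "\<And>x. P \<alpha> x = (\<Sum>b\<in>B. s (g b x) b)"
    and biorth: "\<And>b c. b \<in> B \<Longrightarrow> c \<in> B \<Longrightarrow> g b c = (if b = c then 1 else 0)"
    and d: "tensor_le \<A> \<A> d r" and r: "0 \<le> r"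
    and comm: "\<And>b c. b \<in> B \<Longrightarrow> c \<in> B \<Longrightarrow> tensor_le \<A> \<A>
      (\<lambda>\<phi>. left_act s \<A> \<A> (\<lambda>x. s (g c x) b) d \<phi> - right_act s \<A> \<A> (\<lambda>x. s (g c x) b) d \<phi>) \<epsilon>"
    and small: "(\<Sum>i\<in>B \<times> B. onorm (\<lambda>x. if x \<in> range (P \<alpha>) then s (g (snd i) x) (fst i) else 0)
        * (N * N * \<epsilon>)) \<le> card B"
    and trace: "norm (d (\<lambda>R S. \<Sum>c\<in>B. g c (R (S c))) - of_nat (card B)) \<le> card B / 4"
  shows "\<exists>\<beta>\<in>A. \<exists>\<Delta>. generalized_diagonal s (range (P \<beta>)) (range (P \<alpha>))
       (finite_rank_ops s (range (P \<alpha>)) (range (P \<alpha>))) \<Delta> \<and>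
     proj_norm s (finite_rank_ops s (range (P \<beta>)) (range (P \<alpha>)))
       (finite_rank_ops s (range (P \<alpha>)) (range (P \<beta>))) \<Delta> \<le> 2 * (N * N * r + 1)"
proof -
  note opA = op_space_approximable
  have AB: "\<A> \<subseteq> bounded_ops s UNIV UNIV" by (auto intro: approximable_bounded)
  have dmem: "d \<in> proj_tensor s \<A> \<A>" using d by (rule tensor_le_mem)
  \<comment> \<open>The functionals are the coordinates of P_\<alpha> x, so they do not notice a
    further P_\<alpha>.\<close>
  have gP: "g b (P \<alpha> x) = g b x" if b: "b \<in> B" for b x
  proof -
    have "g b (P \<alpha> x) = (\<Sum>c\<in>B. g b (s (g c x) c))"
      unfolding expand by (rule linear_sum[OF bounded_linear.linear[OF
          dual_space_bounded_linear[OF g[OF b]]]])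
    also have "\<dots> = (\<Sum>c\<in>B. if c = b then g c x else 0)"
      using b by (intro sum.cong refl) (auto simp: dual_spaceD(2)[OF g[OF b]] biorth)
    finally show ?thesis using b B(1) by simp
  qed
  have "\<exists>\<beta>\<in>A. norm (d (\<lambda>R S. \<Sum>c\<in>B. g c (R (P \<beta> (S c)))) - of_nat (card B)) \<le> card B / 2"
  proof (cases "B = {}")
    \<comment> \<open>With dimension 0 there is no strict room in \<open>card B / 4\<close>, but the
      trace form is an empty sum and any \<beta> will do.\<close>
    case True
    have "d (\<lambda>R S. \<Sum>c\<in>{}. g c (R (P \<alpha> (S c)))) = (\<Sum>c\<in>{}. d (\<lambda>R S. g c (R (P \<alpha> (S c)))))"
      by (rule tensor_form_sum[OF dmem opA opA]) auto
    with True \<alpha> show ?thesis by (intro bexI[of _ \<alpha>]) auto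
  next
    case False
    then have "0 < real (card B) / 4" using B(1) by (simp add: card_gt_0_iff)
    moreover have "((\<lambda>\<beta>. d (\<lambda>R S. \<Sum>c\<in>B. g c (R (P \<beta> (S c)))))
        \<longlongrightarrow> d (\<lambda>R S. \<Sum>c\<in>B. g c (R (S c)))) (tails A le)"
      by (rule trace_tendsto[OF dmem B(1) g])
    ultimately have "\<forall>\<^sub>F \<beta> in tails A le. dist (d (\<lambda>R S. \<Sum>c\<in>B. g c (R (P \<beta> (S c)))))
        (d (\<lambda>R S. \<Sum>c\<in>B. g c (R (S c)))) < card B / 4"
      by (intro tendstoD)
    with eventually_tails_mem[OF directed]
    have "\<forall>\<^sub>F \<beta> in tails A le. \<beta> \<in> A \<and> dist (d (\<lambda>R S. \<Sum>c\<in>B. g c (R (P \<beta> (S c)))))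
        (d (\<lambda>R S. \<Sum>c\<in>B. g c (R (S c)))) < card B / 4"
      by eventually_elim auto
    from eventually_happens'[OF tails_neq_bot[OF directed] this] obtain \<beta> where \<beta>: "\<beta> \<in> A"
      "dist (d (\<lambda>R S. \<Sum>c\<in>B. g c (R (P \<beta> (S c))))) (d (\<lambda>R S. \<Sum>c\<in>B. g c (R (S c)))) < card B / 4"
        by blast
    \<comment> \<open>A quarter of the dimension is lost in \<open>d\<close>, another one by
      inserting P_\<beta>; together they give the tolerance of
      \<open>averaged_diagonal\<close>.\<close>
    have "dist (d (\<lambda>R S. \<Sum>c\<in>B. g c (R (P \<beta> (S c))))) (of_nat (card B)) \<le> card B / 4 + card B / 4"
      using trace \<beta>(2) by (intro order_trans[OF dist_triangle add_mono]) (auto simp: dist_norm)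
    with \<beta>(1) show ?thesis by (intro bexI[of _ \<beta>]) (auto simp: dist_norm)
  qed
  then obtain \<beta> where \<beta>: "\<beta> \<in> A"
    and tr: "norm (d (\<lambda>R S. \<Sum>c\<in>B. g c (R (P \<beta> (S c)))) - of_nat (card B)) \<le> card B / 2" by blast
  define Y where "Y = range (P \<beta>)"
  define Z where "Z = range (P \<alpha>)"
  define U where "U = finite_rank_ops s Y Z"
  define V where "V = finite_rank_ops s Z Y"
  have Y: "subspace Y" and Z: "subspace Z" using subspace_range \<alpha> \<beta> by (auto simp: Y_def Z_def)
  have op: "op_space U" "op_space V"
    using Y Z by (auto simp: U_def V_def intro: op_space_finite_rank)
  \<comment> \<open>The projection costs N and the restriction costs 1, so compressing both factors
    costs \<open>N * N\<close> whatever \<beta> is.\<close>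
  have compress: "op_map \<A> (finite_rank_ops s X' X) N (\<lambda>R. (P \<gamma> \<circ> R) \<circ> restr X')"
    if \<gamma>: "\<gamma> \<in> A" and X: "X = range (P \<gamma>)" and X': "subspace X'" for \<gamma> X X'
  proof -
    have PF: "P \<gamma> \<in> finite_rank_ops s UNIV X" using P_finite_rank[OF \<gamma>] X by simp
    have spX: "subspace X" using subspace_range[OF \<gamma>] X by simp
    have 1: "op_map \<A> (finite_rank_ops s UNIV X) N (\<lambda>R. P \<gamma> \<circ> R)"
      by (rule op_map_mono[OF op_map_left[OF finite_rank_bounded[OF PF] AB] onorm_P[OF \<gamma>] opA])
        (rule finite_rank_compose_right[OF PF approximable_bounded])
    have "op_map (finite_rank_ops s UNIV X) (finite_rank_ops s X' X) 1 (\<lambda>R. R \<circ> restr X')"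
      by (rule op_map_mono[OF op_map_right[OF bounded_ops_bounded_map[OF restr_bounded_ops[OF
          X']]] onorm_restr_le])
        (auto intro: op_space_finite_rank[OF spX] finite_rank_compose_right[OF _
            restr_bounded_ops[OF X']])
    from op_map_comp[OF 1 this] show ?thesis by simp
  qed
  define \<Phi> where "\<Phi> R = (P \<alpha> \<circ> R) \<circ> restr Y" for R
  define \<Psi> where "\<Psi> S = (P \<beta> \<circ> S) \<circ> restr Z" for S
  have \<Phi>: "op_map \<A> U N \<Phi>" using compress[OF \<alpha> Z_def Y] by (simp add: \<Phi>_def[abs_def] U_def)
  have \<Psi>: "op_map \<A> V N \<Psi>" using compress[OF \<beta> Y_def Z] by (simp add: \<Psi>_def[abs_def] V_def)
  define \<Delta> where "\<Delta> = tensor_map U V \<Phi> \<Psi> d"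
  have \<Delta>: "tensor_le U V \<Delta> (N * N * r)"
    unfolding \<Delta>_def by (rule tensor_le_map[OF d \<Phi> \<Psi> opA opA op])
  have \<Delta>_eq: "\<Delta> \<phi> = d (\<lambda>R S. \<phi> (\<Phi> R) (\<Psi> S))" if "\<phi> \<in> forms U V" for \<phi>
    using that by (simp add: \<Delta>_def tensor_map_def)
  have UB: "U \<subseteq> bounded_ops s Y Z" "V \<subseteq> bounded_ops s Z Y"
    by (auto simp: U_def V_def finite_rank_bounded)
  have BZ: "c \<in> Z" "P \<alpha> c = c" if "c \<in> B" for c
    using that B(2) P_range[OF \<alpha>, of c] by (auto simp: Z_def)
  define e where "e b c x = (if x \<in> Z then s (g c x) b else 0)" for b c x
  define E where "E b c x = s (g c x) b" for b c x
  have P_lin: "P \<alpha> (s k x) = s k (P \<alpha> x)" for k x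
    using bounded_opsD(4)[OF P_bounded[OF \<alpha>]] by simp
  have PZ: "P \<alpha> y \<in> Z" for y by (simp add: Z_def)
  have "\<exists>\<Delta>'. generalized_diagonal s Y Z (finite_rank_ops s Z Z) \<Delta>' \<and>
    proj_norm s (finite_rank_ops s Y Z) (finite_rank_ops s Z Y) \<Delta>' \<le> 2 * (N * N * r + 1)"
  proof (rule averaged_diagonal[where B = B and g = g, OF separated Y Z B(1) _ g])
    show "B \<subseteq> Z" using B(2) by (simp add: Z_def)
    show "x = (\<Sum>b\<in>B. s (g b x) b)" if "x \<in> Z" for x
      using P_range[OF \<alpha>, of x] that expand[of x] by (simp add: Z_def)
    show "tensor_le (finite_rank_ops s Y Z) (finite_rank_ops s Z Y) \<Delta> (N * N * r)"
      using \<Delta> by (simp add: U_def V_def)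
    show "0 \<le> N * N * r" using r N by simp
    show "(\<Sum>i\<in>B \<times> B. onorm (\<lambda>x. if x \<in> Z then s (g (snd i) x) (fst i) else 0) * (N * N * \<epsilon>))
        \<le> real (card B)"
      using small by (simp add: Z_def)
    have "\<Delta> (\<lambda>R S. \<Sum>c\<in>B. g c (R (S c))) = d (\<lambda>R S. \<Sum>c\<in>B. g c (\<Phi> R (\<Psi> S c)))"
      by (intro \<Delta>_eq forms_sum B(1) op form_apply[OF UB Y] g)
    \<comment> \<open>The outer P_\<alpha> is absorbed by the functional \<open>g c\<close>, while
      P_\<beta> remains between R and S.\<close>
    also have "(\<lambda>R S. \<Sum>c\<in>B. g c (\<Phi> R (\<Psi> S c))) = (\<lambda>R S. \<Sum>c\<in>B. g c (R (P \<beta> (S c))))"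
      using BZ by (auto simp: \<Phi>_def \<Psi>_def restr_def Y_def gP intro!: ext sum.cong)
    finally show "norm (\<Delta> (\<lambda>R S. \<Sum>c\<in>B. g c (R (S c))) - of_nat (card B)) \<le> real (card B) / 2"
      using tr by simp
    fix b c assume bc: "b \<in> B" "c \<in> B"
    \<comment> \<open>\<open>E b c\<close> is the matrix unit on the whole space. It commutes past
      P_\<alpha> on one side and past the restriction to X_\<alpha> on the other.\<close>
    have eb: "e b c (P \<alpha> y) = P \<alpha> (E b c y)" for y
      by (simp add: e_def E_def PZ gP[OF bc(2)] P_lin BZ[OF bc(1)])
    have Eb: "restr Z (e b c y) = E b c (restr Z y)" for y
      using subspace_0[OF Z] dual_spaceD(2)[OF g[OF bc(2)], of 0 0] BZ(1)[OF bc(1)]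
          subspace_scale[OF Z]
      by (simp add: restr_def e_def E_def)
    have \<Phi>e: "e b c \<circ> \<Phi> R = \<Phi> (E b c \<circ> R)" for R by (simp add: \<Phi>_def fun_eq_iff eb)
    have \<Psi>e: "\<Psi> S \<circ> e b c = \<Psi> (S \<circ> E b c)" for S by (simp add: \<Psi>_def fun_eq_iff Eb)
    have eFR: "e b c \<in> finite_rank_ops s Z Z"
      unfolding e_def[abs_def] using bc BZ by (intro rank_one_restr_finite_rank g Z)
    have ome: "op_map U U (onorm (e b c)) (\<lambda>R. e b c \<circ> R)" "op_map V V (onorm (e b c))
        (\<lambda>S. S \<circ> e b c)"
      using op_map_left[OF finite_rank_bounded[OF eFR] UB(1), of U]
        op_map_right[OF bounded_ops_bounded_map[OF finite_rank_bounded[OF eFR]] op(2), of V]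
        finite_rank_compose_right[OF eFR finite_rank_bounded]
        finite_rank_compose_right[OF _ finite_rank_bounded[OF eFR]]
      by (auto simp: U_def V_def)
    have "left_act s U V (e b c) \<Delta> \<phi> - right_act s U V (e b c) \<Delta> \<phi> =
        tensor_map U V \<Phi> \<Psi> (\<lambda>\<phi>. left_act s \<A> \<A> (E b c) d \<phi> - right_act s \<A> \<A> (E b c) d \<phi>) \<phi>" for \<phi>
    proof (cases "\<phi> \<in> forms U V")
      case True
      have "left_act s U V (e b c) \<Delta> \<phi> = d (\<lambda>R S. \<phi> (\<Phi> (E b c \<circ> R)) (\<Psi> S))"
        using True \<Delta>_eq[OF forms_pullback[OF True ome(1) op_map_id op op]]
          by (simp add: left_act_def \<Phi>e)
      moreover have "right_act s U V (e b c) \<Delta> \<phi> = d (\<lambda>R S. \<phi> (\<Phi> R) (\<Psi> (S \<circ> E b c)))"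
        using True \<Delta>_eq[OF forms_pullback[OF True op_map_id ome(2) op op]]
          by (simp add: right_act_def \<Psi>e)
      ultimately show ?thesis
        using True forms_pullback[OF True \<Phi> \<Psi> opA opA op]
          by (simp add: tensor_map_def left_act_def right_act_def)
    qed (simp add: tensor_map_def left_act_def right_act_def)
    moreover have "tensor_le U V (tensor_map U V \<Phi> \<Psi>
        (\<lambda>\<phi>. left_act s \<A> \<A> (E b c) d \<phi> - right_act s \<A> \<A> (E b c) d \<phi>)) (N * N * \<epsilon>)"
      using comm[OF bc] by (intro tensor_le_map[OF _ \<Phi> \<Psi> opA opA op]) (simp add: E_def[abs_def])
    ultimately have "tensor_le U V (\<lambda>\<phi>. left_act s U V (e b c) \<Delta> \<phi>
        - right_act s U V (e b c) \<Delta> \<phi>) (N * N * \<epsilon>)"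
      by simp
    then show "tensor_le (finite_rank_ops s Y Z) (finite_rank_ops s Z Y)
        (\<lambda>\<phi>. left_act s (finite_rank_ops s Y Z) (finite_rank_ops s Z Y) (\<lambda>x. if x \<in> Z then s (g c
            x) b else 0) \<Delta> \<phi> -
          right_act s (finite_rank_ops s Y Z) (finite_rank_ops s Z Y) (\<lambda>x. if x \<in> Z then s (g c x)
              b else 0) \<Delta> \<phi>) (N * N * \<epsilon>)"
      by (simp add: e_def[abs_def] U_def V_def)
  qed (use biorth in auto)
  with \<beta> show ?thesis unfolding Y_def Z_def by blast
qed

text \<open>The tolerances may depend on \<alpha>, since only finitely many commutators and one unit
  condition are requested from a member of the filter. The resulting constant involves only M and
  N.\<close>

lemma diagonals_if_amenable:
  assumes am: "amenable s \<A>"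
  shows "\<exists>K>0. \<forall>\<alpha>\<in>A. \<exists>\<beta>\<in>A. \<exists>\<Delta>.
       generalized_diagonal s (range (P \<beta>)) (range (P \<alpha>))
         (finite_rank_ops s (range (P \<alpha>)) (range (P \<alpha>))) \<Delta> \<and>
       proj_norm s (finite_rank_ops s (range (P \<beta>)) (range (P \<alpha>)))
         (finite_rank_ops s (range (P \<alpha>)) (range (P \<beta>))) \<Delta> \<le> K"
proof -
  note op = op_space_approximable
  have AB: "\<A> \<subseteq> bounded_ops s UNIV UNIV" by (auto intro: approximable_bounded)
  from am obtain F :: "('x, 'k) tensor filter" and M where F: "F \<noteq> bot"
    and bdd: "\<forall>\<^sub>F d in F. d \<in> proj_tensor s \<A> \<A> \<and> proj_norm s \<A> \<A> d \<le> M"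
    and unit: "\<And>a. a \<in> \<A> \<Longrightarrow> ((\<lambda>d. onorm (\<lambda>x. tensor_mult s \<A> \<A> d (a x) - a x)) \<longlongrightarrow> 0) F"
    and comm: "\<And>a. a \<in> \<A> \<Longrightarrow> ((\<lambda>d. proj_norm s \<A> \<A> (\<lambda>\<phi>. left_act s \<A> \<A> a d \<phi>
        - right_act s \<A> \<A> a d \<phi>)) \<longlongrightarrow> 0) F"
    unfolding amenable_def by blast
  \<comment> \<open>Any member of the approximate diagonal shows that its norm bound M is
    nonnegative.\<close>
  from eventually_happens'[OF F bdd] obtain d\<^sub>0 where "d\<^sub>0 \<in> proj_tensor s \<A> \<A>"
      "proj_norm s \<A> \<A> d\<^sub>0 \<le> M"
    by blast
  from order_trans[OF proj_norm_nonneg[OF this(1) op op] this(2)] have M: "0 \<le> M" .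
  have "\<exists>\<beta>\<in>A. \<exists>\<Delta>.
       generalized_diagonal s (range (P \<beta>)) (range (P \<alpha>))
         (finite_rank_ops s (range (P \<alpha>)) (range (P \<alpha>))) \<Delta> \<and>
       proj_norm s (finite_rank_ops s (range (P \<beta>)) (range (P \<alpha>)))
         (finite_rank_ops s (range (P \<alpha>)) (range (P \<beta>))) \<Delta> \<le> 2 * (N * N * (M + 1) + 1)" if \<alpha>: "\<alpha> \<in>
             A" for \<alpha>
  proof -
    obtain B g where B: "finite B" "B \<subseteq> range (P \<alpha>)" and g: "\<And>b. b \<in> B \<Longrightarrow> g b \<in> dual_space s"
      and expand: "\<And>x. P \<alpha> x = (\<Sum>b\<in>B. s (g b x) b)"
      and biorth: "\<And>b c. b \<in> B \<Longrightarrow> c \<in> B \<Longrightarrow> g b c = (if b = c then 1 else 0)"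
      by (rule projection_expansion[OF approximable[OF \<alpha>] idem[OF \<alpha>]]) (rule that)
    define E where "E b c x = s (g c x) b" for b c x
    define W where "W = (\<Sum>i\<in>B \<times> B. onorm (\<lambda>x. if x \<in> range (P \<alpha>) then s (g (snd i) x) (fst i)
        else 0))"
    define L where "L = (\<Sum>c\<in>B. onorm (g c) * norm c)"
    have EA: "E b c \<in> \<A>" if "c \<in> B" for b c
      unfolding E_def[abs_def] by (intro finite_rank_approximable rank_one_finite_rank g that)
    have W: "0 \<le> W"
      unfolding W_def
    proof (intro sum_nonneg onorm_nonneg)
      fix i assume "i \<in> B \<times> B"
      then show "bounded_map (\<lambda>x. if x \<in> range (P \<alpha>) then s (g (snd i) x) (fst i) else 0)"
        by (intro bounded_ops_bounded_map[OF finite_rank_bounded[OF rank_one_restr_finite_rank]] g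
            subspace_range \<alpha>
            subsetD[OF B(2)]) auto
    qed
    have L: "0 \<le> L"
      unfolding L_def using g by (intro sum_nonneg mult_nonneg_nonneg onorm_nonneg dual_spaceD(3))
          auto
    \<comment> \<open>\<epsilon> makes the sum of all commutator errors at most 1, and \<eta> makes
      the trace error at most 1/4. Both bounds are within the allowed share of \<open>card B\<close>
      once B is nonempty; for empty B the sums are 0.\<close>
    define \<epsilon> where "\<epsilon> = 1 / (W * (N * N) + 1)"
    define \<eta> where "\<eta> = 1 / (4 * (L + 1))"
    have NN: "0 < N * N" using N by simp
    have pos: "0 < \<epsilon>" "0 < \<eta>"
      using W L NN by (simp_all add: \<epsilon>_def \<eta>_def add_nonneg_pos)
    have "\<forall>\<^sub>F d in F. \<forall>b\<in>B. \<forall>c\<in>B.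
        proj_norm s \<A> \<A> (\<lambda>\<phi>. left_act s \<A> \<A> (E b c) d \<phi> - right_act s \<A> \<A> (E b c) d \<phi>) < \<epsilon>"
      using order_tendstoD(2)[OF comm[OF EA] pos(1)]
        by (intro eventually_ball_finite B(1) ballI) auto
    moreover have "\<forall>\<^sub>F d in F. onorm (\<lambda>x. tensor_mult s \<A> \<A> d (P \<alpha> x) - P \<alpha> x) < \<eta>"
      by (rule order_tendstoD(2)[OF unit[OF approximable[OF \<alpha>]] pos(2)])
    ultimately have "\<forall>\<^sub>F d in F. (d \<in> proj_tensor s \<A> \<A> \<and> proj_norm s \<A> \<A> d \<le> M) \<and>
        (\<forall>b\<in>B. \<forall>c\<in>B. proj_norm s \<A> \<A> (\<lambda>\<phi>. left_act s \<A> \<A> (E b c) d \<phi> - right_act s \<A> \<A> (E b c) d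
            \<phi>) < \<epsilon>) \<and>
        onorm (\<lambda>x. tensor_mult s \<A> \<A> d (P \<alpha> x) - P \<alpha> x) < \<eta>"
      using bdd by eventually_elim auto
    from eventually_happens'[OF F this] obtain d where d: "d \<in> proj_tensor s \<A> \<A>"
        "proj_norm s \<A> \<A> d \<le> M"
      and dE: "\<And>b c. b \<in> B \<Longrightarrow> c \<in> B \<Longrightarrow> proj_norm s \<A> \<A> (\<lambda>\<phi>. left_act s \<A> \<A> (E b c) d \<phi>
          - right_act s \<A> \<A> (E b c) d \<phi>) < \<epsilon>"
      and d\<eta>: "onorm (\<lambda>x. tensor_mult s \<A> \<A> d (P \<alpha> x) - P \<alpha> x) < \<eta>" by blast
    have d_le: "tensor_le \<A> \<A> d (M + 1)" using d by (intro tensor_le_proj_norm) auto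
    show ?thesis
    proof (rule compressed_diagonal[where B = B and g = g, OF \<alpha> B g expand biorth d_le])
      show "0 \<le> M + 1" using M by simp
      fix b c assume bc: "b \<in> B" "c \<in> B"
      note oE = op_map_approximable[OF approximable_bounded[OF EA[OF bc(2), of b]]]
      \<comment> \<open>This crude bound only serves to show that the commutator is a tensor; its
        small norm then yields a representing series of sum at most \<epsilon>.\<close>
      have "tensor_le \<A> \<A> (\<lambda>\<phi>. left_act s \<A> \<A> (E b c) d \<phi> - right_act s \<A> \<A> (E b c) d \<phi>)
          (onorm (E b c) * 1 * (M + 1) + 1 * onorm (E b c) * (M + 1))"
        unfolding left_act_eq right_act_eq
        by (intro tensor_le_diff tensor_le_map[OF d_le] oE op_map_id op)
      from tensor_le_proj_norm[OF tensor_le_mem[OF this] dE[OF bc]]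
      show "tensor_le \<A> \<A> (\<lambda>\<phi>. left_act s \<A> \<A> (\<lambda>x. s (g c x) b) d \<phi>
          - right_act s \<A> \<A> (\<lambda>x. s (g c x) b) d \<phi>) \<epsilon>"
        by (simp add: E_def[abs_def])
    next
      have "(\<Sum>i\<in>B \<times> B. onorm (\<lambda>x. if x \<in> range (P \<alpha>) then s (g (snd i) x) (fst i) else 0)
          * (N * N * \<epsilon>)) = W * (N * N * \<epsilon>)"
        by (simp add: W_def sum_distrib_right)
      also have "\<dots> \<le> card B"
      proof (cases "B = {}")
        case False
        have "W * (N * N * \<epsilon>) \<le> 1" using W NN by (simp add: \<epsilon>_def divide_le_eq add_nonneg_pos)
        also have "1 \<le> real (card B)" using False B(1) by (simp add: Suc_le_eq card_gt_0_iff)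
        finally show ?thesis .
      qed (simp add: W_def)
      finally show "(\<Sum>i\<in>B \<times> B. onorm (\<lambda>x. if x \<in> range (P \<alpha>) then s (g (snd i) x) (fst i) else 0)
          * (N * N * \<epsilon>)) \<le> card B" .
    next
      let ?m = "tensor_mult s \<A> \<A> d"
      have bm: "bounded_map ?m"
        by (rule bounded_map_tensor_mult[OF separated AB AB subspace_UNIV d(1)])
      have b: "bounded_map (\<lambda>x. ?m (P \<alpha> x) - P \<alpha> x)"
        by (rule bounded_map_compose_minus[OF bm P_bounded_map[OF \<alpha>] P_bounded_map[OF \<alpha>]])
      have "d (\<lambda>R S. \<Sum>c\<in>B. g c (R (S c))) = (\<Sum>c\<in>B. d (\<lambda>R S. g c (R (S c))))"
        by (intro tensor_form_sum[OF d(1) op op B(1)] form_apply[OF AB AB subspace_UNIV] g)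
      also have "\<dots> = (\<Sum>c\<in>B. g c (?m c))"
        by (intro sum.cong refl dual_tensor_mult[OF separated AB AB subspace_UNIV d(1), symmetric]
            g)
      \<comment> \<open>By biorthogonality the dimension is the trace of the identity, so the
        difference is the trace of \<pi>(d) - I on X_\<alpha>.\<close>
      finally have "d (\<lambda>R S. \<Sum>c\<in>B. g c (R (S c))) - of_nat (card B) = (\<Sum>c\<in>B. g c (?m c))
          - (\<Sum>c\<in>B. g c c)"
        by (simp add: biorth)
      also have "\<dots> = (\<Sum>c\<in>B. g c (?m (P \<alpha> c) - P \<alpha> c))"
      proof -
        have "P \<alpha> c = c" if "c \<in> B" for c using that B(2) P_range[OF \<alpha>, of c] by auto
        then show ?thesis
          using linear_diff[OF bounded_linear.linear[OF dual_space_bounded_linear[OF g]]]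
          by (simp add: sum_subtractf[symmetric])
      qed
      also have "norm \<dots> \<le> (\<Sum>c\<in>B. norm (g c (?m (P \<alpha> c) - P \<alpha> c)))" by (rule norm_sum)
      also have "\<dots> \<le> (\<Sum>c\<in>B. onorm (g c) * (\<eta> * norm c))"
      proof (rule sum_mono)
        fix c assume c: "c \<in> B"
        note bg = dual_spaceD(3)[OF g[OF c]]
        have "norm (?m (P \<alpha> c) - P \<alpha> c) \<le> onorm (\<lambda>x. ?m (P \<alpha> x) - P \<alpha> x) * norm c"
          by (rule norm_le_onorm[OF b])
        also have "\<dots> \<le> \<eta> * norm c" using d\<eta> by (intro mult_right_mono) auto
        finally show "norm (g c (?m (P \<alpha> c) - P \<alpha> c)) \<le> onorm (g c) * (\<eta> * norm c)"
          using order_trans[OF norm_le_onorm[OF bg] mult_left_mono[OF _ onorm_nonneg[OF bg]]]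
            by blast
      qed
      also have "\<dots> = L * \<eta>" by (simp add: L_def sum_distrib_left mult_ac)
      also have "\<dots> \<le> card B / 4"
      proof (cases "B = {}")
        case False
        have "L * \<eta> \<le> 1 / 4" using L by (simp add: \<eta>_def field_simps)
        also have "1 \<le> real (card B)" using False B(1) by (simp add: Suc_le_eq card_gt_0_iff)
        finally show ?thesis by simp
      qed (simp add: L_def)
      finally show "norm (d (\<lambda>R S. \<Sum>c\<in>B. g c (R (S c))) - of_nat (card B)) \<le> card B / 4" .
    qed
  qed
  moreover have "0 < 2 * (N * N * (M + 1) + 1)" using M N by (simp add: add_nonneg_pos)
  ultimately show ?thesis by blast
qed

end

theorem corollary3p3:
  fixes s :: "'k::{real_normed_field, euclidean_space} \<Rightarrow> 'x::banach \<Rightarrow> 'x"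
    and A :: "'i set" and le :: "'i \<Rightarrow> 'i \<Rightarrow> bool"
    and P :: "'i \<Rightarrow> 'x \<Rightarrow> 'x"
  assumes "banach_space_over s"
    and "directed_set A le"
    and "\<And>\<alpha>. \<alpha> \<in> A \<Longrightarrow> P \<alpha> \<in> approximable_ops s"
    and "\<And>\<alpha>. \<alpha> \<in> A \<Longrightarrow> P \<alpha> \<circ> P \<alpha> = P \<alpha>"
    and "\<exists>M. \<forall>\<alpha>\<in>A. onorm (P \<alpha>) \<le> M"
    and "\<And>x. ((\<lambda>\<alpha>. P \<alpha> x) \<longlongrightarrow> x) (tails A le)"
    and "\<And>f. f \<in> dual_space s \<Longrightarrow>
           ((\<lambda>\<alpha>. onorm (\<lambda>x. (f \<circ> P \<alpha>) x - f x)) \<longlongrightarrow> 0) (tails A le)"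
  shows "amenable s (approximable_ops s) \<longleftrightarrow>
    (\<exists>K>0. \<forall>\<alpha>\<in>A. \<exists>\<beta>\<in>A. \<exists>\<Delta>.
       generalized_diagonal s (range (P \<beta>)) (range (P \<alpha>))
         (finite_rank_ops s (range (P \<alpha>)) (range (P \<alpha>))) \<Delta> \<and>
       proj_norm s (finite_rank_ops s (range (P \<beta>)) (range (P \<alpha>)))
         (finite_rank_ops s (range (P \<alpha>)) (range (P \<beta>))) \<Delta> \<le> K)"
proof -
  from assms(5) obtain M where M: "\<forall>\<alpha>\<in>A. onorm (P \<alpha>) \<le> M" by blast
  interpret projection_net s A le P "max 1 M"
  proof
    show "onorm (P \<alpha>) \<le> max 1 M" if "\<alpha> \<in> A" for \<alpha> using M that by (simp add: le_max_iff_disj)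
  qed (use assms in simp_all)
  show ?thesis
    using diagonals_if_amenable amenable_if_diagonals by blast
qed

end
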